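(* Let $C\subset U=U_q(\mathfrak{sl}_2)$ be a right coideal subalgebra such that $C\cap U^0$ is a Hopf subalgebra of $U$. (1) If $C\cap U^0=\mathbb C\cdot 1$, then either $C\subset U^{\ge0}$, or $C\subset U^{\le0}$, or $C=\langle EK^{-1}+\lambda F+\lambda'K^{-1}\rangle$ for some $\lambda,\lambda'\in\mathbb C$, or $C=\langle EK^{-1}+\lambda K^{-1},\,F+\lambda'K^{-1}\rangle$ for some $\lambda,\lambda'\in\mathbb C$ with $\lambda\lambda'=\dfrac{q^2}{(1-q^2)(q-q^{-1})}$. (2) If $C\cap U^0\neq\mathbb C\cdot 1$, then either $C\subset U^{\ge0}$, or $C\subset U^{\le0}$, or $C=\langle EK^{-1},K^2,K^{-2},F\rangle$, or $C=U_q(\mathfrak{sl}_2)$.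
   Context: Let $q\in\mathbb C^\times$ be not a root of unity. $U=U_q(\mathfrak{sl}_2)$ is the $\mathbb C$-algebra generated by $E,F,K,K^{-1}$ with $KK^{-1}=K^{-1}K=1$, $KEK^{-1}=q^2E$, $KFK^{-1}=q^{-2}F$, $EF-FE=\frac{K-K^{-1}}{q-q^{-1}}$, and Hopf algebra structure with $\Delta(E)=E\otimes1+K\otimes E$, $\Delta(F)=F\otimes K^{-1}+1\otimes F$, $\Delta(K)=K\otimes K$. $U^0=\mathbb C[K,K^{-1}]$; $U^{\ge0}$ is the subalgebra generated by $E,K,K^{-1}$ and $U^{\le0}$ the subalgebra generated by $F,K,K^{-1}$. $\langle\cdots\rangle$ denotes the unital subalgebra generated by the listed elements. A right coideal subalgebra is a unital subalgebra $C\subset U$ with $\Delta(C)\subset C\otimes U$. *)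

theory Defs
  imports Complex_Main "HOL-Algebra.Module" "HOL-Algebra.QuotRing" "HOL-Algebra.Subrings"
begin

section \<open>Complex algebras\<close>

text \<open>
  A complex algebra is represented by the record \<^type>\<open>module\<close>: a ring together with a
  scalar multiplication by complex numbers. The ring need not be commutative.
\<close>

definition complex_ring :: "complex ring" where
  "complex_ring = \<lparr>carrier = UNIV, monoid.mult = (*), one = 1, ring.zero = 0, add = (+)\<rparr>"

definition alg_hom ::
    "(complex, 'a, 'm) module_scheme \<Rightarrow> (complex, 'b, 'n) module_scheme \<Rightarrow> ('a \<Rightarrow> 'b) set" where
  "alg_hom A B = {h \<in> ring_hom A B. \<forall>c. \<forall>x\<in>carrier A. h (c \<odot>\<^bsub>A\<^esub> x) = c \<odot>\<^bsub>B\<^esub> h x}"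

definition opposite :: "(complex, 'a) module \<Rightarrow> (complex, 'a) module" where
  "opposite A = A\<lparr>monoid.mult := \<lambda>x y. y \<otimes>\<^bsub>A\<^esub> x\<rparr>"

definition unital_subalgebra :: "(complex, 'a, 'm) module_scheme \<Rightarrow> 'a set \<Rightarrow> bool" where
  "unital_subalgebra A S \<longleftrightarrow> subring S A \<and> submodule S complex_ring A"

definition generated_subalgebra :: "(complex, 'a, 'm) module_scheme \<Rightarrow> 'a set \<Rightarrow> 'a set" where
  "generated_subalgebra A X = unital_subalgebra A hull X"

definition linear_span :: "(complex, 'a, 'm) module_scheme \<Rightarrow> 'a set \<Rightarrow> 'a set" where
  "linear_span A X = (\<lambda>V. submodule V complex_ring A) hull X"

text \<open>The quotient \<open>A / I\<close> of \<^const>\<open>FactRing\<close>, with the induced scalar multiplication on cosets.\<close>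

definition quotient_algebra ::
    "(complex, 'a, 'm) module_scheme \<Rightarrow> 'a set \<Rightarrow> (complex, 'a set) module" where
  "quotient_algebra A I =
     ring.extend (A Quot I) (module.fields (\<lambda>c X. \<Union>x\<in>X. I +>\<^bsub>A\<^esub> (c \<odot>\<^bsub>A\<^esub> x)))"

definition monoid_algebra :: "('m, 'x) monoid_scheme \<Rightarrow> (complex, 'm \<Rightarrow> complex) module" where
  "monoid_algebra M =
     \<lparr>carrier = {f. finite {m. f m \<noteq> 0} \<and> {m. f m \<noteq> 0} \<subseteq> carrier M},
      monoid.mult = (\<lambda>f g m. \<Sum>(a, b) \<in> {(a, b). f a \<noteq> 0 \<and> g b \<noteq> 0 \<and> a \<otimes>\<^bsub>M\<^esub> b = m}. f a * g b),
      one = (\<lambda>m. if m = \<one>\<^bsub>M\<^esub> then 1 else 0),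
      ring.zero = (\<lambda>m. 0),
      add = (\<lambda>f g m. f m + g m),
      smult = (\<lambda>c f m. c * f m)\<rparr>"

definition single :: "'m \<Rightarrow> 'm \<Rightarrow> complex" where
  "single a = (\<lambda>m. if m = a then 1 else 0)"


section \<open>Tensor products of algebras\<close>

text \<open>
  \<open>A \<otimes> B\<close> is the free vector space on \<open>A \<times> B\<close> modulo the bilinearity relations. The free
  vector space carries the product induced by \<open>(a, b) (a', b') = (a a', b b')\<close>, so it is the
  monoid algebra of the product of the multiplicative monoids. The span of the bilinearity
  relations is stable under multiplication by all pairs \<open>(a, b)\<close>, hence equals the ideal
  they generate.
\<close>

definition bilinear_relations ::
    "(complex, 'a) module \<Rightarrow> (complex, 'b) module \<Rightarrow> ('a \<times> 'b \<Rightarrow> complex) set" where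
  "bilinear_relations A B = (let P = monoid_algebra (A \<times>\<times> B) in
     {single (a \<oplus>\<^bsub>A\<^esub> a', b) \<ominus>\<^bsub>P\<^esub> (single (a, b) \<oplus>\<^bsub>P\<^esub> single (a', b)) | a a' b.
        a \<in> carrier A \<and> a' \<in> carrier A \<and> b \<in> carrier B} \<union>
     {single (a, b \<oplus>\<^bsub>B\<^esub> b') \<ominus>\<^bsub>P\<^esub> (single (a, b) \<oplus>\<^bsub>P\<^esub> single (a, b')) | a b b'.
        a \<in> carrier A \<and> b \<in> carrier B \<and> b' \<in> carrier B} \<union>
     {single (c \<odot>\<^bsub>A\<^esub> a, b) \<ominus>\<^bsub>P\<^esub> c \<odot>\<^bsub>P\<^esub> single (a, b) | c a b.
        a \<in> carrier A \<and> b \<in> carrier B} \<union>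
     {single (a, c \<odot>\<^bsub>B\<^esub> b) \<ominus>\<^bsub>P\<^esub> c \<odot>\<^bsub>P\<^esub> single (a, b) | c a b.
        a \<in> carrier A \<and> b \<in> carrier B})"

definition tensor_ideal ::
    "(complex, 'a) module \<Rightarrow> (complex, 'b) module \<Rightarrow> ('a \<times> 'b \<Rightarrow> complex) set" where
  "tensor_ideal A B = Idl\<^bsub>monoid_algebra (A \<times>\<times> B)\<^esub> (bilinear_relations A B)"

definition tensor_algebra ::
    "(complex, 'a) module \<Rightarrow> (complex, 'b) module \<Rightarrow> (complex, ('a \<times> 'b \<Rightarrow> complex) set) module" where
  "tensor_algebra A B = quotient_algebra (monoid_algebra (A \<times>\<times> B)) (tensor_ideal A B)"

definition pure_tensor ::
    "(complex, 'a) module \<Rightarrow> (complex, 'b) module \<Rightarrow> 'a \<Rightarrow> 'b \<Rightarrow> ('a \<times> 'b \<Rightarrow> complex) set" where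
  "pure_tensor A B a b = tensor_ideal A B +>\<^bsub>monoid_algebra (A \<times>\<times> B)\<^esub> single (a, b)"

text \<open>For subspaces \<open>S\<close> of \<open>A\<close> and \<open>T\<close> of \<open>B\<close>, the subspace \<open>S \<otimes> T\<close> of \<open>A \<otimes> B\<close>.\<close>

definition tensor_subspace ::
    "(complex, 'a) module \<Rightarrow> (complex, 'b) module \<Rightarrow> 'a set \<Rightarrow> 'b set \<Rightarrow>
      ('a \<times> 'b \<Rightarrow> complex) set set" where
  "tensor_subspace A B S T =
     linear_span (tensor_algebra A B) {pure_tensor A B s t | s t. s \<in> S \<and> t \<in> T}"


section \<open>Coideal subalgebras and Hopf subalgebras\<close>

text \<open>
  \<open>\<Delta>\<close> and \<open>S\<close> are the comultiplication and the antipode of the Hopf algebra \<open>A\<close>; the counit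
  imposes no closure condition on a Hopf subalgebra.
\<close>

definition right_coideal_subalgebra ::
    "(complex, 'a) module \<Rightarrow> ('a \<Rightarrow> ('a \<times> 'a \<Rightarrow> complex) set) \<Rightarrow> 'a set \<Rightarrow> bool" where
  "right_coideal_subalgebra A \<Delta> C \<longleftrightarrow>
     unital_subalgebra A C \<and> \<Delta> ` C \<subseteq> tensor_subspace A A C (carrier A)"

definition hopf_subalgebra ::
    "(complex, 'a) module \<Rightarrow> ('a \<Rightarrow> ('a \<times> 'a \<Rightarrow> complex) set) \<Rightarrow> ('a \<Rightarrow> 'a) \<Rightarrow> 'a set \<Rightarrow> bool" where
  "hopf_subalgebra A \<Delta> S H \<longleftrightarrow>
     unital_subalgebra A H \<and> \<Delta> ` H \<subseteq> tensor_subspace A A H H \<and> S ` H \<subseteq> H"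


section \<open>The quantum group \<open>U\<^sub>q(sl\<^sub>2)\<close>\<close>

datatype gen = Gen_E | Gen_F | Gen_K | Gen_Kinv

text \<open>The free algebra on the generators is the monoid algebra of the monoid of words.\<close>

definition word_monoid :: "gen list monoid" where
  "word_monoid = \<lparr>carrier = UNIV, monoid.mult = (@), one = []\<rparr>"

abbreviation free_alg :: "(complex, gen list \<Rightarrow> complex) module" where
  "free_alg \<equiv> monoid_algebra word_monoid"

definition Uq_relations :: "complex \<Rightarrow> (gen list \<Rightarrow> complex) set" where
  "Uq_relations q =
    {single [Gen_K, Gen_Kinv] \<ominus>\<^bsub>free_alg\<^esub> single [],
     single [Gen_Kinv, Gen_K] \<ominus>\<^bsub>free_alg\<^esub> single [],
     single [Gen_K, Gen_E, Gen_Kinv] \<ominus>\<^bsub>free_alg\<^esub> q^2 \<odot>\<^bsub>free_alg\<^esub> single [Gen_E],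
     single [Gen_K, Gen_F, Gen_Kinv] \<ominus>\<^bsub>free_alg\<^esub> inverse (q^2) \<odot>\<^bsub>free_alg\<^esub> single [Gen_F],
     (single [Gen_E, Gen_F] \<ominus>\<^bsub>free_alg\<^esub> single [Gen_F, Gen_E])
       \<ominus>\<^bsub>free_alg\<^esub> (1 / (q - inverse q)) \<odot>\<^bsub>free_alg\<^esub> (single [Gen_K] \<ominus>\<^bsub>free_alg\<^esub> single [Gen_Kinv])}"

definition Uq_ideal :: "complex \<Rightarrow> (gen list \<Rightarrow> complex) set" where
  "Uq_ideal q = Idl\<^bsub>free_alg\<^esub> (Uq_relations q)"

type_synonym uq = "(gen list \<Rightarrow> complex) set"

definition Uq :: "complex \<Rightarrow> (complex, uq) module" where
  "Uq q = quotient_algebra free_alg (Uq_ideal q)"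

definition Uq_gen :: "complex \<Rightarrow> gen \<Rightarrow> uq" where
  "Uq_gen q g = Uq_ideal q +>\<^bsub>free_alg\<^esub> single [g]"

abbreviation UE :: "complex \<Rightarrow> uq" where "UE q \<equiv> Uq_gen q Gen_E"
abbreviation UF :: "complex \<Rightarrow> uq" where "UF q \<equiv> Uq_gen q Gen_F"
abbreviation UK :: "complex \<Rightarrow> uq" where "UK q \<equiv> Uq_gen q Gen_K"
abbreviation UKinv :: "complex \<Rightarrow> uq" where "UKinv q \<equiv> Uq_gen q Gen_Kinv"

definition U_zero :: "complex \<Rightarrow> uq set" where
  "U_zero q = generated_subalgebra (Uq q) {UK q, UKinv q}"

definition U_ge0 :: "complex \<Rightarrow> uq set" where
  "U_ge0 q = generated_subalgebra (Uq q) {UE q, UK q, UKinv q}"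

definition U_le0 :: "complex \<Rightarrow> uq set" where
  "U_le0 q = generated_subalgebra (Uq q) {UF q, UK q, UKinv q}"

abbreviation UU :: "complex \<Rightarrow> (complex, (uq \<times> uq \<Rightarrow> complex) set) module" where
  "UU q \<equiv> tensor_algebra (Uq q) (Uq q)"

abbreviation UU_pure :: "complex \<Rightarrow> uq \<Rightarrow> uq \<Rightarrow> (uq \<times> uq \<Rightarrow> complex) set" where
  "UU_pure q \<equiv> pure_tensor (Uq q) (Uq q)"

text \<open>
  The comultiplication and the antipode are determined on the carrier of \<^term>\<open>Uq q\<close>
  by their values on generators, the value at \<open>K\<^sup>-\<^sup>1\<close> being forced by the one at \<open>K\<close>;
  outside the carrier they are arbitrary. The antipode is the anti-homomorphism with
  \<open>S(E) = -K\<^sup>-\<^sup>1 E\<close>, \<open>S(F) = -F K\<close>, \<open>S(K) = K\<^sup>-\<^sup>1\<close>, which is the one forced by \<open>\<Delta>\<close>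
  (with \<open>\<epsilon>(E) = \<epsilon>(F) = 0\<close>, \<open>\<epsilon>(K) = 1\<close>).
\<close>

definition is_Uq_comult :: "complex \<Rightarrow> (uq \<Rightarrow> (uq \<times> uq \<Rightarrow> complex) set) \<Rightarrow> bool" where
  "is_Uq_comult q \<Delta> \<longleftrightarrow> \<Delta> \<in> alg_hom (Uq q) (UU q) \<and>
     \<Delta> (UE q) = UU_pure q (UE q) \<one>\<^bsub>Uq q\<^esub> \<oplus>\<^bsub>UU q\<^esub> UU_pure q (UK q) (UE q) \<and>
     \<Delta> (UF q) = UU_pure q (UF q) (UKinv q) \<oplus>\<^bsub>UU q\<^esub> UU_pure q \<one>\<^bsub>Uq q\<^esub> (UF q) \<and>
     \<Delta> (UK q) = UU_pure q (UK q) (UK q)"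

definition Uq_comult :: "complex \<Rightarrow> uq \<Rightarrow> (uq \<times> uq \<Rightarrow> complex) set" where
  "Uq_comult q = (SOME \<Delta>. is_Uq_comult q \<Delta>)"

definition is_Uq_antipode :: "complex \<Rightarrow> (uq \<Rightarrow> uq) \<Rightarrow> bool" where
  "is_Uq_antipode q S \<longleftrightarrow> S \<in> alg_hom (Uq q) (opposite (Uq q)) \<and>
     S (UE q) = \<ominus>\<^bsub>Uq q\<^esub> (UKinv q \<otimes>\<^bsub>Uq q\<^esub> UE q) \<and>
     S (UF q) = \<ominus>\<^bsub>Uq q\<^esub> (UF q \<otimes>\<^bsub>Uq q\<^esub> UK q) \<and>
     S (UK q) = UKinv q"

definition Uq_antipode :: "complex \<Rightarrow> uq \<Rightarrow> uq" where
  "Uq_antipode q = (SOME S. is_Uq_antipode q S)"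

end

(* A right coideal is stable under (id \<otimes> f) \<circ> \<Delta> for every linear functional f. In the PBW basis X^a Y^b K^d with
   X = E K^-1 and Y = F, the coefficient functionals at K^e, X K^e and Y K^e yield a grading of C by d - a - b and two
   skew derivations that lower the degree a + b. Applying them to an element of degree m turns each top coefficient
   into a power of K in C. If C meets U^0 trivially, all top terms are therefore X^a Y^b with d = 0, and the
   space of degree-one symbols, of dimension at most two, decides C: for dimension one the derivations determine the top
   part of an element by one coefficient, so C is generated by one element, and for dimension two the q-commutator of the
   two generators lies in U^0, which forces the relation between \<lambda> and \<lambda>'. If some K^n with n > 0 lies in C,
   conjugation by it splits C into weight spaces for a - b, from which X, Y and hence K^2, K^-2 are extracted. *)

theory Submission
  imports Defs
begin

section \<open>Complex algebras: subalgebras, monoid algebras, quotients, operators\<close>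

section \<open>Complex algebras\<close>

text \<open>Both U and its tensor square are quotients by generated ideals, so neither the
  independence of monomials nor the coefficients of a tensor can be read off. Independence comes
  from an explicit action of U on all functions on N x N x Z, evaluated at the coordinates of 1.
  Tensor coefficients come from bilinear forms, which vanish on the ideal of bilinearity relations.
  After that a subalgebra is treated only through its set of coordinate functions. X = E K^-1
  replaces E because Delta(X) is the sum of X tensor K^-1 and 1 tensor X, the same shape as
  Delta(F): the left tensor factor then keeps the power of K of the original monomial. The monomials
  X, F and K^-1 are exactly those with a + b at most one and d - a - b = -1; this is why K^-1 is the
  only lower term in the generators of the classification. The antipode enters through K^d to K^-d,
  which makes conjugation by powers of K available inside C.\<close>

locale complex_algebra = ring A for A :: "(complex, 'a, 'm) module_scheme" (structure) +
  assumes smult_closed [simp, intro]: "x \<in> carrier A \<Longrightarrow> c \<odot> x \<in> carrier A"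
    and smult_l_distr: "x \<in> carrier A \<Longrightarrow> (c + d) \<odot> x = c \<odot> x \<oplus> d \<odot> x"
    and smult_r_distr: "x \<in> carrier A \<Longrightarrow> y \<in> carrier A \<Longrightarrow> c \<odot> (x \<oplus> y) = c \<odot> x \<oplus> c \<odot> y"
    and smult_smult: "x \<in> carrier A \<Longrightarrow> c \<odot> (d \<odot> x) = (c * d) \<odot> x"
    and smult_one [simp]: "x \<in> carrier A \<Longrightarrow> 1 \<odot> x = x"
    and smult_mult_left: "x \<in> carrier A \<Longrightarrow> y \<in> carrier A \<Longrightarrow> (c \<odot> x) \<otimes> y = c \<odot> (x \<otimes> y)"
    and smult_mult_right: "x \<in> carrier A \<Longrightarrow> y \<in> carrier A \<Longrightarrow> x \<otimes> (c \<odot> y) = c \<odot> (x \<otimes> y)"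
begin

lemma smult_zero_left [simp]: "x \<in> carrier A \<Longrightarrow> 0 \<odot> x = \<zero>"
  using smult_l_distr[of x 0 0] add.l_cancel_one'[of "0 \<odot> x" "0 \<odot> x"] by simp

lemma smult_zero_right [simp]: "c \<odot> \<zero> = \<zero>"
  using smult_r_distr[of \<zero> \<zero> c] add.l_cancel_one'[of "c \<odot> \<zero>" "c \<odot> \<zero>"] by simp

lemma minus_smult: "x \<in> carrier A \<Longrightarrow> (- c) \<odot> x = \<ominus> (c \<odot> x)"
  using smult_l_distr[of x "- c" c] by (metis add.inv_equality add.left_inverse smult_closed smult_zero_left)

lemma minus_eq_smult: "x \<in> carrier A \<Longrightarrow> \<ominus> x = (-1) \<odot> x"
  by (simp add: minus_smult)

lemma diff_eq_smult: "x \<in> carrier A \<Longrightarrow> y \<in> carrier A \<Longrightarrow> x \<ominus> y = x \<oplus> (-1) \<odot> y"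
  by (simp add: minus_eq minus_eq_smult)

lemma smult_minus: "x \<in> carrier A \<Longrightarrow> c \<odot> (\<ominus> x) = (- c) \<odot> x"
  by (simp add: minus_eq_smult smult_smult)

lemma submoduleI':
  assumes "S \<subseteq> carrier A" "\<zero> \<in> S" "\<And>x y. x \<in> S \<Longrightarrow> y \<in> S \<Longrightarrow> x \<oplus> y \<in> S"
    "\<And>c x. x \<in> S \<Longrightarrow> c \<odot> x \<in> S"
  shows "submodule S complex_ring A"
proof (intro submodule.intro submodule_axioms.intro subgroup.intro)
  fix x assume "x \<in> S"
  then have "\<ominus> x \<in> S" using assms minus_eq_smult by auto
  then show "inv\<^bsub>add_monoid A\<^esub> x \<in> S" by (simp add: a_inv_def)
qed (use assms in \<open>auto simp: complex_ring_def\<close>)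

lemma unital_subalgebraI:
  assumes "S \<subseteq> carrier A" "\<one> \<in> S" "\<And>x y. x \<in> S \<Longrightarrow> y \<in> S \<Longrightarrow> x \<oplus> y \<in> S"
    "\<And>c x. x \<in> S \<Longrightarrow> c \<odot> x \<in> S" "\<And>x y. x \<in> S \<Longrightarrow> y \<in> S \<Longrightarrow> x \<otimes> y \<in> S"
  shows "unital_subalgebra A S"
  unfolding unital_subalgebra_def
proof
  have z: "\<zero> \<in> S" using assms(1,2) assms(4)[of \<one> 0] by auto
  show "submodule S complex_ring A" by (rule submoduleI') (use assms z in auto)
  show "subring S A"
    by (rule subringI) (use assms minus_eq_smult in auto)
qed

end

lemma submoduleD:
  assumes "submodule S complex_ring A"
  shows "S \<subseteq> carrier A" "\<zero>\<^bsub>A\<^esub> \<in> S" "\<And>x y. x \<in> S \<Longrightarrow> y \<in> S \<Longrightarrow> x \<oplus>\<^bsub>A\<^esub> y \<in> S"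
    "\<And>c x. x \<in> S \<Longrightarrow> c \<odot>\<^bsub>A\<^esub> x \<in> S"
proof -
  interpret submodule S complex_ring A by fact
  show "S \<subseteq> carrier A" "\<zero>\<^bsub>A\<^esub> \<in> S" "\<And>x y. x \<in> S \<Longrightarrow> y \<in> S \<Longrightarrow> x \<oplus>\<^bsub>A\<^esub> y \<in> S"
    using subset one_closed m_closed by simp_all
  show "\<And>c x. x \<in> S \<Longrightarrow> c \<odot>\<^bsub>A\<^esub> x \<in> S" using smult_closed by (simp add: complex_ring_def)
qed

lemma unital_subalgebraD:
  assumes "unital_subalgebra A S"
  shows "S \<subseteq> carrier A" "\<zero>\<^bsub>A\<^esub> \<in> S" "\<one>\<^bsub>A\<^esub> \<in> S" "\<And>x y. x \<in> S \<Longrightarrow> y \<in> S \<Longrightarrow> x \<oplus>\<^bsub>A\<^esub> y \<in> S"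
    "\<And>c x. x \<in> S \<Longrightarrow> c \<odot>\<^bsub>A\<^esub> x \<in> S" "\<And>x y. x \<in> S \<Longrightarrow> y \<in> S \<Longrightarrow> x \<otimes>\<^bsub>A\<^esub> y \<in> S"
proof -
  have s: "subring S A" "submodule S complex_ring A" using assms by (auto simp: unital_subalgebra_def)
  interpret subring S A by fact
  show "\<one>\<^bsub>A\<^esub> \<in> S" "\<And>x y. x \<in> S \<Longrightarrow> y \<in> S \<Longrightarrow> x \<otimes>\<^bsub>A\<^esub> y \<in> S" by auto
qed (use assms submoduleD in \<open>auto simp: unital_subalgebra_def\<close>)

lemma generated_subalgebra_minimal:
  "unital_subalgebra A S \<Longrightarrow> X \<subseteq> S \<Longrightarrow> generated_subalgebra A X \<subseteq> S"
  unfolding generated_subalgebra_def by (rule hull_minimal)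

lemma alg_homD:
  assumes "h \<in> alg_hom A B"
  shows "x \<in> carrier A \<Longrightarrow> h x \<in> carrier B"
    "x \<in> carrier A \<Longrightarrow> y \<in> carrier A \<Longrightarrow> h (x \<oplus>\<^bsub>A\<^esub> y) = h x \<oplus>\<^bsub>B\<^esub> h y"
    "x \<in> carrier A \<Longrightarrow> y \<in> carrier A \<Longrightarrow> h (x \<otimes>\<^bsub>A\<^esub> y) = h x \<otimes>\<^bsub>B\<^esub> h y"
    "h \<one>\<^bsub>A\<^esub> = \<one>\<^bsub>B\<^esub>"
    "x \<in> carrier A \<Longrightarrow> h (c \<odot>\<^bsub>A\<^esub> x) = c \<odot>\<^bsub>B\<^esub> h x"
  using assms ring_hom_closed[of h A B] ring_hom_add[of h A B] ring_hom_mult[of h A B] ring_hom_one[of h A B]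
  by (auto simp: alg_hom_def)

lemma alg_hom_diff:
  assumes "h \<in> alg_hom A B" "complex_algebra A" "complex_algebra B" "x \<in> carrier A" "y \<in> carrier A"
  shows "h (x \<ominus>\<^bsub>A\<^esub> y) = h x \<ominus>\<^bsub>B\<^esub> h y"
proof -
  interpret A: complex_algebra A by fact
  interpret B: complex_algebra B by fact
  show ?thesis using assms(4,5) alg_homD[OF assms(1)]
    by (simp add: A.diff_eq_smult B.diff_eq_smult)
qed

lemma alg_hom_ring_hom_ring:
  assumes "h \<in> alg_hom A B" "complex_algebra A" "complex_algebra B"
  shows "ring_hom_ring A B h"
  using assms unfolding alg_hom_def complex_algebra_def by (auto intro: ring_hom_ringI2)

lemma complex_algebraI:
  fixes A :: "(complex, 'a, 'm) module_scheme"
  assumes "ring A"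
    and "\<And>c x. x \<in> carrier A \<Longrightarrow> c \<odot>\<^bsub>A\<^esub> x \<in> carrier A"
    and "\<And>c d x. x \<in> carrier A \<Longrightarrow> (c + d) \<odot>\<^bsub>A\<^esub> x = c \<odot>\<^bsub>A\<^esub> x \<oplus>\<^bsub>A\<^esub> d \<odot>\<^bsub>A\<^esub> x"
    and "\<And>c x y. x \<in> carrier A \<Longrightarrow> y \<in> carrier A \<Longrightarrow> c \<odot>\<^bsub>A\<^esub> (x \<oplus>\<^bsub>A\<^esub> y) = c \<odot>\<^bsub>A\<^esub> x \<oplus>\<^bsub>A\<^esub> c \<odot>\<^bsub>A\<^esub> y"
    and "\<And>c d x. x \<in> carrier A \<Longrightarrow> c \<odot>\<^bsub>A\<^esub> (d \<odot>\<^bsub>A\<^esub> x) = (c * d) \<odot>\<^bsub>A\<^esub> x"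
    and "\<And>x. x \<in> carrier A \<Longrightarrow> 1 \<odot>\<^bsub>A\<^esub> x = x"
    and "\<And>c x y. x \<in> carrier A \<Longrightarrow> y \<in> carrier A \<Longrightarrow> (c \<odot>\<^bsub>A\<^esub> x) \<otimes>\<^bsub>A\<^esub> y = c \<odot>\<^bsub>A\<^esub> (x \<otimes>\<^bsub>A\<^esub> y)"
    and "\<And>c x y. x \<in> carrier A \<Longrightarrow> y \<in> carrier A \<Longrightarrow> x \<otimes>\<^bsub>A\<^esub> (c \<odot>\<^bsub>A\<^esub> y) = c \<odot>\<^bsub>A\<^esub> (x \<otimes>\<^bsub>A\<^esub> y)"
  shows "complex_algebra A"
  using assms by (intro complex_algebra.intro complex_algebra_axioms.intro) auto

subsection \<open>Monoid algebras\<close>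

text \<open>The pairing of \<open>f\<close> with an arbitrary function \<open>h\<close>. Identities
  in the monoid algebra are tested against all \<open>h\<close>, which avoids handling the
  convolution sum directly.\<close>

definition support_sum :: "('m \<Rightarrow> complex) \<Rightarrow> ('m \<Rightarrow> complex) \<Rightarrow> complex" where
  "support_sum h f = (\<Sum>a | f a \<noteq> 0. f a * h a)"

lemma support_sum_superset:
  assumes "finite S" "{a. f a \<noteq> 0} \<subseteq> S"
  shows "support_sum h f = (\<Sum>a\<in>S. f a * h a)"
  unfolding support_sum_def by (rule sum.mono_neutral_left) (use assms in auto)

lemma support_sum_add:
  assumes "finite {a. f a \<noteq> 0}" "finite {a. g a \<noteq> 0}"
  shows "support_sum h (\<lambda>a. f a + g a) = support_sum h f + support_sum h g"
proof -
  let ?S = "{a. f a \<noteq> 0} \<union> {a. g a \<noteq> 0}"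
  have "finite ?S" using assms by auto
  then show ?thesis
    using support_sum_superset[of ?S f h] support_sum_superset[of ?S g h]
    by (subst support_sum_superset[of ?S]) (auto simp: sum.distrib distrib_right)
qed

lemma support_sum_smult:
  assumes "finite {a. f a \<noteq> 0}"
  shows "support_sum h (\<lambda>a. c * f a) = c * support_sum h f"
  using support_sum_superset[of "{a. f a \<noteq> 0}" f h]
    support_sum_superset[of "{a. f a \<noteq> 0}" "\<lambda>a. c * f a" h] assms
  by (auto simp: sum_distrib_left mult.assoc)

lemma support_sum_delta:
  assumes "finite {a. f a \<noteq> 0}"
  shows "support_sum (\<lambda>a. if a = m then 1 else 0) f = f m"
  using assms by (auto simp: support_sum_def if_distrib[of "\<lambda>x. _ * x"] sum.delta cong: if_cong)

lemma support_sum_single: "support_sum h (single a) = h a"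
  using support_sum_superset[of "{a}" "single a" h] by (auto simp: single_def)

lemma monoid_algebra_mult_support:
  assumes "f \<in> carrier (monoid_algebra M)" "g \<in> carrier (monoid_algebra M)"
  shows "{m. (f \<otimes>\<^bsub>monoid_algebra M\<^esub> g) m \<noteq> 0} \<subseteq> (\<lambda>(a, b). a \<otimes>\<^bsub>M\<^esub> b) ` ({a. f a \<noteq> 0} \<times> {b. g b \<noteq> 0})"
    (is "?L \<subseteq> ?R")
proof
  fix m assume "m \<in> ?L"
  then have "(\<Sum>(a, b)\<in>{(a, b). f a \<noteq> 0 \<and> g b \<noteq> 0 \<and> a \<otimes>\<^bsub>M\<^esub> b = m}. f a * g b) \<noteq> 0"
    by (simp add: monoid_algebra_def)
  then obtain p where "p \<in> {(a, b). f a \<noteq> 0 \<and> g b \<noteq> 0 \<and> a \<otimes>\<^bsub>M\<^esub> b = m}"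
    using sum.not_neutral_contains_not_neutral by meson
  then show "m \<in> ?R" by force
qed

text \<open>Grouping the pairs \<open>(a, b)\<close> by their product gives the convolution, so
  pairing a product with \<open>h\<close> unfolds into an iterated pairing.\<close>

lemma support_sum_mult:
  assumes "f \<in> carrier (monoid_algebra M)" "g \<in> carrier (monoid_algebra M)"
  shows "support_sum h (f \<otimes>\<^bsub>monoid_algebra M\<^esub> g) =
    support_sum (\<lambda>a. support_sum (\<lambda>b. h (a \<otimes>\<^bsub>M\<^esub> b)) g) f"
proof -
  let ?F = "{a. f a \<noteq> 0}" and ?G = "{b. g b \<noteq> 0}"
  let ?P = "\<lambda>(a, b). a \<otimes>\<^bsub>M\<^esub> b"
  let ?S = "?P ` (?F \<times> ?G)"
  have fin: "finite ?F" "finite ?G" using assms by (auto simp: monoid_algebra_def)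
  then have finS: "finite ?S" by auto
  have "support_sum h (f \<otimes>\<^bsub>monoid_algebra M\<^esub> g) = (\<Sum>m\<in>?S. (f \<otimes>\<^bsub>monoid_algebra M\<^esub> g) m * h m)"
    by (rule support_sum_superset[OF finS monoid_algebra_mult_support[OF assms]])
  also have "\<dots> = (\<Sum>m\<in>?S. \<Sum>x\<in>{x \<in> ?F \<times> ?G. ?P x = m}. f (fst x) * g (snd x) * h (?P x))"
  proof (rule sum.cong[OF refl])
    fix m
    have "{(a, b). f a \<noteq> 0 \<and> g b \<noteq> 0 \<and> a \<otimes>\<^bsub>M\<^esub> b = m} = {x \<in> ?F \<times> ?G. ?P x = m}" by auto
    then show "(f \<otimes>\<^bsub>monoid_algebra M\<^esub> g) m * h m =
        (\<Sum>x\<in>{x \<in> ?F \<times> ?G. ?P x = m}. f (fst x) * g (snd x) * h (?P x))"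
      by (auto simp: monoid_algebra_def sum_distrib_right case_prod_beta intro!: sum.cong)
  qed
  also have "\<dots> = (\<Sum>x\<in>?F \<times> ?G. f (fst x) * g (snd x) * h (?P x))"
    by (rule sum.group) (use fin in auto)
  also have "\<dots> = (\<Sum>a\<in>?F. \<Sum>b\<in>?G. f a * g b * h (a \<otimes>\<^bsub>M\<^esub> b))"
    by (simp add: sum.cartesian_product case_prod_beta)
  finally show ?thesis by (simp add: support_sum_def sum_distrib_left mult.assoc)
qed

lemma support_sum_cong: "(\<And>a. f a \<noteq> 0 \<Longrightarrow> h a = h' a) \<Longrightarrow> support_sum h f = support_sum h' f"
  unfolding support_sum_def by (rule sum.cong) auto

lemma monoid_algebra_eqI:
  assumes "f \<in> carrier (monoid_algebra M)" "g \<in> carrier (monoid_algebra M)"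
    and "\<And>h. support_sum h f = support_sum h g"
  shows "f = g"
proof
  fix m show "f m = g m"
    using assms support_sum_delta[of f m] support_sum_delta[of g m] by (auto simp: monoid_algebra_def)
qed

lemma support_sum_linear:
  assumes "finite {a. f a \<noteq> 0}"
  shows "support_sum (\<lambda>a. h a + h' a) f = support_sum h f + support_sum h' f"
    "support_sum (\<lambda>a. c * h a) f = c * support_sum h f"
  by (simp_all add: support_sum_def sum.distrib distrib_left sum_distrib_left mult.left_commute)

lemma monoid_algebra_simps:
  "carrier (monoid_algebra M) = {f. finite {m. f m \<noteq> 0} \<and> {m. f m \<noteq> 0} \<subseteq> carrier M}"
  "\<one>\<^bsub>monoid_algebra M\<^esub> = single \<one>\<^bsub>M\<^esub>"
  "\<zero>\<^bsub>monoid_algebra M\<^esub> = (\<lambda>m. 0)"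
  "f \<oplus>\<^bsub>monoid_algebra M\<^esub> g = (\<lambda>m. f m + g m)"
  "c \<odot>\<^bsub>monoid_algebra M\<^esub> f = (\<lambda>m. c * f m)"
  by (auto simp: monoid_algebra_def single_def)

lemma monoid_algebra_zero_closed: "(\<lambda>m. 0) \<in> carrier (monoid_algebra M)"
  by (simp add: monoid_algebra_simps)

lemma finite_nonzero_add:
  "finite {m. f m \<noteq> (0::complex)} \<Longrightarrow> finite {m. g m \<noteq> 0} \<Longrightarrow> finite {m. f m + g m \<noteq> 0}"
  by (rule finite_subset[of _ "{m. f m \<noteq> 0} \<union> {m. g m \<noteq> 0}"]) auto

lemma monoid_algebra_closed:
  assumes "f \<in> carrier (monoid_algebra M)" "g \<in> carrier (monoid_algebra M)"
  shows "f \<oplus>\<^bsub>monoid_algebra M\<^esub> g \<in> carrier (monoid_algebra M)"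
    "c \<odot>\<^bsub>monoid_algebra M\<^esub> f \<in> carrier (monoid_algebra M)"
    "\<zero>\<^bsub>monoid_algebra M\<^esub> \<in> carrier (monoid_algebra M)"
    "monoid M \<Longrightarrow> f \<otimes>\<^bsub>monoid_algebra M\<^esub> g \<in> carrier (monoid_algebra M)"
proof -
  have fin: "finite {m. f m \<noteq> 0}" "finite {m. g m \<noteq> 0}" "{m. f m \<noteq> 0} \<subseteq> carrier M" "{m. g m \<noteq> 0} \<subseteq> carrier M"
    using assms by (auto simp: monoid_algebra_simps)
  show "f \<oplus>\<^bsub>monoid_algebra M\<^esub> g \<in> carrier (monoid_algebra M)"
    using fin finite_nonzero_add[of f g]
    by (auto simp: monoid_algebra_simps) (metis (mono_tags, lifting) add.right_neutral in_mono mem_Collect_eq)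
  show "c \<odot>\<^bsub>monoid_algebra M\<^esub> f \<in> carrier (monoid_algebra M)"
    using fin by (auto simp: monoid_algebra_simps intro: finite_subset[of _ "{m. f m \<noteq> 0}"])
  show "\<zero>\<^bsub>monoid_algebra M\<^esub> \<in> carrier (monoid_algebra M)" by (simp add: monoid_algebra_simps)
  assume "monoid M"
  then interpret monoid M .
  have "(\<lambda>(a, b). a \<otimes>\<^bsub>M\<^esub> b) ` ({a. f a \<noteq> 0} \<times> {b. g b \<noteq> 0}) \<subseteq> carrier M"
    using fin by auto
  then show "f \<otimes>\<^bsub>monoid_algebra M\<^esub> g \<in> carrier (monoid_algebra M)"
    using monoid_algebra_mult_support[OF assms] fin
    by (simp add: monoid_algebra_simps) (meson finite_SigmaI finite_imageI finite_subset order_trans)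
qed

lemma single_closed: "a \<in> carrier M \<Longrightarrow> single a \<in> carrier (monoid_algebra M)"
  by (auto simp: monoid_algebra_simps single_def)

lemma support_sum_ops:
  assumes "f \<in> carrier (monoid_algebra M)"
  shows "g \<in> carrier (monoid_algebra M) \<Longrightarrow> support_sum h (f \<oplus>\<^bsub>monoid_algebra M\<^esub> g) = support_sum h f + support_sum h g"
    "support_sum h (c \<odot>\<^bsub>monoid_algebra M\<^esub> f) = c * support_sum h f"
  using assms by (auto simp: monoid_algebra_simps intro: support_sum_add support_sum_smult)

lemma support_sum_zero: "support_sum h \<zero>\<^bsub>monoid_algebra M\<^esub> = 0"
  by (simp add: support_sum_def monoid_algebra_simps)

text \<open>The laws for products are tested by pairing: by \<open>support_sum_mult\<close> both
  bracketings of a triple product become the same iterated sum, up to associativity in the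
  monoid.\<close>

lemma complex_algebra_monoid_algebra:
  assumes "monoid M"
  shows "complex_algebra (monoid_algebra M)"
proof -
  interpret monoid M by fact
  let ?P = "monoid_algebra M"
  note cl = monoid_algebra_closed[where M = M, OF _ _] monoid_algebra_closed(4)[OF _ _ assms]
  have fin: "finite {m. f m \<noteq> 0}" if "f \<in> carrier ?P" for f
    using that by (simp add: monoid_algebra_simps)
  have sub: "a \<in> carrier M" if "f \<in> carrier ?P" "f a \<noteq> 0" for f a
    using that by (auto simp: monoid_algebra_simps)
  note ss = support_sum_mult support_sum_ops support_sum_linear[OF fin] support_sum_single
  show ?thesis
  proof (rule complex_algebraI)
    show "ring ?P"
    proof (rule ringI)
      show "abelian_group ?P"
      proof (rule abelian_groupI)
        fix f assume f: "f \<in> carrier ?P"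
        show "\<exists>g\<in>carrier ?P. g \<oplus>\<^bsub>?P\<^esub> f = \<zero>\<^bsub>?P\<^esub>"
          by (rule bexI[of _ "(-1) \<odot>\<^bsub>?P\<^esub> f"]) (use f monoid_algebra_closed(2)[OF f f, of "-1"] in \<open>auto simp: monoid_algebra_simps(3-5)\<close>)
      qed (use cl in \<open>auto simp: monoid_algebra_simps(3-5) monoid_algebra_zero_closed\<close>)
      show "monoid ?P"
      proof (rule monoidI)
        show "\<one>\<^bsub>?P\<^esub> \<in> carrier ?P" by (simp add: monoid_algebra_simps(2) single_closed)
        fix f g h assume fgh: "f \<in> carrier ?P" "g \<in> carrier ?P" "h \<in> carrier ?P"
        show "f \<otimes>\<^bsub>?P\<^esub> g \<otimes>\<^bsub>?P\<^esub> h = f \<otimes>\<^bsub>?P\<^esub> (g \<otimes>\<^bsub>?P\<^esub> h)"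
        proof (rule monoid_algebra_eqI[of _ M])
          fix k show "support_sum k (f \<otimes>\<^bsub>?P\<^esub> g \<otimes>\<^bsub>?P\<^esub> h) = support_sum k (f \<otimes>\<^bsub>?P\<^esub> (g \<otimes>\<^bsub>?P\<^esub> h))"
            using fgh cl by (simp add: support_sum_mult)
              (intro support_sum_cong, simp add: sub m_assoc)
        qed (use fgh cl in auto)
      next
        fix f assume f: "f \<in> carrier ?P"
        have o: "single \<one>\<^bsub>M\<^esub> \<in> carrier ?P" by (simp add: single_closed)
        show "\<one>\<^bsub>?P\<^esub> \<otimes>\<^bsub>?P\<^esub> f = f"
        proof (rule monoid_algebra_eqI[of _ M])
          fix k show "support_sum k (\<one>\<^bsub>?P\<^esub> \<otimes>\<^bsub>?P\<^esub> f) = support_sum k f"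
            using f o sub by (auto simp: monoid_algebra_simps(2) support_sum_mult support_sum_single intro!: support_sum_cong)
        qed (use f o cl in \<open>auto simp: monoid_algebra_simps(2)\<close>)
        show "f \<otimes>\<^bsub>?P\<^esub> \<one>\<^bsub>?P\<^esub> = f"
        proof (rule monoid_algebra_eqI[of _ M])
          fix k show "support_sum k (f \<otimes>\<^bsub>?P\<^esub> \<one>\<^bsub>?P\<^esub>) = support_sum k f"
            using f o sub by (auto simp: monoid_algebra_simps(2) support_sum_mult support_sum_single intro!: support_sum_cong)
        qed (use f o cl in \<open>auto simp: monoid_algebra_simps(2)\<close>)
      qed (use cl in auto)
      fix f g h assume fgh: "f \<in> carrier ?P" "g \<in> carrier ?P" "h \<in> carrier ?P"
      show "(f \<oplus>\<^bsub>?P\<^esub> g) \<otimes>\<^bsub>?P\<^esub> h = f \<otimes>\<^bsub>?P\<^esub> h \<oplus>\<^bsub>?P\<^esub> g \<otimes>\<^bsub>?P\<^esub> h"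
        by (rule monoid_algebra_eqI[of _ M]) (use fgh cl in \<open>simp_all add: ss\<close>)
      show "h \<otimes>\<^bsub>?P\<^esub> (f \<oplus>\<^bsub>?P\<^esub> g) = h \<otimes>\<^bsub>?P\<^esub> f \<oplus>\<^bsub>?P\<^esub> h \<otimes>\<^bsub>?P\<^esub> g"
        by (rule monoid_algebra_eqI[of _ M]) (use fgh cl in \<open>simp_all add: ss\<close>)
    qed
    fix c f g assume fg: "f \<in> carrier ?P" "g \<in> carrier ?P"
    show "c \<odot>\<^bsub>?P\<^esub> f \<otimes>\<^bsub>?P\<^esub> g = c \<odot>\<^bsub>?P\<^esub> (f \<otimes>\<^bsub>?P\<^esub> g)"
      by (rule monoid_algebra_eqI[of _ M]) (use fg cl in \<open>simp_all add: ss\<close>)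
    show "f \<otimes>\<^bsub>?P\<^esub> (c \<odot>\<^bsub>?P\<^esub> g) = c \<odot>\<^bsub>?P\<^esub> (f \<otimes>\<^bsub>?P\<^esub> g)"
      by (rule monoid_algebra_eqI[of _ M]) (use fg cl in \<open>simp_all add: ss\<close>)
  qed (use cl in \<open>auto simp: monoid_algebra_simps(3-5) algebra_simps\<close>)
qed

lemma single_mult:
  assumes "monoid M" "a \<in> carrier M" "b \<in> carrier M"
  shows "single a \<otimes>\<^bsub>monoid_algebra M\<^esub> single b = single (a \<otimes>\<^bsub>M\<^esub> b)"
proof -
  interpret monoid M by fact
  show ?thesis
    by (rule monoid_algebra_eqI[of _ M])
      (use assms in \<open>auto simp: support_sum_mult single_closed support_sum_single
        intro!: monoid_algebra_closed(4)\<close>)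
qed

lemma monoid_algebra_induct [consumes 1, case_names zero add]:
  assumes "f \<in> carrier (monoid_algebra M)"
    and zero: "P \<zero>\<^bsub>monoid_algebra M\<^esub>"
    and add: "\<And>c a f. a \<in> carrier M \<Longrightarrow> f \<in> carrier (monoid_algebra M) \<Longrightarrow> P f \<Longrightarrow>
      P (c \<odot>\<^bsub>monoid_algebra M\<^esub> single a \<oplus>\<^bsub>monoid_algebra M\<^esub> f)"
  shows "P f"
proof -
  have "finite {m. f m \<noteq> 0}" using assms(1) by (simp add: monoid_algebra_simps)
  then have "f \<in> carrier (monoid_algebra M) \<Longrightarrow> P f"
  proof (induction "{m. f m \<noteq> 0}" arbitrary: f rule: finite_induct)
    case empty
    then have "f = (\<lambda>m. 0)" by auto
    then show ?case using zero by (simp add: monoid_algebra_simps)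
  next
    case (insert a F)
    let ?g = "f(a := 0)"
    have F: "F = {m. ?g m \<noteq> 0}" using insert by auto
    have a: "a \<in> carrier M" using insert by (auto simp: monoid_algebra_simps)
    have g: "?g \<in> carrier (monoid_algebra M)"
      using insert.prems by (auto simp: monoid_algebra_simps intro: finite_subset[of _ "{m. f m \<noteq> 0}"])
    have "f = f a \<odot>\<^bsub>monoid_algebra M\<^esub> single a \<oplus>\<^bsub>monoid_algebra M\<^esub> ?g"
      by (auto simp: monoid_algebra_simps single_def)
    then show ?case using add[OF a g insert.hyps(3)[OF F g], of "f a"] by simp
  qed
  then show ?thesis using assms(1) by blast
qed

context complex_algebra
begin

definition linear_ext :: "('w \<Rightarrow> 'a) \<Rightarrow> ('w \<Rightarrow> complex) \<Rightarrow> 'a" where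
  "linear_ext h f = (\<Oplus>m\<in>{m. f m \<noteq> 0}. f m \<odot> h m)"

lemma linear_ext_superset:
  assumes "finite S" "{m. f m \<noteq> 0} \<subseteq> S" "\<And>m. m \<in> S \<Longrightarrow> h m \<in> carrier A"
  shows "linear_ext h f = (\<Oplus>m\<in>S. f m \<odot> h m)"
  unfolding linear_ext_def by (rule add.finprod_mono_neutral_cong_left) (use assms in auto)

lemma linear_ext_plus:
  assumes "finite {m. f m \<noteq> 0}" "finite {m. g m \<noteq> 0}" "\<And>m. f m \<noteq> 0 \<or> g m \<noteq> 0 \<Longrightarrow> h m \<in> carrier A"
  shows "linear_ext h (\<lambda>m. f m + g m) = linear_ext h f \<oplus> linear_ext h g"
proof -
  let ?S = "{m. f m \<noteq> 0} \<union> {m. g m \<noteq> 0}"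
  have S: "finite ?S" "\<And>m. m \<in> ?S \<Longrightarrow> h m \<in> carrier A"
    using assms by auto
  have "linear_ext h (\<lambda>m. f m + g m) = (\<Oplus>m\<in>?S. (f m + g m) \<odot> h m)"
    by (rule linear_ext_superset) (use S in auto)
  also have "\<dots> = (\<Oplus>m\<in>?S. f m \<odot> h m \<oplus> g m \<odot> h m)"
    by (rule finsum_cong') (use S in \<open>auto simp: smult_l_distr\<close>)
  also have "\<dots> = (\<Oplus>m\<in>?S. f m \<odot> h m) \<oplus> (\<Oplus>m\<in>?S. g m \<odot> h m)"
    by (rule finsum_addf) (use S in auto)
  also have "(\<Oplus>m\<in>?S. f m \<odot> h m) = linear_ext h f"
    by (rule linear_ext_superset[symmetric]) (use S in auto)
  also have "(\<Oplus>m\<in>?S. g m \<odot> h m) = linear_ext h g"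
    by (rule linear_ext_superset[symmetric]) (use S in auto)
  finally show ?thesis .
qed

lemma linear_ext_scale:
  assumes "finite {m. f m \<noteq> 0}" "\<And>m. f m \<noteq> 0 \<Longrightarrow> h m \<in> carrier A"
  shows "linear_ext h (\<lambda>m. c * f m) = c \<odot> linear_ext h f"
proof -
  let ?S = "{m. f m \<noteq> 0}"
  have cl: "linear_ext h f \<in> carrier A"
    unfolding linear_ext_def by (rule finsum_closed) (use assms in auto)
  have "linear_ext h (\<lambda>m. c * f m) = (\<Oplus>m\<in>?S. (c * f m) \<odot> h m)"
    by (rule linear_ext_superset) (use assms in auto)
  \<comment> \<open>Scaling is rewritten as left multiplication by \<open>c \<odot> \<one>\<close>,
    so that distributivity over finite sums applies.\<close>
  also have "\<dots> = (\<Oplus>m\<in>?S. (c \<odot> \<one>) \<otimes> (f m \<odot> h m))"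
    by (rule finsum_cong') (use assms in \<open>auto simp: smult_mult_left smult_smult\<close>)
  also have "\<dots> = (c \<odot> \<one>) \<otimes> (\<Oplus>m\<in>?S. f m \<odot> h m)"
    by (rule finsum_rdistr[symmetric]) (use assms in auto)
  also have "(\<Oplus>m\<in>?S. f m \<odot> h m) = linear_ext h f" by (simp add: linear_ext_def)
  finally show ?thesis using cl by (simp add: smult_mult_left)
qed

lemma linear_ext_closed:
  assumes "f \<in> carrier (monoid_algebra M)" "\<And>m. m \<in> carrier M \<Longrightarrow> h m \<in> carrier A"
  shows "linear_ext h f \<in> carrier A"
  unfolding linear_ext_def by (rule finsum_closed) (use assms in \<open>auto simp: monoid_algebra_simps\<close>)

lemma linear_ext_add:
  assumes "f \<in> carrier (monoid_algebra M)" "g \<in> carrier (monoid_algebra M)"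
    "\<And>m. m \<in> carrier M \<Longrightarrow> h m \<in> carrier A"
  shows "linear_ext h (f \<oplus>\<^bsub>monoid_algebra M\<^esub> g) = linear_ext h f \<oplus> linear_ext h g"
  unfolding monoid_algebra_simps
  by (rule linear_ext_plus) (use assms in \<open>auto simp: monoid_algebra_simps\<close>)

lemma linear_ext_smult_single:
  assumes "h a \<in> carrier A"
  shows "linear_ext h (c \<odot>\<^bsub>monoid_algebra M\<^esub> single a) = c \<odot> h a"
  by (subst linear_ext_superset[of "{a}"]) (use assms in \<open>auto simp: monoid_algebra_simps single_def\<close>)

lemma linear_ext_single:
  assumes "h a \<in> carrier A"
  shows "linear_ext h (single a) = h a"
  using linear_ext_superset[of "{a}" "single a" h] assms
  by (auto simp: single_def)

lemma linear_ext_zero: "linear_ext h \<zero>\<^bsub>monoid_algebra M\<^esub> = \<zero>"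
  by (simp add: linear_ext_def monoid_algebra_simps)

lemma linear_ext_alg_hom:
  assumes M: "monoid M"
    and h: "\<And>m. m \<in> carrier M \<Longrightarrow> h m \<in> carrier A" "h \<one>\<^bsub>M\<^esub> = \<one>"
      "\<And>m n. m \<in> carrier M \<Longrightarrow> n \<in> carrier M \<Longrightarrow> h (m \<otimes>\<^bsub>M\<^esub> n) = h m \<otimes> h n"
  shows "linear_ext h \<in> alg_hom (monoid_algebra M) A"
proof -
  interpret M: monoid M by fact
  let ?P = "monoid_algebra M"
  interpret P: complex_algebra ?P by (rule complex_algebra_monoid_algebra[OF M])
  note add = linear_ext_add[of _ M _ h] and cl = linear_ext_closed[of _ M h]
  have smult: "linear_ext h (c \<odot>\<^bsub>?P\<^esub> f) = c \<odot> linear_ext h f" if "f \<in> carrier ?P" for c f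
    unfolding monoid_algebra_simps
    by (rule linear_ext_scale) (use that h in \<open>auto simp: monoid_algebra_simps\<close>)
  \<comment> \<open>Multiplicativity in two stages: first a basis element on the left against any
    right factor, then any left factor.\<close>
  have mult1: "linear_ext h (single a \<otimes>\<^bsub>?P\<^esub> g) = h a \<otimes> linear_ext h g"
    if "g \<in> carrier ?P" "a \<in> carrier M" for a g
    using that
  proof (induction rule: monoid_algebra_induct)
    case zero
    then show ?case using h single_closed[of a M] by (simp add: linear_ext_zero)
  next
    case (add d b f)
    have "single (a \<otimes>\<^bsub>M\<^esub> b) \<in> carrier ?P" using add by (simp add: single_closed)
    then show ?case using add h cl single_closed[of a M] single_closed[of b M]
      by (simp add: linear_ext_add[of _ M] P.r_distr r_distr P.smult_mult_right smult_mult_right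
          linear_ext_smult_single single_mult M)
  qed
  have mult: "linear_ext h (f \<otimes>\<^bsub>?P\<^esub> g) = linear_ext h f \<otimes> linear_ext h g"
    if "f \<in> carrier ?P" "g \<in> carrier ?P" for f g
    using that
  proof (induction rule: monoid_algebra_induct)
    case zero
    then show ?case using h cl by (simp add: linear_ext_zero)
  next
    case (add d b f)
    then show ?case using h cl single_closed[of b M]
      by (simp add: linear_ext_add[of _ M] P.l_distr l_distr P.smult_mult_left smult_mult_left
          linear_ext_smult_single mult1 smult)
  qed
  show ?thesis unfolding alg_hom_def
    using add cl smult mult h by (auto intro!: ring_hom_memI simp: monoid_algebra_simps(2) linear_ext_single)
qed

end

subsection \<open>Quotient algebras\<close>

text \<open>Scaling is multiplication by \<open>c \<odot> \<one>\<close>, so a ring ideal is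
  automatically a subspace and scalars act on the quotient.\<close>

lemma (in complex_algebra) ideal_smult:
  assumes "ideal I A" "x \<in> I"
  shows "c \<odot> x \<in> I"
proof -
  interpret ideal I A by fact
  have x: "x \<in> carrier A" using assms(2) Icarr by blast
  then have "c \<odot> x = (c \<odot> \<one>) \<otimes> x" by (simp add: smult_mult_left)
  then show ?thesis using I_l_closed[OF assms(2), of "c \<odot> \<one>"] by simp
qed

lemma quotient_algebra_simps:
  "carrier (quotient_algebra A I) = a_rcosets\<^bsub>A\<^esub> I"
  "X \<otimes>\<^bsub>quotient_algebra A I\<^esub> Y = rcoset_mult A I X Y"
  "\<one>\<^bsub>quotient_algebra A I\<^esub> = I +>\<^bsub>A\<^esub> \<one>\<^bsub>A\<^esub>"
  "\<zero>\<^bsub>quotient_algebra A I\<^esub> = I"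
  "X \<oplus>\<^bsub>quotient_algebra A I\<^esub> Y = set_add A X Y"
  "c \<odot>\<^bsub>quotient_algebra A I\<^esub> X = (\<Union>x\<in>X. I +>\<^bsub>A\<^esub> (c \<odot>\<^bsub>A\<^esub> x))"
  by (simp_all add: quotient_algebra_def FactRing_def ring.extend_def module.fields_def)

locale algebra_ideal = complex_algebra A + ideal I A
  for A :: "(complex, 'a, 'm) module_scheme" (structure) and I
begin

abbreviation "Q \<equiv> quotient_algebra A I"

lemma coset_eq_iff: "x \<in> carrier A \<Longrightarrow> y \<in> carrier A \<Longrightarrow> I +> x = I +> y \<longleftrightarrow> x \<ominus> y \<in> I"
  using quotient_eq_iff_same_a_r_cos[OF is_ideal] by auto

lemma quotient_carrier: "X \<in> carrier Q \<longleftrightarrow> (\<exists>x\<in>carrier A. X = I +> x)"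
  by (auto simp: quotient_algebra_simps A_RCOSETS_def')

lemma coset_smult:
  assumes "x \<in> carrier A"
  shows "c \<odot>\<^bsub>Q\<^esub> (I +> x) = I +> (c \<odot> x)"
proof -
  have "I +> (c \<odot> y) = I +> (c \<odot> x)" if "y \<in> I +> x" for y
  proof -
    have y: "y \<in> carrier A" using that a_r_coset_subset_G[of I x] assms a_subset by auto
    have "I +> y = I +> x" using that assms y a_rcos_self[OF y] 
      using a_repr_independence' by auto
    then have "y \<ominus> x \<in> I" using coset_eq_iff assms y by simp
    then have "c \<odot> (y \<ominus> x) \<in> I" by (rule ideal_smult[OF is_ideal])
    moreover have "c \<odot> (y \<ominus> x) = c \<odot> y \<ominus> c \<odot> x"
      using assms y by (simp add: minus_eq smult_r_distr minus_eq_smult smult_smult)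
    ultimately show ?thesis using coset_eq_iff assms y by simp
  qed
  moreover have "x \<in> I +> x" by (rule a_rcos_self[OF assms])
  ultimately show ?thesis unfolding quotient_algebra_simps by blast
qed

lemma coset_ops:
  assumes "x \<in> carrier A" "y \<in> carrier A"
  shows "(I +> x) \<oplus>\<^bsub>Q\<^esub> (I +> y) = I +> (x \<oplus> y)" "(I +> x) \<otimes>\<^bsub>Q\<^esub> (I +> y) = I +> (x \<otimes> y)"
  using assms by (simp_all add: quotient_algebra_simps a_rcos_sum rcoset_mult_add)

lemma coset_closed: "x \<in> carrier A \<Longrightarrow> I +> x \<in> carrier Q"
  using quotient_carrier by auto

lemma complex_algebra_quotient: "complex_algebra Q"
proof (rule complex_algebraI)
  note R = quotient_is_ring
  interpret R: ring "A Quot I" by (rule R)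
  have eq: "carrier Q = carrier (A Quot I)" "X \<otimes>\<^bsub>Q\<^esub> Y = X \<otimes>\<^bsub>A Quot I\<^esub> Y" "\<one>\<^bsub>Q\<^esub> = \<one>\<^bsub>A Quot I\<^esub>"
    "\<zero>\<^bsub>Q\<^esub> = \<zero>\<^bsub>A Quot I\<^esub>" "X \<oplus>\<^bsub>Q\<^esub> Y = X \<oplus>\<^bsub>A Quot I\<^esub> Y" for X Y
    by (simp_all add: quotient_algebra_simps FactRing_def)
  show "ring Q"
  proof (rule ringI)
    show "abelian_group Q"
      by (rule abelian_groupI) (auto simp: eq R.a_ac intro: R.add.l_inv_ex)
    show "monoid Q" by (rule monoidI) (auto simp: eq R.m_assoc)
  qed (auto simp: eq R.l_distr R.r_distr)
qed (auto simp: quotient_carrier coset_smult coset_ops smult_l_distr smult_r_distr smult_smult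
    smult_mult_left smult_mult_right)

lemma coset_alg_hom: "(+>) I \<in> alg_hom A Q"
  unfolding alg_hom_def
  by (simp add: ring_hom_memI coset_closed coset_smult coset_ops quotient_algebra_simps(3))

text \<open>A representative of each coset is chosen by \<open>SOME\<close>; the vanishing of
  \<open>h\<close> on \<open>I\<close> makes the value independent of this choice.\<close>

lemma quotient_factor:
  assumes B: "complex_algebra B" and h: "h \<in> alg_hom A B" and z: "\<And>x. x \<in> I \<Longrightarrow> h x = \<zero>\<^bsub>B\<^esub>"
  obtains g where "g \<in> alg_hom Q B" "\<And>x. x \<in> carrier A \<Longrightarrow> g (I +> x) = h x"
proof
  interpret B: complex_algebra B by fact
  note hD = alg_homD[OF h]
  define g where "g X = h (SOME x. x \<in> carrier A \<and> X = I +> x)" for X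
  show g: "g (I +> x) = h x" if x: "x \<in> carrier A" for x
  proof -
    define y where "y = (SOME y. y \<in> carrier A \<and> I +> x = I +> y)"
    have "\<exists>y. y \<in> carrier A \<and> I +> x = I +> y" using x by blast
    then have y: "y \<in> carrier A" "I +> x = I +> y"
      unfolding y_def by (metis (mono_tags, lifting) someI_ex)+
    then have "x \<ominus> y \<in> I" using x coset_eq_iff by simp
    then have "h (x \<ominus> y) = \<zero>\<^bsub>B\<^esub>" by (rule z)
    then have "h x \<ominus>\<^bsub>B\<^esub> h y = \<zero>\<^bsub>B\<^esub>"
      using alg_hom_diff[OF h complex_algebra_axioms B x y(1)] by simp
    then have "h x = h y" using hD x y by simp
    then show ?thesis by (simp add: g_def y_def)
  qed
  show "g \<in> alg_hom Q B" unfolding alg_hom_def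
    using hD by (auto intro!: ring_hom_memI simp: quotient_carrier coset_smult coset_ops g)
      (simp add: quotient_algebra_simps g)
qed

end

subsection \<open>Endomorphisms of a function space\<close>

text \<open>The operators act on all functions, not only on those of finite support, so membership
  is linearity alone and operators given by formulas on coordinates need no support check.\<close>

definition End_alg :: "(complex, ('i \<Rightarrow> complex) \<Rightarrow> 'i \<Rightarrow> complex) module" where
  "End_alg = \<lparr>carrier = {T. (\<forall>u v. T (\<lambda>i. u i + v i) = (\<lambda>i. T u i + T v i)) \<and>
      (\<forall>c u. T (\<lambda>i. c * u i) = (\<lambda>i. c * T u i))},
    monoid.mult = (\<circ>), one = id, ring.zero = (\<lambda>u i. 0), add = (\<lambda>S T u i. S u i + T u i),
    smult = (\<lambda>c T u i. c * T u i)\<rparr>"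

lemma End_alg_simps:
  "T \<in> carrier End_alg \<longleftrightarrow> (\<forall>u v. T (\<lambda>i. u i + v i) = (\<lambda>i. T u i + T v i)) \<and>
      (\<forall>c u. T (\<lambda>i. c * u i) = (\<lambda>i. c * T u i))"
  "S \<otimes>\<^bsub>End_alg\<^esub> T = S \<circ> T" "\<one>\<^bsub>End_alg\<^esub> = id" "\<zero>\<^bsub>End_alg\<^esub> = (\<lambda>u i. 0)"
  "S \<oplus>\<^bsub>End_alg\<^esub> T = (\<lambda>u i. S u i + T u i)" "c \<odot>\<^bsub>End_alg\<^esub> T = (\<lambda>u i. c * T u i)"
  by (simp_all add: End_alg_def)

lemma complex_algebra_End_alg: "complex_algebra End_alg"
proof (rule complex_algebraI)
  show "ring (End_alg :: (complex, ('i \<Rightarrow> complex) \<Rightarrow> 'i \<Rightarrow> complex) module)" (is "ring ?E")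
  proof (rule ringI)
    show "abelian_group ?E"
    proof (rule abelian_groupI)
      fix T assume "T \<in> carrier ?E"
      then show "\<exists>S\<in>carrier ?E. S \<oplus>\<^bsub>?E\<^esub> T = \<zero>\<^bsub>?E\<^esub>"
        by (intro bexI[of _ "(-1) \<odot>\<^bsub>?E\<^esub> T"]) (auto simp: End_alg_simps algebra_simps)
    qed (auto simp: End_alg_simps algebra_simps)
    show "monoid ?E" by (rule monoidI) (auto simp: End_alg_simps o_def)
  qed (auto simp: End_alg_simps o_def)
qed (auto simp: End_alg_simps algebra_simps o_def)

section \<open>U as a quotient of the free algebra\<close>

section \<open>The universal property of the quantum group\<close>

lemma word_monoid_simps: "x \<otimes>\<^bsub>word_monoid\<^esub> y = x @ y" "\<one>\<^bsub>word_monoid\<^esub> = []" "x \<in> carrier word_monoid"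
  by (simp_all add: word_monoid_def)

lemma monoid_word_monoid: "monoid word_monoid"
  by (rule monoidI) (auto simp: word_monoid_def)

interpretation free: complex_algebra free_alg
  by (rule complex_algebra_monoid_algebra[OF monoid_word_monoid])

lemma single_word_closed [simp]: "single w \<in> carrier free_alg"
  by (rule single_closed) (simp add: word_monoid_simps)

lemma Uq_relations_closed: "Uq_relations q \<subseteq> carrier free_alg"
  by (simp add: Uq_relations_def)

lemma algebra_ideal_Uq: "algebra_ideal free_alg (Uq_ideal q)"
  unfolding Uq_ideal_def
  by (intro algebra_ideal.intro free.complex_algebra_axioms free.genideal_ideal Uq_relations_closed)

lemmas Uq_complex_algebra_quotient = algebra_ideal.complex_algebra_quotient[OF algebra_ideal_Uq]
lemmas Uq_quotient_factor = algebra_ideal.quotient_factor[OF algebra_ideal_Uq]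
lemmas Uq_quotient_carrier = algebra_ideal.quotient_carrier[OF algebra_ideal_Uq]
lemmas Uq_coset_ops = algebra_ideal.coset_ops[OF algebra_ideal_Uq]
lemmas Uq_coset_closed = algebra_ideal.coset_closed[OF algebra_ideal_Uq]
lemmas Uq_coset_smult = algebra_ideal.coset_smult[OF algebra_ideal_Uq]
lemmas Uq_coset_eq_iff = algebra_ideal.coset_eq_iff[OF algebra_ideal_Uq]
lemmas Uq_coset_alg_hom = algebra_ideal.coset_alg_hom[OF algebra_ideal_Uq]

lemma complex_algebra_Uq: "complex_algebra (Uq q)"
  unfolding Uq_def by (rule Uq_complex_algebra_quotient)

lemma word_product_coset:
  "Uq_ideal q +>\<^bsub>free_alg\<^esub> single (g # w) = Uq_gen q g \<otimes>\<^bsub>Uq q\<^esub> (Uq_ideal q +>\<^bsub>free_alg\<^esub> single w)"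
proof -
  have "single [g] \<otimes>\<^bsub>free_alg\<^esub> single w = single (g # w)"
    using single_mult[OF monoid_word_monoid, of "[g]" w] by (simp add: word_monoid_simps)
  then show ?thesis unfolding Uq_gen_def Uq_def by (simp add: Uq_coset_ops)
qed

lemma empty_word_coset: "Uq_ideal q +>\<^bsub>free_alg\<^esub> single [] = \<one>\<^bsub>Uq q\<^esub>"
  unfolding Uq_def quotient_algebra_simps(3) monoid_algebra_simps(2) word_monoid_simps ..

lemma Uq_gen_closed [simp]: "Uq_gen q g \<in> carrier (Uq q)"
  unfolding Uq_gen_def Uq_def by (rule Uq_coset_closed) simp

text \<open>Evaluation of words extends linearly to the free algebra; its kernel is an ideal
  containing the relations, hence the ideal they generate. The relations are bracketed to the right
  because \<open>w\<close> evaluates a word as a right fold.\<close>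

lemma Uq_hom_exists:
  assumes "complex_algebra A"
    and c: "e \<in> carrier A" "f \<in> carrier A" "k \<in> carrier A" "k' \<in> carrier A"
    and r: "k \<otimes>\<^bsub>A\<^esub> k' = \<one>\<^bsub>A\<^esub>" "k' \<otimes>\<^bsub>A\<^esub> k = \<one>\<^bsub>A\<^esub>"
      "k \<otimes>\<^bsub>A\<^esub> (e \<otimes>\<^bsub>A\<^esub> k') = q^2 \<odot>\<^bsub>A\<^esub> e"
      "k \<otimes>\<^bsub>A\<^esub> (f \<otimes>\<^bsub>A\<^esub> k') = inverse (q^2) \<odot>\<^bsub>A\<^esub> f"
      "e \<otimes>\<^bsub>A\<^esub> f \<ominus>\<^bsub>A\<^esub> f \<otimes>\<^bsub>A\<^esub> e = (1 / (q - inverse q)) \<odot>\<^bsub>A\<^esub> (k \<ominus>\<^bsub>A\<^esub> k')"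
  obtains h where "h \<in> alg_hom (Uq q) A" "h (UE q) = e" "h (UF q) = f" "h (UK q) = k" "h (UKinv q) = k'"
proof -
  interpret A: complex_algebra A by fact
  define \<gamma> where "\<gamma> g = (case g of Gen_E \<Rightarrow> e | Gen_F \<Rightarrow> f | Gen_K \<Rightarrow> k | Gen_Kinv \<Rightarrow> k')" for g
  define w where "w = rec_list \<one>\<^bsub>A\<^esub> (\<lambda>g _ x. \<gamma> g \<otimes>\<^bsub>A\<^esub> x)"
  have w_simps: "w [] = \<one>\<^bsub>A\<^esub>" "w (g # gs) = \<gamma> g \<otimes>\<^bsub>A\<^esub> w gs" for g gs
    by (simp_all add: w_def)
  have \<gamma>: "\<gamma> g \<in> carrier A" for g using c by (cases g) (auto simp: \<gamma>_def)
  have w: "w gs \<in> carrier A" for gs by (induction gs) (use \<gamma> in \<open>auto simp: w_simps\<close>)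
  have w_append: "w (gs @ hs) = w gs \<otimes>\<^bsub>A\<^esub> w hs" for gs hs
    by (induction gs) (use \<gamma> w in \<open>auto simp: w_simps A.m_assoc\<close>)
  define h where "h = A.linear_ext w"
  have h: "h \<in> alg_hom free_alg A" unfolding h_def
    by (rule A.linear_ext_alg_hom[OF monoid_word_monoid])
      (use w w_append in \<open>auto simp: word_monoid_simps w_simps\<close>)
  note hD = alg_homD[OF h] alg_hom_diff[OF h free.complex_algebra_axioms assms(1)]
  have hs: "h (single gs) = w gs" for gs unfolding h_def by (rule A.linear_ext_single) (rule w)
  have rel: "h x = \<zero>\<^bsub>A\<^esub>" if "x \<in> Uq_relations q" for x
    using that c r unfolding Uq_relations_def
    by (auto simp: hD hs w_simps \<gamma>_def)
  interpret ring_hom_ring free_alg A h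
    by (rule alg_hom_ring_hom_ring[OF h free.complex_algebra_axioms assms(1)])
  have "Uq_relations q \<subseteq> a_kernel free_alg A h"
    unfolding a_kernel_def' using rel Uq_relations_closed by blast
  then have "Uq_ideal q \<subseteq> a_kernel free_alg A h"
    unfolding Uq_ideal_def by (rule free.genideal_minimal[OF kernel_is_ideal])
  then have "h x = \<zero>\<^bsub>A\<^esub>" if "x \<in> Uq_ideal q" for x using that unfolding a_kernel_def' by blast
  then obtain g where g: "g \<in> alg_hom (Uq q) A" "\<And>x. x \<in> carrier free_alg \<Longrightarrow> g (Uq_ideal q +>\<^bsub>free_alg\<^esub> x) = h x"
    using Uq_quotient_factor[OF assms(1) h] unfolding Uq_def by metis
  have "g (Uq_gen q a) = \<gamma> a" for a
    using \<gamma> by (simp add: Uq_gen_def g(2) hs w_simps)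
  then show thesis using that g(1) by (simp add: \<gamma>_def)
qed

locale quantum_sl2 =
  fixes q :: complex
  assumes q_nonzero: "q \<noteq> 0" and q_not_root_of_unity: "\<And>n::nat. n > 0 \<Longrightarrow> q ^ n \<noteq> 1"
begin

definition p :: complex where "p = q\<^sup>2"
definition \<kappa> :: complex where "\<kappa> = 1 / (q - inverse q)"

lemma p_nonzero [simp]: "p \<noteq> 0" using q_nonzero by (simp add: p_def)

lemma p_pow_neq_1: "n > 0 \<Longrightarrow> p ^ n \<noteq> 1"
  using q_not_root_of_unity[of "2 * n"] by (simp add: p_def flip: power_mult)

lemma \<kappa>_nonzero [simp]: "\<kappa> \<noteq> 0"
  using q_not_root_of_unity[of 2] q_nonzero by (auto simp: \<kappa>_def field_simps power2_eq_square)

sublocale complex_algebra "Uq q" by (rule complex_algebra_Uq)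

abbreviation "U \<equiv> Uq q"

abbreviation K where "K \<equiv> UK q"
abbreviation L where "L \<equiv> UKinv q"
abbreviation Y where "Y \<equiv> UF q"
abbreviation E where "E \<equiv> UE q"
abbreviation X where "X \<equiv> E \<otimes>\<^bsub>U\<^esub> L"

text \<open>Cosets of words span U, and a word is built by left multiplication with generators, so
  closure under such multiplications replaces closure under products.\<close>

lemma U_induct [consumes 1, case_names one add smult gen]:
  assumes "u \<in> carrier U"
    and one: "P \<one>\<^bsub>U\<^esub>"
    and add: "\<And>x y. x \<in> carrier U \<Longrightarrow> y \<in> carrier U \<Longrightarrow> P x \<Longrightarrow> P y \<Longrightarrow> P (x \<oplus>\<^bsub>U\<^esub> y)"
    and smult: "\<And>c x. x \<in> carrier U \<Longrightarrow> P x \<Longrightarrow> P (c \<odot>\<^bsub>U\<^esub> x)"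
    and gen: "\<And>g x. x \<in> carrier U \<Longrightarrow> P x \<Longrightarrow> P (Uq_gen q g \<otimes>\<^bsub>U\<^esub> x)"
  shows "P u"
proof -
  let ?\<pi> = "\<lambda>f. Uq_ideal q +>\<^bsub>free_alg\<^esub> f"
  obtain f where f: "f \<in> carrier free_alg" "u = ?\<pi> f"
    using assms(1) Uq_quotient_carrier by (auto simp: Uq_def)
  have \<pi>: "f \<in> carrier free_alg \<Longrightarrow> ?\<pi> f \<in> carrier U" for f
    by (simp add: Uq_def Uq_coset_closed)
  have word: "P (?\<pi> (single w))" for w
    by (induction w) (use one gen \<pi> in \<open>auto simp: empty_word_coset word_product_coset\<close>)
  have zero: "P \<zero>\<^bsub>U\<^esub>" using smult[of "\<one>\<^bsub>U\<^esub>" 0] one by simp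
  from f(1) have "P (?\<pi> f)"
  proof (induction rule: monoid_algebra_induct)
    case zero
    have "?\<pi> (0 \<odot>\<^bsub>free_alg\<^esub> single []) = 0 \<odot>\<^bsub>U\<^esub> ?\<pi> (single [])"
      unfolding Uq_def by (rule Uq_coset_smult[symmetric]) simp
    then show ?case using \<open>P \<zero>\<^bsub>U\<^esub>\<close> \<pi> by simp
  next
    case (add c w f)
    have "?\<pi> (c \<odot>\<^bsub>free_alg\<^esub> single w \<oplus>\<^bsub>free_alg\<^esub> f) = c \<odot>\<^bsub>U\<^esub> ?\<pi> (single w) \<oplus>\<^bsub>U\<^esub> ?\<pi> f"
      using add by (simp add: Uq_def Uq_coset_smult Uq_coset_ops)
    then show ?case using assms(3,4) word add \<pi> by simp
  qed
  then show ?thesis using f by simp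
qed

lemma relation_coset:
  assumes "x \<ominus>\<^bsub>free_alg\<^esub> y \<in> Uq_relations q" "x \<in> carrier free_alg" "y \<in> carrier free_alg"
  shows "Uq_ideal q +>\<^bsub>free_alg\<^esub> x = Uq_ideal q +>\<^bsub>free_alg\<^esub> y"
  using assms free.genideal_self[OF Uq_relations_closed, of q] Uq_coset_eq_iff[of x y q]
  by (auto simp: Uq_ideal_def)

lemma coset_linear:
  "x \<in> carrier free_alg \<Longrightarrow> Uq_ideal q +>\<^bsub>free_alg\<^esub> (c \<odot>\<^bsub>free_alg\<^esub> x) = c \<odot>\<^bsub>U\<^esub> (Uq_ideal q +>\<^bsub>free_alg\<^esub> x)"
  "x \<in> carrier free_alg \<Longrightarrow> y \<in> carrier free_alg \<Longrightarrow>
     Uq_ideal q +>\<^bsub>free_alg\<^esub> (x \<ominus>\<^bsub>free_alg\<^esub> y) = (Uq_ideal q +>\<^bsub>free_alg\<^esub> x) \<ominus>\<^bsub>U\<^esub> (Uq_ideal q +>\<^bsub>free_alg\<^esub> y)"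
  using Uq_coset_smult alg_hom_diff[OF Uq_coset_alg_hom free.complex_algebra_axioms Uq_complex_algebra_quotient]
  by (auto simp: Uq_def)

lemma defining_relations:
  "K \<otimes>\<^bsub>U\<^esub> L = \<one>\<^bsub>U\<^esub>" "L \<otimes>\<^bsub>U\<^esub> K = \<one>\<^bsub>U\<^esub>"
  "K \<otimes>\<^bsub>U\<^esub> (E \<otimes>\<^bsub>U\<^esub> L) = p \<odot>\<^bsub>U\<^esub> E" "K \<otimes>\<^bsub>U\<^esub> (Y \<otimes>\<^bsub>U\<^esub> L) = (1 / p) \<odot>\<^bsub>U\<^esub> Y"
  "E \<otimes>\<^bsub>U\<^esub> Y \<ominus>\<^bsub>U\<^esub> Y \<otimes>\<^bsub>U\<^esub> E = \<kappa> \<odot>\<^bsub>U\<^esub> (K \<ominus>\<^bsub>U\<^esub> L)"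
proof -
  note s = word_product_coset empty_word_coset coset_linear
  show "K \<otimes>\<^bsub>U\<^esub> L = \<one>\<^bsub>U\<^esub>"
    using relation_coset[of "single [Gen_K, Gen_Kinv]" "single []"] by (simp add: Uq_relations_def s)
  show "L \<otimes>\<^bsub>U\<^esub> K = \<one>\<^bsub>U\<^esub>"
    using relation_coset[of "single [Gen_Kinv, Gen_K]" "single []"] by (simp add: Uq_relations_def s)
  show "K \<otimes>\<^bsub>U\<^esub> (E \<otimes>\<^bsub>U\<^esub> L) = p \<odot>\<^bsub>U\<^esub> E"
    using relation_coset[of "single [Gen_K, Gen_E, Gen_Kinv]" "q^2 \<odot>\<^bsub>free_alg\<^esub> single [Gen_E]"]
    by (simp add: Uq_relations_def s p_def)
  show "K \<otimes>\<^bsub>U\<^esub> (Y \<otimes>\<^bsub>U\<^esub> L) = (1 / p) \<odot>\<^bsub>U\<^esub> Y"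
    using relation_coset[of "single [Gen_K, Gen_F, Gen_Kinv]" "inverse (q^2) \<odot>\<^bsub>free_alg\<^esub> single [Gen_F]"]
    by (simp add: Uq_relations_def s p_def inverse_eq_divide)
  show "E \<otimes>\<^bsub>U\<^esub> Y \<ominus>\<^bsub>U\<^esub> Y \<otimes>\<^bsub>U\<^esub> E = \<kappa> \<odot>\<^bsub>U\<^esub> (K \<ominus>\<^bsub>U\<^esub> L)"
    using relation_coset[of "single [Gen_E, Gen_F] \<ominus>\<^bsub>free_alg\<^esub> single [Gen_F, Gen_E]"
        "(1 / (q - inverse q)) \<odot>\<^bsub>free_alg\<^esub> (single [Gen_K] \<ominus>\<^bsub>free_alg\<^esub> single [Gen_Kinv])"]
    by (simp add: Uq_relations_def s \<kappa>_def)
qed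

end

section \<open>The PBW basis from an action on coordinate functions\<close>

section \<open>The PBW basis\<close>

type_synonym coords = "nat \<times> nat \<times> int \<Rightarrow> complex"

text \<open>The q-integer (r^n - 1)/(r - 1) for r other than 1, written as a geometric sum: peeling
  off its last or its first term gives the recursions \<open>qnum_Suc\<close> and
  \<open>qnum_Suc'\<close>.\<close>

definition qnum :: "complex \<Rightarrow> nat \<Rightarrow> complex" where
  "qnum r n = (\<Sum>i<n. r ^ i)"

lemma qnum_0 [simp]: "qnum r 0 = 0" and qnum_1 [simp]: "qnum r (Suc 0) = 1"
  and qnum_Suc: "qnum r (Suc n) = qnum r n + r ^ n"
  by (simp_all add: qnum_def)

lemma qnum_Suc': "qnum r (Suc n) = 1 + r * qnum r n"
  unfolding qnum_def sum.lessThan_Suc_shift by (simp add: sum_distrib_left)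

lemma qnum_nonzero: "r ^ Suc n \<noteq> 1 \<Longrightarrow> qnum r (Suc n) \<noteq> 0"
  using power_diff_1_eq[of r "Suc n"] by (auto simp: qnum_def)

context quantum_sl2
begin

text \<open>The skew derivations multiply coefficients by these numbers; since q is no root of
  unity, no coefficient is lost.\<close>

lemma qnum_p_nonzero: "qnum p (Suc n) \<noteq> 0" "qnum (1 / p) (Suc n) \<noteq> 0"
  using p_pow_neq_1[of "Suc n"] qnum_nonzero[of p n] qnum_nonzero[of "1 / p" n]
  by (auto simp: power_divide divide_simps)

declare pow_nat [simp del]

text \<open>Left multiplication by X on the coefficients of X^a Y^b K^d; likewise \<open>Kop\<close>
  and \<open>Lop\<close> for K and K^-1, with the powers of p from moving them past X^a and Y^b. A
  coefficient is fetched from the monomial before multiplication, so the index shifts are opposite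
  to those of the exponents.\<close>

definition Xop :: "coords \<Rightarrow> coords" where
  "Xop v = (\<lambda>(a, b, d). if a = 0 then 0 else v (a - 1, b, d))"
definition Kop :: "coords \<Rightarrow> coords" where
  "Kop v = (\<lambda>(a, b, d). p ^ a / p ^ b * v (a, b, d - 1))"
definition Lop :: "coords \<Rightarrow> coords" where
  "Lop v = (\<lambda>(a, b, d). p ^ b / p ^ a * v (a, b, d + 1))"

text \<open>Left multiplication by \<open>Y\<close> in the PBW basis, where for \<open>n = qnum (1 / p) a\<close>
  \<open>Y X^a = p^-a X^a Y - \<kappa> n X^(a-1) + \<kappa> n p^(1-a) X^(a-1) K^-2\<close>.\<close>

definition Yop :: "coords \<Rightarrow> coords" where
  "Yop v = (\<lambda>(a, b, d). (if b = 0 then 0 else v (a, b - 1, d) / p ^ a)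
     - \<kappa> * qnum (1 / p) (Suc a) * v (Suc a, b, d)
     + \<kappa> * qnum (1 / p) (Suc a) / p ^ a * p ^ (2 * b) * v (Suc a, b, d + 2))"

lemmas ops_def = Xop_def Kop_def Lop_def Yop_def

lemma ops_End: "Xop \<in> carrier End_alg" "Kop \<in> carrier End_alg" "Lop \<in> carrier End_alg" "Yop \<in> carrier End_alg"
  by (auto simp: End_alg_simps ops_def fun_eq_iff algebra_simps add_divide_distrib)

lemma Kop_Lop [simp]: "Kop (Lop v) = v" "Lop (Kop v) = v"
  by (auto simp: ops_def fun_eq_iff)

lemma Kop_Xop: "Kop (Xop v) = (\<lambda>i. p * Xop (Kop v) i)"
  by (auto simp: ops_def fun_eq_iff power_eq_if)

lemma Kop_Yop: "Kop (Yop v) = (\<lambda>i. Yop (Kop v) i / p)"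
proof
  fix i :: "nat \<times> nat \<times> int"
  obtain a b d where i: "i = (a, b, d)" by (cases i)
  have "d - 1 + 2 = d + 1" "d + 2 - 1 = d + 1" by auto
  then show "Kop (Yop v) i = Yop (Kop v) i / p"
    unfolding i by (cases b) (simp_all add: ops_def field_simps)
qed

text \<open>The operator form of Y X = p^-1 X Y - \<open>\<kappa>\<close> + \<open>\<kappa>\<close>
  K^-2, which is the commutator relation of E and F rewritten for X = E K^-1. The other relations
  are commutations up to a power of p.\<close>

lemma Yop_Xop: "Yop (Xop v) = (\<lambda>i. Xop (Yop v) i / p - \<kappa> * v i + \<kappa> * Lop (Lop v) i)"
proof
  fix i :: "nat \<times> nat \<times> int"
  obtain a b d where i: "i = (a, b, d)" by (cases i)
  have d: "d + 1 + 1 = d + 2" by auto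
  show "Yop (Xop v) i = Xop (Yop v) i / p - \<kappa> * v i + \<kappa> * Lop (Lop v) i"
  proof (cases a)
    case 0
    then show ?thesis unfolding i by (simp add: ops_def d mult_2 power_add add.commute[of 2 d])
  next
    case (Suc n)
    \<comment> \<open>The coefficient of \<open>v i\<close> needs the q-integer expanded from the
      front, that of \<open>v (a, b, d + 2)\<close> needs it expanded from the back.\<close>
    have 1: "qnum (1/p) (Suc a) = 1 + qnum (1/p) a / p" using qnum_Suc'[of "1/p" a] by simp
    have 2: "qnum (1/p) (Suc a) / p ^ a = qnum (1/p) a / (p * p ^ n) + 1 / (p ^ a * p ^ a)"
      unfolding qnum_Suc[of "1/p" a] by (simp add: Suc power_divide field_simps)
    have "Yop (Xop v) i = (if b = 0 then 0 else v (n, b - 1, d) / p ^ a)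
       - \<kappa> * (1 + qnum (1/p) a / p) * v i
       + \<kappa> * (qnum (1/p) a / (p * p ^ n) + 1 / (p ^ a * p ^ a)) * p ^ (2 * b) * v (a, b, d + 2)"
      unfolding 1[symmetric] 2[symmetric] i by (simp add: Xop_def Yop_def Suc)
    also have "\<dots> = Xop (Yop v) i / p - \<kappa> * v i + \<kappa> * Lop (Lop v) i"
      unfolding i by (simp add: ops_def Suc d mult_2 power_add) (simp add: field_simps)
    finally show ?thesis .
  qed
qed

text \<open>E acts as \<open>Xop \<circ> Kop\<close> because E = X K; the commutator relation then
  reduces to \<open>Yop_Xop\<close>.\<close>

lemma rep_exists:
  "\<exists>h. h \<in> alg_hom U End_alg \<and> h E = Xop \<circ> Kop \<and> h Y = Yop \<and> h K = Kop \<and> h L = Lop"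
proof -
  have XK: "Xop \<circ> Kop \<in> carrier End_alg" using ops_End by (auto simp: End_alg_simps)
  interpret A: complex_algebra "End_alg :: (complex, coords \<Rightarrow> coords) module"
    by (rule complex_algebra_End_alg)
  have lin: "Yop (\<lambda>i. c * v i) = (\<lambda>i. c * Yop v i)" "Xop (\<lambda>i. c * v i) = (\<lambda>i. c * Xop v i)"
    "Xop (\<lambda>i. v i / c) = (\<lambda>i. Xop v i / c)" for c v
    by (auto simp: ops_def fun_eq_iff algebra_simps)
  have minus: "\<ominus>\<^bsub>End_alg\<^esub> T = (\<lambda>v i. - T v i)" if "T \<in> carrier End_alg" for T :: "coords \<Rightarrow> coords"
    using that by (simp add: A.minus_eq_smult End_alg_simps)
  have comm: "Xop (Kop (Yop v)) i - Yop (Xop (Kop v)) i = \<kappa> * (Kop v i - Lop v i)" for v i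
    by (simp add: Kop_Yop Yop_Xop lin algebra_simps)
  show ?thesis
  proof (rule Uq_hom_exists[OF complex_algebra_End_alg XK ops_End(4,2,3)])
    show "Kop \<otimes>\<^bsub>End_alg\<^esub> ((Xop \<circ> Kop) \<otimes>\<^bsub>End_alg\<^esub> Lop) = q\<^sup>2 \<odot>\<^bsub>End_alg\<^esub> (Xop \<circ> Kop)"
      by (auto simp: End_alg_simps fun_eq_iff Kop_Xop simp flip: p_def)
    show "Kop \<otimes>\<^bsub>End_alg\<^esub> (Yop \<otimes>\<^bsub>End_alg\<^esub> Lop) = inverse (q\<^sup>2) \<odot>\<^bsub>End_alg\<^esub> Yop"
      by (auto simp: End_alg_simps fun_eq_iff Kop_Yop inverse_eq_divide simp flip: p_def)
    have "Yop \<circ> (Xop \<circ> Kop) \<in> carrier End_alg" using XK ops_End by (auto simp: End_alg_simps)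
    then show "(Xop \<circ> Kop) \<otimes>\<^bsub>End_alg\<^esub> Yop \<ominus>\<^bsub>End_alg\<^esub> Yop \<otimes>\<^bsub>End_alg\<^esub> (Xop \<circ> Kop) =
      (1 / (q - inverse q)) \<odot>\<^bsub>End_alg\<^esub> (Kop \<ominus>\<^bsub>End_alg\<^esub> Lop)"
      using comm ops_End
      by (auto simp: A.minus_eq minus End_alg_simps fun_eq_iff simp flip: \<kappa>_def)
    show "\<exists>h. h \<in> alg_hom U End_alg \<and> h E = Xop \<circ> Kop \<and> h Y = Yop \<and> h K = Kop \<and> h L = Lop"
      if "h \<in> alg_hom U End_alg" "h E = Xop \<circ> Kop" "h Y = Yop" "h K = Kop" "h L = Lop" for h
      using that by blast
  qed (auto simp: End_alg_simps fun_eq_iff)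
qed

definition rep :: "uq \<Rightarrow> coords \<Rightarrow> coords" where
  "rep = (SOME h. h \<in> alg_hom U End_alg \<and> h E = Xop \<circ> Kop \<and> h Y = Yop \<and> h K = Kop \<and> h L = Lop)"

lemma rep: "rep \<in> alg_hom U End_alg" "rep E = Xop \<circ> Kop" "rep Y = Yop" "rep K = Kop" "rep L = Lop"
  using someI_ex[OF rep_exists] unfolding rep_def by blast+

lemma rep_ops:
  "u \<in> carrier U \<Longrightarrow> v \<in> carrier U \<Longrightarrow> rep (u \<oplus>\<^bsub>U\<^esub> v) w = (\<lambda>i. rep u w i + rep v w i)"
  "u \<in> carrier U \<Longrightarrow> rep (c \<odot>\<^bsub>U\<^esub> u) w = (\<lambda>i. c * rep u w i)"
  "u \<in> carrier U \<Longrightarrow> v \<in> carrier U \<Longrightarrow> rep (u \<otimes>\<^bsub>U\<^esub> v) w = rep u (rep v w)"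
  "rep \<one>\<^bsub>U\<^esub> w = w"
  using alg_homD[OF rep(1)] by (simp_all add: End_alg_simps)

lemma rep_linear:
  assumes "u \<in> carrier U"
  shows "rep u (\<lambda>i. v i + w i) = (\<lambda>i. rep u v i + rep u w i)" "rep u (\<lambda>i. c * v i) = (\<lambda>i. c * rep u v i)"
  using alg_homD(1)[OF rep(1) assms] by (auto simp: End_alg_simps)

lemma rep_X: "rep X = Xop"
  by (rule ext) (simp add: rep_ops rep(2-5))

text \<open>Acting on the coordinates of 1 defines coordinates of every element before the PBW
  monomials are known to be independent; independence then follows from
  \<open>coord_Mon\<close>.\<close>

definition coord :: "uq \<Rightarrow> coords" where
  "coord u = rep u (single (0, 0, 0))"

lemma coord_ops:
  "u \<in> carrier U \<Longrightarrow> v \<in> carrier U \<Longrightarrow> coord (u \<oplus>\<^bsub>U\<^esub> v) = (\<lambda>i. coord u i + coord v i)"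
  "u \<in> carrier U \<Longrightarrow> coord (c \<odot>\<^bsub>U\<^esub> u) = (\<lambda>i. c * coord u i)"
  "u \<in> carrier U \<Longrightarrow> v \<in> carrier U \<Longrightarrow> coord (u \<otimes>\<^bsub>U\<^esub> v) = rep u (coord v)"
  "coord \<one>\<^bsub>U\<^esub> = single (0, 0, 0)"
  by (simp_all add: coord_def rep_ops)

lemma X_closed: "X \<in> carrier U" by simp

definition Kpow :: "int \<Rightarrow> uq" where
  "Kpow d = (if d \<ge> 0 then K [^]\<^bsub>U\<^esub> nat d else L [^]\<^bsub>U\<^esub> nat (- d))"

lemma Kpow_closed [simp]: "Kpow d \<in> carrier U"
  by (simp add: Kpow_def)

lemma Kpow_0 [simp]: "Kpow 0 = \<one>\<^bsub>U\<^esub>" by (simp add: Kpow_def)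

lemma KL_cancel [simp]:
  "u \<in> carrier U \<Longrightarrow> K \<otimes>\<^bsub>U\<^esub> (L \<otimes>\<^bsub>U\<^esub> u) = u" "u \<in> carrier U \<Longrightarrow> L \<otimes>\<^bsub>U\<^esub> (K \<otimes>\<^bsub>U\<^esub> u) = u"
  using defining_relations(1,2) by (simp_all flip: m_assoc)

lemma K_Kpow: "K \<otimes>\<^bsub>U\<^esub> Kpow d = Kpow (d + 1)"
proof (cases "d \<ge> 0")
  case True
  then have "nat (d + 1) = Suc (nat d)" by simp
  then show ?thesis using True nat_pow_Suc2[of K "nat d"] by (simp add: Kpow_def)
next
  case False
  define n where "n = nat (- d - 1)"
  have d: "d = - int (Suc n)" using False by (simp add: n_def)
  have n: "nat (- (- int (Suc n) + 1)) = n" "nat (- (- int (Suc n))) = Suc n" by auto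
  have "K \<otimes>\<^bsub>U\<^esub> (L [^]\<^bsub>U\<^esub> Suc n) = L [^]\<^bsub>U\<^esub> n"
    unfolding nat_pow_Suc2[OF Uq_gen_closed] by simp
  then show ?thesis unfolding d Kpow_def n by (cases n) auto
qed

definition Mon :: "nat \<times> nat \<times> int \<Rightarrow> uq" where
  "Mon = (\<lambda>(a, b, d). X [^]\<^bsub>U\<^esub> a \<otimes>\<^bsub>U\<^esub> (Y [^]\<^bsub>U\<^esub> b \<otimes>\<^bsub>U\<^esub> Kpow d))"

lemma Mon_closed [simp]: "Mon i \<in> carrier U"
  by (cases i) (simp add: Mon_def)

lemma Mon_X: "X \<otimes>\<^bsub>U\<^esub> Mon (a, b, d) = Mon (Suc a, b, d)"
  using nat_pow_Suc2[OF X_closed, of a] by (simp add: Mon_def m_assoc)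

lemma Mon_Y: "Y \<otimes>\<^bsub>U\<^esub> Mon (0, b, d) = Mon (0, Suc b, d)"
  using nat_pow_Suc2[of Y b] by (simp add: Mon_def m_assoc)

lemma Mon_K: "Mon (0, 0, d) = Kpow d"
  by (simp add: Mon_def)

lemma K_X: "u \<in> carrier U \<Longrightarrow> K \<otimes>\<^bsub>U\<^esub> (X \<otimes>\<^bsub>U\<^esub> u) = p \<odot>\<^bsub>U\<^esub> (X \<otimes>\<^bsub>U\<^esub> (K \<otimes>\<^bsub>U\<^esub> u))"
proof -
  assume u: "u \<in> carrier U"
  have "K \<otimes>\<^bsub>U\<^esub> (E \<otimes>\<^bsub>U\<^esub> L) \<otimes>\<^bsub>U\<^esub> u = p \<odot>\<^bsub>U\<^esub> (E \<otimes>\<^bsub>U\<^esub> u)"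
    using u by (simp add: defining_relations smult_mult_left)
  then show ?thesis using u by (simp add: m_assoc)
qed

lemma K_Y: "u \<in> carrier U \<Longrightarrow> K \<otimes>\<^bsub>U\<^esub> (Y \<otimes>\<^bsub>U\<^esub> u) = (1 / p) \<odot>\<^bsub>U\<^esub> (Y \<otimes>\<^bsub>U\<^esub> (K \<otimes>\<^bsub>U\<^esub> u))"
proof -
  assume u: "u \<in> carrier U"
  have "K \<otimes>\<^bsub>U\<^esub> (Y \<otimes>\<^bsub>U\<^esub> L) \<otimes>\<^bsub>U\<^esub> (K \<otimes>\<^bsub>U\<^esub> u) = (1 / p) \<odot>\<^bsub>U\<^esub> (Y \<otimes>\<^bsub>U\<^esub> (K \<otimes>\<^bsub>U\<^esub> u))"
    using u by (simp add: defining_relations smult_mult_left)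
  then show ?thesis using u by (simp add: m_assoc)
qed

text \<open>The commutator relation is multiplied on the right by K^-1: E Y K^-1 becomes p^-1 X Y on
  moving K past Y, and \<open>\<kappa>\<close> (K - K^-1) becomes \<open>\<kappa>\<close> (1 -
  K^-2).\<close>

lemma Y_X:
  assumes u: "u \<in> carrier U"
  shows "Y \<otimes>\<^bsub>U\<^esub> (X \<otimes>\<^bsub>U\<^esub> u) = (1 / p) \<odot>\<^bsub>U\<^esub> (X \<otimes>\<^bsub>U\<^esub> (Y \<otimes>\<^bsub>U\<^esub> u)) \<oplus>\<^bsub>U\<^esub>
    ((- \<kappa>) \<odot>\<^bsub>U\<^esub> u \<oplus>\<^bsub>U\<^esub> \<kappa> \<odot>\<^bsub>U\<^esub> (L \<otimes>\<^bsub>U\<^esub> (L \<otimes>\<^bsub>U\<^esub> u)))"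
proof -
  let ?w = "L \<otimes>\<^bsub>U\<^esub> u"
  have w: "?w \<in> carrier U" using u by simp
  have LY: "E \<otimes>\<^bsub>U\<^esub> (Y \<otimes>\<^bsub>U\<^esub> ?w) = (1 / p) \<odot>\<^bsub>U\<^esub> (X \<otimes>\<^bsub>U\<^esub> (Y \<otimes>\<^bsub>U\<^esub> u))"
  proof -
    have "X \<otimes>\<^bsub>U\<^esub> (K \<otimes>\<^bsub>U\<^esub> (Y \<otimes>\<^bsub>U\<^esub> ?w)) = X \<otimes>\<^bsub>U\<^esub> ((1 / p) \<odot>\<^bsub>U\<^esub> (Y \<otimes>\<^bsub>U\<^esub> u))"
      using u K_Y[OF w] by simp
    then show ?thesis using u by (simp add: m_assoc smult_mult_right)
  qed
  have "E \<otimes>\<^bsub>U\<^esub> (Y \<otimes>\<^bsub>U\<^esub> ?w) \<ominus>\<^bsub>U\<^esub> Y \<otimes>\<^bsub>U\<^esub> (E \<otimes>\<^bsub>U\<^esub> ?w) = (E \<otimes>\<^bsub>U\<^esub> Y \<ominus>\<^bsub>U\<^esub> Y \<otimes>\<^bsub>U\<^esub> E) \<otimes>\<^bsub>U\<^esub> ?w"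
    using w by (simp add: diff_eq_smult l_distr smult_mult_left m_assoc)
  also have "\<dots> = \<kappa> \<odot>\<^bsub>U\<^esub> u \<oplus>\<^bsub>U\<^esub> (- \<kappa>) \<odot>\<^bsub>U\<^esub> (L \<otimes>\<^bsub>U\<^esub> ?w)"
    using u unfolding defining_relations
    by (simp add: diff_eq_smult l_distr smult_mult_left smult_r_distr smult_smult m_assoc)
  finally have "E \<otimes>\<^bsub>U\<^esub> (Y \<otimes>\<^bsub>U\<^esub> ?w) \<ominus>\<^bsub>U\<^esub> Y \<otimes>\<^bsub>U\<^esub> (E \<otimes>\<^bsub>U\<^esub> ?w) =
     \<kappa> \<odot>\<^bsub>U\<^esub> u \<oplus>\<^bsub>U\<^esub> (- \<kappa>) \<odot>\<^bsub>U\<^esub> (L \<otimes>\<^bsub>U\<^esub> ?w)" (is "?a \<ominus>\<^bsub>U\<^esub> ?b = ?c") .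
  moreover have "a \<ominus>\<^bsub>U\<^esub> (a \<ominus>\<^bsub>U\<^esub> b) = b" if "a \<in> carrier U" "b \<in> carrier U" for a b
    using that a_comm[of b "\<ominus>\<^bsub>U\<^esub> a"] by (simp add: minus_eq minus_add r_neg2)
  ultimately have "?b = ?a \<ominus>\<^bsub>U\<^esub> ?c" using u by (metis Uq_gen_closed m_closed)
  then show ?thesis using u unfolding LY
    by (simp add: diff_eq_smult smult_r_distr smult_smult m_assoc)
qed

text \<open>The spanning half of the PBW theorem: this span contains 1 and is stable under left
  multiplication by the generators, so \<open>U_induct\<close> makes it all of U.\<close>

inductive_set pbw :: "uq set" where
  mon: "Mon i \<in> pbw"
| add: "x \<in> pbw \<Longrightarrow> y \<in> pbw \<Longrightarrow> x \<oplus>\<^bsub>U\<^esub> y \<in> pbw"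
| smult: "x \<in> pbw \<Longrightarrow> c \<odot>\<^bsub>U\<^esub> x \<in> pbw"

lemma pbw_closed: "x \<in> pbw \<Longrightarrow> x \<in> carrier U"
  by (induction rule: pbw.induct) auto

lemma pbw_mult:
  assumes g: "g \<in> carrier U" "\<And>a b d. g \<otimes>\<^bsub>U\<^esub> Mon (a, b, d) \<in> pbw" and x: "x \<in> pbw"
  shows "g \<otimes>\<^bsub>U\<^esub> x \<in> pbw"
  using x
proof (induction rule: pbw.induct)
  case (mon i)
  then show ?case by (cases i) (simp add: g)
next
  case (add x y)
  then show ?case using g pbw.add pbw_closed by (simp add: r_distr)
next
  case (smult x c)
  then show ?case using g pbw.smult pbw_closed by (simp add: smult_mult_right)
qed

lemma pbw_X: "x \<in> pbw \<Longrightarrow> X \<otimes>\<^bsub>U\<^esub> x \<in> pbw"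
  by (rule pbw_mult) (auto simp: Mon_X pbw.mon)

lemma K_Mon: "K \<otimes>\<^bsub>U\<^esub> Mon (a, b, d) = (p ^ a / p ^ b) \<odot>\<^bsub>U\<^esub> Mon (a, b, d + 1)"
proof (induction a)
  case 0
  show ?case
  proof (induction b)
    case 0
    then show ?case by (simp add: Mon_K K_Kpow)
  next
    case (Suc b)
    then show ?case
      using K_Y[of "Mon (0, b, d)"] by (simp add: Mon_Y smult_mult_right smult_smult)
  qed
next
  case (Suc a)
  then show ?case
    using K_X[of "Mon (a, b, d)"] by (simp add: Mon_X smult_mult_right smult_smult)
qed

lemma L_Mon: "L \<otimes>\<^bsub>U\<^esub> Mon (a, b, d) = (p ^ b / p ^ a) \<odot>\<^bsub>U\<^esub> Mon (a, b, d - 1)"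
proof -
  have "Mon (a, b, d) = (p ^ b / p ^ a) \<odot>\<^bsub>U\<^esub> (K \<otimes>\<^bsub>U\<^esub> Mon (a, b, d - 1))"
    using K_Mon[of a b "d - 1"] by (simp add: smult_smult)
  then show ?thesis by (metis KL_cancel(2) Mon_closed Uq_gen_closed m_closed smult_mult_right)
qed

lemma pbw_K: "x \<in> pbw \<Longrightarrow> K \<otimes>\<^bsub>U\<^esub> x \<in> pbw"
  by (rule pbw_mult) (auto simp: K_Mon pbw.mon pbw.smult)

lemma pbw_L: "x \<in> pbw \<Longrightarrow> L \<otimes>\<^bsub>U\<^esub> x \<in> pbw"
  by (rule pbw_mult) (auto simp: L_Mon pbw.mon pbw.smult)

lemma pbw_Y: "x \<in> pbw \<Longrightarrow> Y \<otimes>\<^bsub>U\<^esub> x \<in> pbw"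
proof (rule pbw_mult)
  show "Y \<otimes>\<^bsub>U\<^esub> Mon (a, b, d) \<in> pbw" for a b d
  \<comment> \<open>Y moves past one factor X at a time by \<open>Y_X\<close>; the resulting terms
    stay in the span by the induction hypothesis and by stability under X and K^-1.\<close>
  proof (induction a)
    case 0
    show ?case by (simp add: Mon_Y pbw.mon)
  next
    case (Suc a)
    have "Y \<otimes>\<^bsub>U\<^esub> (X \<otimes>\<^bsub>U\<^esub> Mon (a, b, d)) \<in> pbw"
      unfolding Y_X[OF Mon_closed] by (intro pbw.intros pbw_X pbw_L Suc)
    then show ?case by (simp only: Mon_X)
  qed
qed auto

lemma pbw_E: "x \<in> pbw \<Longrightarrow> E \<otimes>\<^bsub>U\<^esub> x \<in> pbw"
  using pbw_X[OF pbw_K, of x] pbw_closed[of x] by (simp add: m_assoc)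

lemma pbw_eq: "pbw = carrier U"
proof
  show "carrier U \<subseteq> pbw"
  proof
    fix u assume "u \<in> carrier U"
    then show "u \<in> pbw"
    proof (induction rule: U_induct)
      case one
      show ?case using pbw.mon[of "(0, 0, 0)"] by (simp add: Mon_def)
    next
      case (gen g x)
      then show ?case using pbw_E pbw_Y pbw_K pbw_L by (cases g) auto
    qed (auto intro: pbw.intros)
  qed
qed (use pbw_closed in auto)

lemma pbw_induct [consumes 1, case_names mon add smult]:
  assumes "u \<in> carrier U" "\<And>i. P (Mon i)"
    "\<And>x y. x \<in> carrier U \<Longrightarrow> y \<in> carrier U \<Longrightarrow> P x \<Longrightarrow> P y \<Longrightarrow> P (x \<oplus>\<^bsub>U\<^esub> y)"
    "\<And>c x. x \<in> carrier U \<Longrightarrow> P x \<Longrightarrow> P (c \<odot>\<^bsub>U\<^esub> x)"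
  shows "P u"
proof -
  have "u \<in> pbw" using assms(1) pbw_eq by simp
  then show ?thesis
    by (induction rule: pbw.induct) (use assms pbw_closed in auto)
qed

subsection \<open>Coordinates\<close>

lemma single_eq: "single (a, b, d) = (\<lambda>(a', b', d'). if a' = a \<and> b' = b \<and> d' = d then 1 else 0)"
  by (auto simp: single_def fun_eq_iff)

lemma ops_single:
  "Xop (single (a, b, d)) = single (Suc a, b, d)"
  "Yop (single (0, b, d)) = single (0, Suc b, d)"
  "Kop (single (0, 0, d)) = single (0, 0, d + 1)"
  "Lop (single (0, 0, d)) = single (0, 0, d - 1)"
  by (auto simp: single_eq ops_def fun_eq_iff)

lemma coord_Kpow: "coord (Kpow d) = single (0, 0, d)"
proof -
  have K: "coord (K [^]\<^bsub>U\<^esub> n) = single (0, 0, int n)" for n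
  proof (induction n)
    case (Suc n)
    then show ?case unfolding nat_pow_Suc2[OF Uq_gen_closed]
      by (simp add: coord_ops rep ops_single add.commute)
  qed (simp add: coord_ops)
  have L: "coord (L [^]\<^bsub>U\<^esub> n) = single (0, 0, - int n)" for n
  proof (induction n)
    case (Suc n)
    have "- int n - 1 = - int (Suc n)" by simp
    then show ?case using Suc unfolding nat_pow_Suc2[OF Uq_gen_closed]
      by (simp only: coord_ops(3) Uq_gen_closed nat_pow_closed rep ops_single)
  qed (simp add: coord_ops)
  show ?thesis by (simp add: Kpow_def K L)
qed

lemma coord_Mon: "coord (Mon i) = single i"
proof -
  obtain a b d where i: "i = (a, b, d)" by (cases i)
  have 0: "coord (Mon (0, b, d)) = single (0, b, d)"
  proof (induction b)
    case (Suc b)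
    then show ?case by (simp add: coord_ops rep ops_single flip: Mon_Y)
  qed (simp add: Mon_K coord_Kpow)
  have "coord (Mon (a, b, d)) = single (a, b, d)"
  proof (induction a)
    case (Suc a)
    have "coord (Mon (Suc a, b, d)) = coord (X \<otimes>\<^bsub>U\<^esub> Mon (a, b, d))" by (simp only: Mon_X)
    then show ?case using Suc by (simp only: coord_ops(3) X_closed Mon_closed rep_X ops_single)
  qed (rule 0)
  then show ?thesis by (simp add: i)
qed

lemma finite_coord: "u \<in> carrier U \<Longrightarrow> finite {i. coord u i \<noteq> 0}"
proof (induction rule: pbw_induct)
  case (mon i)
  then show ?case by (simp add: coord_Mon single_def)
next
  case (add x y)
  then show ?case by (simp add: coord_ops finite_nonzero_add)
next
  case (smult c x)
  then show ?case by (simp add: coord_ops)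
qed

text \<open>Reassembling an element from its coordinates makes \<open>coord\<close> injective, so
  elements of U may be compared by coordinates alone.\<close>

lemma linear_ext_coord: "u \<in> carrier U \<Longrightarrow> linear_ext Mon (coord u) = u"
proof (induction rule: pbw_induct)
  case (mon i)
  then show ?case by (simp add: coord_Mon linear_ext_single)
next
  case (add x y)
  then show ?case by (simp add: coord_ops linear_ext_plus finite_coord)
next
  case (smult c x)
  then show ?case by (simp add: coord_ops linear_ext_scale finite_coord)
qed

lemma coord_inject: "u \<in> carrier U \<Longrightarrow> v \<in> carrier U \<Longrightarrow> coord u = coord v \<Longrightarrow> u = v"
  by (metis linear_ext_coord)

end

section \<open>Tensor products tested by bilinear forms\<close>

section \<open>Tensor products\<close>

locale algebra_pair = A: complex_algebra A + B: complex_algebra B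
  for A :: "(complex, 'a) module" and B :: "(complex, 'b) module"
begin

abbreviation "AB \<equiv> tensor_algebra A B"
abbreviation "P \<equiv> monoid_algebra (A \<times>\<times> B)"
abbreviation "pure \<equiv> pure_tensor A B"
abbreviation "I \<equiv> tensor_ideal A B"

lemma monoid_DirProd: "monoid (A \<times>\<times> B)"
  by (rule DirProd_monoid) (rule A.monoid_axioms B.monoid_axioms)+

lemma complex_algebra_P: "complex_algebra P"
  by (rule complex_algebra_monoid_algebra[OF monoid_DirProd])

lemma single_pair_closed: "a \<in> carrier A \<Longrightarrow> b \<in> carrier B \<Longrightarrow> single (a, b) \<in> carrier P"
  by (rule single_closed) simp

lemma bilinear_relations_closed: "bilinear_relations A B \<subseteq> carrier P"
proof -
  interpret P: complex_algebra P by (rule complex_algebra_P)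
  show ?thesis unfolding bilinear_relations_def Let_def
    by (auto intro!: P.minus_closed P.a_closed P.smult_closed single_pair_closed)
qed

lemma algebra_ideal_tensor: "algebra_ideal P I"
proof -
  interpret P: complex_algebra P by (rule complex_algebra_P)
  show ?thesis unfolding tensor_ideal_def
    by (intro algebra_ideal.intro complex_algebra_P P.genideal_ideal bilinear_relations_closed)
qed

lemma complex_algebra_AB: "complex_algebra AB"
  unfolding tensor_algebra_def by (rule algebra_ideal.complex_algebra_quotient[OF algebra_ideal_tensor])

lemma pure_closed [simp]: "a \<in> carrier A \<Longrightarrow> b \<in> carrier B \<Longrightarrow> pure a b \<in> carrier AB"
  unfolding tensor_algebra_def pure_tensor_def
  by (rule algebra_ideal.coset_closed[OF algebra_ideal_tensor]) (rule single_pair_closed)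

lemma coset_bilinear_relation:
  assumes "x \<ominus>\<^bsub>P\<^esub> y \<in> bilinear_relations A B" "x \<in> carrier P" "y \<in> carrier P"
  shows "I +>\<^bsub>P\<^esub> x = I +>\<^bsub>P\<^esub> y"
proof -
  interpret P: complex_algebra P by (rule complex_algebra_P)
  have "x \<ominus>\<^bsub>P\<^esub> y \<in> I"
    unfolding tensor_ideal_def using P.genideal_self[OF bilinear_relations_closed] assms(1) by blast
  then show ?thesis using algebra_ideal.coset_eq_iff[OF algebra_ideal_tensor assms(2,3)] by simp
qed

lemma pure_add_left:
  assumes "a \<in> carrier A" "a' \<in> carrier A" "b \<in> carrier B"
  shows "pure (a \<oplus>\<^bsub>A\<^esub> a') b = pure a b \<oplus>\<^bsub>AB\<^esub> pure a' b"
proof -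
  interpret P: complex_algebra P by (rule complex_algebra_P)
  have s: "single (a, b) \<in> carrier P" "single (a', b) \<in> carrier P" "single (a \<oplus>\<^bsub>A\<^esub> a', b) \<in> carrier P"
    using assms by (auto intro: single_pair_closed)
  have "I +>\<^bsub>P\<^esub> single (a \<oplus>\<^bsub>A\<^esub> a', b) = I +>\<^bsub>P\<^esub> (single (a, b) \<oplus>\<^bsub>P\<^esub> single (a', b))"
    by (rule coset_bilinear_relation) (use assms s in \<open>auto simp: bilinear_relations_def Let_def\<close>)
  then show ?thesis unfolding pure_tensor_def tensor_algebra_def
    using algebra_ideal.coset_ops(1)[OF algebra_ideal_tensor s(1,2)] by simp
qed

lemma pure_add_right:
  assumes "a \<in> carrier A" "b \<in> carrier B" "b' \<in> carrier B"
  shows "pure a (b \<oplus>\<^bsub>B\<^esub> b') = pure a b \<oplus>\<^bsub>AB\<^esub> pure a b'"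
proof -
  interpret P: complex_algebra P by (rule complex_algebra_P)
  have s: "single (a, b) \<in> carrier P" "single (a, b') \<in> carrier P" "single (a, b \<oplus>\<^bsub>B\<^esub> b') \<in> carrier P"
    using assms by (auto intro: single_pair_closed)
  have "I +>\<^bsub>P\<^esub> single (a, b \<oplus>\<^bsub>B\<^esub> b') = I +>\<^bsub>P\<^esub> (single (a, b) \<oplus>\<^bsub>P\<^esub> single (a, b'))"
    by (rule coset_bilinear_relation) (use assms s in \<open>auto simp: bilinear_relations_def Let_def\<close>)
  then show ?thesis unfolding pure_tensor_def tensor_algebra_def
    using algebra_ideal.coset_ops(1)[OF algebra_ideal_tensor s(1,2)] by simp
qed

lemma pure_smult:
  assumes "a \<in> carrier A" "b \<in> carrier B"
  shows "pure (c \<odot>\<^bsub>A\<^esub> a) b = c \<odot>\<^bsub>AB\<^esub> pure a b" "pure a (c \<odot>\<^bsub>B\<^esub> b) = c \<odot>\<^bsub>AB\<^esub> pure a b"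
proof -
  interpret P: complex_algebra P by (rule complex_algebra_P)
  have s: "single (a, b) \<in> carrier P" "single (c \<odot>\<^bsub>A\<^esub> a, b) \<in> carrier P" "single (a, c \<odot>\<^bsub>B\<^esub> b) \<in> carrier P"
    using assms by (auto intro: single_pair_closed)
  have "I +>\<^bsub>P\<^esub> single (c \<odot>\<^bsub>A\<^esub> a, b) = I +>\<^bsub>P\<^esub> (c \<odot>\<^bsub>P\<^esub> single (a, b))"
    by (rule coset_bilinear_relation) (use assms s in \<open>auto simp: bilinear_relations_def Let_def\<close>)
  moreover have "I +>\<^bsub>P\<^esub> single (a, c \<odot>\<^bsub>B\<^esub> b) = I +>\<^bsub>P\<^esub> (c \<odot>\<^bsub>P\<^esub> single (a, b))"
    by (rule coset_bilinear_relation) (use assms s in \<open>auto simp: bilinear_relations_def Let_def\<close>)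
  ultimately show "pure (c \<odot>\<^bsub>A\<^esub> a) b = c \<odot>\<^bsub>AB\<^esub> pure a b" "pure a (c \<odot>\<^bsub>B\<^esub> b) = c \<odot>\<^bsub>AB\<^esub> pure a b"
    unfolding pure_tensor_def tensor_algebra_def
    using algebra_ideal.coset_smult[OF algebra_ideal_tensor s(1)] by simp_all
qed

lemma pure_mult:
  assumes "a \<in> carrier A" "b \<in> carrier B" "a' \<in> carrier A" "b' \<in> carrier B"
  shows "pure a b \<otimes>\<^bsub>AB\<^esub> pure a' b' = pure (a \<otimes>\<^bsub>A\<^esub> a') (b \<otimes>\<^bsub>B\<^esub> b')"
proof -
  have "single (a, b) \<otimes>\<^bsub>P\<^esub> single (a', b') = single ((a, b) \<otimes>\<^bsub>A \<times>\<times> B\<^esub> (a', b'))"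
    by (rule single_mult[OF monoid_DirProd]) (use assms in auto)
  then show ?thesis
    unfolding pure_tensor_def tensor_algebra_def
    using algebra_ideal.coset_ops(2)[OF algebra_ideal_tensor single_pair_closed[OF assms(1,2)] single_pair_closed[OF assms(3,4)]]
    by simp
qed

lemma one_AB: "\<one>\<^bsub>AB\<^esub> = pure \<one>\<^bsub>A\<^esub> \<one>\<^bsub>B\<^esub>"
  unfolding pure_tensor_def tensor_algebra_def quotient_algebra_simps(3) monoid_algebra_simps(2) one_DirProd ..

text \<open>Forms are functions on pairs, so that \<open>support_sum\<close> can pair them with
  elements of \<open>P\<close>.\<close>

definition bilinear :: "('a \<times> 'b \<Rightarrow> complex) \<Rightarrow> bool" where
  "bilinear \<beta> \<longleftrightarrow>
    (\<forall>a\<in>carrier A. \<forall>a'\<in>carrier A. \<forall>b\<in>carrier B. \<beta> (a \<oplus>\<^bsub>A\<^esub> a', b) = \<beta> (a, b) + \<beta> (a', b)) \<and>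
    (\<forall>a\<in>carrier A. \<forall>b\<in>carrier B. \<forall>b'\<in>carrier B. \<beta> (a, b \<oplus>\<^bsub>B\<^esub> b') = \<beta> (a, b) + \<beta> (a, b')) \<and>
    (\<forall>c. \<forall>a\<in>carrier A. \<forall>b\<in>carrier B. \<beta> (c \<odot>\<^bsub>A\<^esub> a, b) = c * \<beta> (a, b) \<and> \<beta> (a, c \<odot>\<^bsub>B\<^esub> b) = c * \<beta> (a, b))"

lemma bilinearD:
  assumes "bilinear \<beta>" "a \<in> carrier A" "b \<in> carrier B"
  shows "a' \<in> carrier A \<Longrightarrow> \<beta> (a \<oplus>\<^bsub>A\<^esub> a', b) = \<beta> (a, b) + \<beta> (a', b)"
    "b' \<in> carrier B \<Longrightarrow> \<beta> (a, b \<oplus>\<^bsub>B\<^esub> b') = \<beta> (a, b) + \<beta> (a, b')"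
    "\<beta> (c \<odot>\<^bsub>A\<^esub> a, b) = c * \<beta> (a, b)" "\<beta> (a, c \<odot>\<^bsub>B\<^esub> b) = c * \<beta> (a, b)"
  using assms unfolding bilinear_def by auto

lemma bilinear_translate:
  assumes "bilinear \<beta>" "m \<in> carrier (A \<times>\<times> B)"
  shows "bilinear (\<lambda>n. \<beta> (m \<otimes>\<^bsub>A \<times>\<times> B\<^esub> n))" "bilinear (\<lambda>n. \<beta> (n \<otimes>\<^bsub>A \<times>\<times> B\<^esub> m))"
  using assms unfolding bilinear_def
  by (auto simp: A.r_distr A.l_distr B.r_distr B.l_distr A.smult_mult_left A.smult_mult_right
      B.smult_mult_left B.smult_mult_right)

lemma support_P: "f \<in> carrier P \<Longrightarrow> f m \<noteq> 0 \<Longrightarrow> m \<in> carrier (A \<times>\<times> B)"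
  "f \<in> carrier P \<Longrightarrow> finite {m. f m \<noteq> 0}"
  by (auto simp: monoid_algebra_simps)

lemmas support_sum_ops_P = support_sum_ops[where M = "A \<times>\<times> B"]

text \<open>A finite combination of right translates of a bilinear form. It handles multiplication
  from the right when the common kernel of all bilinear forms is shown to be an ideal.\<close>

lemma bilinear_support_sum:
  assumes "bilinear \<beta>" "f \<in> carrier P"
  shows "bilinear (\<lambda>n. support_sum (\<lambda>m. \<beta> (n \<otimes>\<^bsub>A \<times>\<times> B\<^esub> m)) f)"
proof -
  note fin = support_P(2)[OF assms(2)]
  have b: "bilinear (\<lambda>n. \<beta> (n \<otimes>\<^bsub>A \<times>\<times> B\<^esub> m))" if "f m \<noteq> 0" for m
    by (rule bilinear_translate(2)[OF assms(1) support_P(1)[OF assms(2) that]])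
  have add: "support_sum h f = support_sum h1 f + support_sum h2 f"
    if "\<And>m. f m \<noteq> 0 \<Longrightarrow> h m = h1 m + h2 m" for h h1 h2
    unfolding support_sum_linear(1)[symmetric, OF fin] by (rule support_sum_cong) (rule that)
  have scale: "support_sum h f = c * support_sum h1 f"
    if "\<And>m. f m \<noteq> 0 \<Longrightarrow> h m = c * h1 m" for h h1 c
    unfolding support_sum_linear(2)[symmetric, OF fin] by (rule support_sum_cong) (rule that)
  show ?thesis unfolding bilinear_def
    by (intro conjI ballI allI; (rule add | rule scale); simp add: bilinearD[OF b] del: mult_DirProd)
qed

lemma support_sum_bilinear_relations:
  assumes "bilinear \<beta>" "x \<in> bilinear_relations A B"
  shows "support_sum \<beta> x = 0"
proof -
  interpret P: complex_algebra P by (rule complex_algebra_P)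
  have ss: "support_sum \<beta> (x \<ominus>\<^bsub>P\<^esub> y) = support_sum \<beta> x - support_sum \<beta> y"
    if "x \<in> carrier P" "y \<in> carrier P" for x y
    using that by (simp add: P.diff_eq_smult support_sum_ops_P)
  show ?thesis using assms(2) unfolding bilinear_relations_def Let_def
    by (auto simp: ss single_pair_closed support_sum_ops_P support_sum_single
        bilinearD[OF assms(1)])
qed

text \<open>Translates of bilinear forms are bilinear, so the elements killed by all bilinear forms form an ideal.\<close>

lemma support_sum_tensor_ideal:
  assumes "bilinear \<beta>" "x \<in> I"
  shows "support_sum \<beta> x = 0"
proof -
  interpret P: complex_algebra P by (rule complex_algebra_P)
  let ?J = "{f \<in> carrier P. \<forall>\<beta>. bilinear \<beta> \<longrightarrow> support_sum \<beta> f = 0}"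
  have "ideal ?J P"
  proof (rule idealI)
    show "ring P" by (rule P.ring_axioms)
    show "subgroup ?J (add_monoid P)"
    proof (rule subgroup.intro)
      fix f assume "f \<in> ?J"
      then have "\<ominus>\<^bsub>P\<^esub> f \<in> ?J" by (auto simp: P.minus_eq_smult support_sum_ops_P)
      then show "inv\<^bsub>add_monoid P\<^esub> f \<in> ?J" by (simp add: a_inv_def)
    qed (auto simp: support_sum_ops_P support_sum_zero)
    fix f g assume f: "f \<in> ?J" and g: "g \<in> carrier P"
    have fP: "f \<in> carrier P" using f by simp
    have "support_sum \<beta> (g \<otimes>\<^bsub>P\<^esub> f) = 0" if "bilinear \<beta>" for \<beta>
    proof -
      have "support_sum \<beta> (g \<otimes>\<^bsub>P\<^esub> f) = support_sum (\<lambda>m. 0) g"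
        unfolding support_sum_mult[OF g fP]
      proof (rule support_sum_cong)
        fix m assume "g m \<noteq> 0"
        then have "bilinear (\<lambda>n. \<beta> (m \<otimes>\<^bsub>A \<times>\<times> B\<^esub> n))"
          by (intro bilinear_translate that support_P(1)[OF g])
        then show "support_sum (\<lambda>n. \<beta> (m \<otimes>\<^bsub>A \<times>\<times> B\<^esub> n)) f = 0" using f by blast
      qed
      then show ?thesis by (simp add: support_sum_def)
    qed
    then show "g \<otimes>\<^bsub>P\<^esub> f \<in> ?J" using g fP by simp
    have "support_sum \<beta> (f \<otimes>\<^bsub>P\<^esub> g) = 0" if "bilinear \<beta>" for \<beta>
      unfolding support_sum_mult[OF fP g] using f bilinear_support_sum[OF that g] by blast
    then show "f \<otimes>\<^bsub>P\<^esub> g \<in> ?J" using g fP by simp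
  qed
  then have "I \<subseteq> ?J" unfolding tensor_ideal_def
    by (rule P.genideal_minimal) (use bilinear_relations_closed support_sum_bilinear_relations in blast)
  then show ?thesis using assms by blast
qed

text \<open>The linear functional on the tensor product induced by a bilinear form, through a chosen
  representative of the coset; \<open>support_sum_tensor_ideal\<close> makes the choice
  irrelevant.\<close>

definition tensor_functional :: "('a \<times> 'b \<Rightarrow> complex) \<Rightarrow> ('a \<times> 'b \<Rightarrow> complex) set \<Rightarrow> complex" where
  "tensor_functional \<beta> w = support_sum \<beta> (SOME f. f \<in> carrier P \<and> w = I +>\<^bsub>P\<^esub> f)"

lemma tensor_functional_coset:
  assumes "bilinear \<beta>" "f \<in> carrier P"
  shows "tensor_functional \<beta> (I +>\<^bsub>P\<^esub> f) = support_sum \<beta> f"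
proof -
  interpret P: complex_algebra P by (rule complex_algebra_P)
  define g where "g = (SOME g. g \<in> carrier P \<and> I +>\<^bsub>P\<^esub> f = I +>\<^bsub>P\<^esub> g)"
  have "\<exists>g. g \<in> carrier P \<and> I +>\<^bsub>P\<^esub> f = I +>\<^bsub>P\<^esub> g" using assms(2) by blast
  then have g: "g \<in> carrier P" "I +>\<^bsub>P\<^esub> f = I +>\<^bsub>P\<^esub> g"
    unfolding g_def by (metis (mono_tags, lifting) someI_ex)+
  then have "f \<ominus>\<^bsub>P\<^esub> g \<in> I" using algebra_ideal.coset_eq_iff[OF algebra_ideal_tensor assms(2) g(1)] by simp
  then have "support_sum \<beta> (f \<ominus>\<^bsub>P\<^esub> g) = 0" by (rule support_sum_tensor_ideal[OF assms(1)])
  then show ?thesis using g(1) assms(2)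
    by (simp add: P.diff_eq_smult support_sum_ops_P tensor_functional_def flip: g_def)
qed

lemma AB_cosets:
  assumes "w \<in> carrier AB"
  obtains f where "f \<in> carrier P" "w = I +>\<^bsub>P\<^esub> f"
  using assms algebra_ideal.quotient_carrier[OF algebra_ideal_tensor] unfolding tensor_algebra_def by blast

lemma tensor_functional_linear:
  assumes "bilinear \<beta>" "w \<in> carrier AB"
  shows "v \<in> carrier AB \<Longrightarrow> tensor_functional \<beta> (w \<oplus>\<^bsub>AB\<^esub> v) = tensor_functional \<beta> w + tensor_functional \<beta> v"
    "tensor_functional \<beta> (c \<odot>\<^bsub>AB\<^esub> w) = c * tensor_functional \<beta> w"
proof -
  interpret P: complex_algebra P by (rule complex_algebra_P)
  note ops = algebra_ideal.coset_ops[OF algebra_ideal_tensor] algebra_ideal.coset_smult[OF algebra_ideal_tensor]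
  obtain f where f: "f \<in> carrier P" "w = I +>\<^bsub>P\<^esub> f" using AB_cosets[OF assms(2)] .
  show "tensor_functional \<beta> (c \<odot>\<^bsub>AB\<^esub> w) = c * tensor_functional \<beta> w"
    using f assms(1) unfolding tensor_algebra_def
    by (simp add: ops tensor_functional_coset support_sum_ops_P)
  assume "v \<in> carrier AB"
  then obtain g where g: "g \<in> carrier P" "v = I +>\<^bsub>P\<^esub> g" using AB_cosets by blast
  show "tensor_functional \<beta> (w \<oplus>\<^bsub>AB\<^esub> v) = tensor_functional \<beta> w + tensor_functional \<beta> v"
    using f g assms(1) unfolding tensor_algebra_def
    by (simp add: ops tensor_functional_coset support_sum_ops_P)
qed

lemma bilinear_combine:
  assumes "bilinear \<beta>"
  shows "bilinear \<gamma> \<Longrightarrow> bilinear (\<lambda>m. \<beta> m + \<gamma> m)" "bilinear (\<lambda>m. c * \<beta> m)"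
  using assms unfolding bilinear_def by (auto simp: algebra_simps)

lemma tensor_functional_combine:
  assumes "bilinear \<beta>" "w \<in> carrier AB"
  shows "bilinear \<gamma> \<Longrightarrow> tensor_functional (\<lambda>m. \<beta> m + \<gamma> m) w = tensor_functional \<beta> w + tensor_functional \<gamma> w"
    "tensor_functional (\<lambda>m. c * \<beta> m) w = c * tensor_functional \<beta> w"
proof -
  obtain f where f: "f \<in> carrier P" "w = I +>\<^bsub>P\<^esub> f" using AB_cosets[OF assms(2)] .
  note ss = support_sum_linear[OF support_P(2)[OF f(1)]]
  show "bilinear \<gamma> \<Longrightarrow> tensor_functional (\<lambda>m. \<beta> m + \<gamma> m) w = tensor_functional \<beta> w + tensor_functional \<gamma> w"
    unfolding f(2) using assms(1) f(1) by (simp add: tensor_functional_coset bilinear_combine ss)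
  show "tensor_functional (\<lambda>m. c * \<beta> m) w = c * tensor_functional \<beta> w"
    unfolding f(2) using assms(1) f(1) by (simp add: tensor_functional_coset bilinear_combine ss)
qed

lemma tensor_functional_pure:
  assumes "bilinear \<beta>" "a \<in> carrier A" "b \<in> carrier B"
  shows "tensor_functional \<beta> (pure a b) = \<beta> (a, b)"
  unfolding pure_tensor_def
  by (simp add: tensor_functional_coset[OF assms(1) single_pair_closed[OF assms(2,3)]] support_sum_single)

text \<open>Left multiplication by a pure tensor is transposed to the form, so a functional of a
  product is computed by changing the form instead of the tensor.\<close>

lemma tensor_functional_pure_mult:
  assumes "bilinear \<beta>" "a \<in> carrier A" "b \<in> carrier B" "w \<in> carrier AB"
  shows "tensor_functional \<beta> (pure a b \<otimes>\<^bsub>AB\<^esub> w) =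
    tensor_functional (\<lambda>(x, y). \<beta> (a \<otimes>\<^bsub>A\<^esub> x, b \<otimes>\<^bsub>B\<^esub> y)) w"
proof -
  interpret P: complex_algebra P by (rule complex_algebra_P)
  obtain f where f: "f \<in> carrier P" "w = I +>\<^bsub>P\<^esub> f" using AB_cosets[OF assms(4)] .
  have s: "single (a, b) \<in> carrier P" using assms single_pair_closed by simp
  have ab: "(a, b) \<in> carrier (A \<times>\<times> B)" using assms by simp
  have eq: "(\<lambda>n. \<beta> ((a, b) \<otimes>\<^bsub>A \<times>\<times> B\<^esub> n)) = (\<lambda>(x, y). \<beta> (a \<otimes>\<^bsub>A\<^esub> x, b \<otimes>\<^bsub>B\<^esub> y))"
    by (auto simp: fun_eq_iff)
  have bil: "bilinear (\<lambda>(x, y). \<beta> (a \<otimes>\<^bsub>A\<^esub> x, b \<otimes>\<^bsub>B\<^esub> y))"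
    using bilinear_translate(1)[OF assms(1) ab] unfolding eq .
  have "tensor_functional \<beta> (pure a b \<otimes>\<^bsub>AB\<^esub> w) = support_sum \<beta> (single (a, b) \<otimes>\<^bsub>P\<^esub> f)"
    unfolding pure_tensor_def tensor_algebra_def f(2)
    using algebra_ideal.coset_ops(2)[OF algebra_ideal_tensor s f(1)]
      tensor_functional_coset[OF assms(1)] s f(1) by simp
  also have "\<dots> = support_sum (\<lambda>(x, y). \<beta> (a \<otimes>\<^bsub>A\<^esub> x, b \<otimes>\<^bsub>B\<^esub> y)) f"
    unfolding support_sum_mult[OF s f(1)] support_sum_single eq ..
  also have "\<dots> = tensor_functional (\<lambda>(x, y). \<beta> (a \<otimes>\<^bsub>A\<^esub> x, b \<otimes>\<^bsub>B\<^esub> y)) w"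
    unfolding f(2) by (rule tensor_functional_coset[OF bil f(1), symmetric])
  finally show ?thesis .
qed

end

section \<open>Existence of the antipode and the comultiplication\<close>

section \<open>The Hopf algebra structure\<close>

lemma complex_algebra_opposite:
  assumes "complex_algebra A"
  shows "complex_algebra (opposite A)"
proof -
  interpret complex_algebra A by fact
  have s: "carrier (opposite A) = carrier A" "\<one>\<^bsub>opposite A\<^esub> = \<one>\<^bsub>A\<^esub>" "\<zero>\<^bsub>opposite A\<^esub> = \<zero>\<^bsub>A\<^esub>"
    "x \<oplus>\<^bsub>opposite A\<^esub> y = x \<oplus>\<^bsub>A\<^esub> y" "x \<otimes>\<^bsub>opposite A\<^esub> y = y \<otimes>\<^bsub>A\<^esub> x" "c \<odot>\<^bsub>opposite A\<^esub> x = c \<odot>\<^bsub>A\<^esub> x" for x y c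
    by (simp_all add: opposite_def)
  show ?thesis
  proof (rule complex_algebraI)
    show "ring (opposite A)"
    proof (rule ringI)
      show "abelian_group (opposite A)"
        by (rule abelian_groupI) (auto simp: s a_ac intro: add.l_inv_ex)
      show "monoid (opposite A)" by (rule monoidI) (auto simp: s m_assoc)
    qed (auto simp: s l_distr r_distr)
  qed (auto simp: s smult_l_distr smult_r_distr smult_smult smult_mult_left smult_mult_right)
qed

context quantum_sl2
begin

lemma algebra_pair_UU: "algebra_pair U U"
  by (intro algebra_pair.intro complex_algebra_axioms)

sublocale T: algebra_pair U U by (rule algebra_pair_UU)

sublocale UU: complex_algebra "UU q" by (rule T.complex_algebra_AB)

abbreviation "pure \<equiv> UU_pure q"

lemma K_E: "u \<in> carrier U \<Longrightarrow> K \<otimes>\<^bsub>U\<^esub> (E \<otimes>\<^bsub>U\<^esub> u) = p \<odot>\<^bsub>U\<^esub> (E \<otimes>\<^bsub>U\<^esub> (K \<otimes>\<^bsub>U\<^esub> u))"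
  using K_X[of "K \<otimes>\<^bsub>U\<^esub> u"] by (simp add: m_assoc)

lemma K_Y_K: "K \<otimes>\<^bsub>U\<^esub> Y = (1 / p) \<odot>\<^bsub>U\<^esub> (Y \<otimes>\<^bsub>U\<^esub> K)"
  using K_Y[of "\<one>\<^bsub>U\<^esub>"] by simp

lemma E_L: "E \<otimes>\<^bsub>U\<^esub> L = p \<odot>\<^bsub>U\<^esub> (L \<otimes>\<^bsub>U\<^esub> E)"
proof -
  have "L \<otimes>\<^bsub>U\<^esub> (K \<otimes>\<^bsub>U\<^esub> (E \<otimes>\<^bsub>U\<^esub> L)) = p \<odot>\<^bsub>U\<^esub> (L \<otimes>\<^bsub>U\<^esub> E)"
    unfolding defining_relations(3) by (simp add: smult_mult_right)
  then show ?thesis by simp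
qed

lemma commutator_eq: "E \<otimes>\<^bsub>U\<^esub> Y = Y \<otimes>\<^bsub>U\<^esub> E \<oplus>\<^bsub>U\<^esub> (\<kappa> \<odot>\<^bsub>U\<^esub> K \<oplus>\<^bsub>U\<^esub> (- \<kappa>) \<odot>\<^bsub>U\<^esub> L)"
proof -
  have "Y \<otimes>\<^bsub>U\<^esub> E \<oplus>\<^bsub>U\<^esub> (E \<otimes>\<^bsub>U\<^esub> Y \<ominus>\<^bsub>U\<^esub> Y \<otimes>\<^bsub>U\<^esub> E) = E \<otimes>\<^bsub>U\<^esub> Y"
    using a_comm[of "E \<otimes>\<^bsub>U\<^esub> Y" "\<ominus>\<^bsub>U\<^esub> (Y \<otimes>\<^bsub>U\<^esub> E)"] by (simp add: minus_eq r_neg2)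
  then show ?thesis unfolding defining_relations(5)
    by (simp add: diff_eq_smult smult_r_distr smult_smult)
qed

text \<open>The antipode is defined by \<open>SOME\<close>, so its properties need an existence
  proof: the universal property with the opposite algebra as target and K, K^-1 exchanged.\<close>

lemma antipode: "is_Uq_antipode q (Uq_antipode q)"
proof -
  have O: "complex_algebra (opposite U)" by (rule complex_algebra_opposite) (rule complex_algebra_axioms)
  interpret O: complex_algebra "opposite U" by (rule O)
  have s: "carrier (opposite U) = carrier U" "\<one>\<^bsub>opposite U\<^esub> = \<one>\<^bsub>U\<^esub>" "\<zero>\<^bsub>opposite U\<^esub> = \<zero>\<^bsub>U\<^esub>"
    "x \<oplus>\<^bsub>opposite U\<^esub> y = x \<oplus>\<^bsub>U\<^esub> y" "x \<otimes>\<^bsub>opposite U\<^esub> y = y \<otimes>\<^bsub>U\<^esub> x" "c \<odot>\<^bsub>opposite U\<^esub> x = c \<odot>\<^bsub>U\<^esub> x" for x y c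
    by (simp_all add: opposite_def)
  let ?e = "\<ominus>\<^bsub>U\<^esub> (L \<otimes>\<^bsub>U\<^esub> E)" and ?f = "\<ominus>\<^bsub>U\<^esub> (Y \<otimes>\<^bsub>U\<^esub> K)"
  have e: "?e = (-1) \<odot>\<^bsub>U\<^esub> (L \<otimes>\<^bsub>U\<^esub> E)" and f: "?f = (-1) \<odot>\<^bsub>U\<^esub> (Y \<otimes>\<^bsub>U\<^esub> K)"
    by (simp_all add: minus_eq_smult)
  obtain h where "h \<in> alg_hom U (opposite U)" "h E = ?e" "h Y = ?f" "h K = L" "h L = K"
  proof (rule Uq_hom_exists[OF O, of ?e ?f L K q])
    show "L \<otimes>\<^bsub>opposite U\<^esub> (?e \<otimes>\<^bsub>opposite U\<^esub> K) = q\<^sup>2 \<odot>\<^bsub>opposite U\<^esub> ?e"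
      by (simp add: s e smult_mult_left smult_mult_right smult_smult m_assoc E_L flip: p_def)
    show "L \<otimes>\<^bsub>opposite U\<^esub> (?f \<otimes>\<^bsub>opposite U\<^esub> K) = inverse (q\<^sup>2) \<odot>\<^bsub>opposite U\<^esub> ?f"
      by (simp add: s f smult_mult_left smult_mult_right smult_smult m_assoc K_Y defining_relations inverse_eq_divide
          flip: p_def)
    \<comment> \<open>The two products come out as Y E and E Y, so the commutator changes sign,
      which matches the exchange of K and K^-1.\<close>
    have 1: "?e \<otimes>\<^bsub>opposite U\<^esub> ?f = Y \<otimes>\<^bsub>U\<^esub> E"
      by (simp add: s e f smult_mult_left smult_mult_right smult_smult m_assoc)
    have "L \<otimes>\<^bsub>U\<^esub> (E \<otimes>\<^bsub>U\<^esub> (Y \<otimes>\<^bsub>U\<^esub> K)) = E \<otimes>\<^bsub>U\<^esub> Y"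
    proof -
      have "E \<otimes>\<^bsub>U\<^esub> (Y \<otimes>\<^bsub>U\<^esub> K) = E \<otimes>\<^bsub>U\<^esub> (p \<odot>\<^bsub>U\<^esub> (K \<otimes>\<^bsub>U\<^esub> Y))"
        unfolding K_Y_K by (simp add: smult_smult)
      also have "\<dots> = K \<otimes>\<^bsub>U\<^esub> (E \<otimes>\<^bsub>U\<^esub> Y)"
        using K_E[of Y] by (simp add: smult_mult_right)
      finally show ?thesis by simp
    qed
    then have 2: "?f \<otimes>\<^bsub>opposite U\<^esub> ?e = E \<otimes>\<^bsub>U\<^esub> Y"
      by (simp add: s e f smult_mult_left smult_mult_right smult_smult m_assoc)
    show "?e \<otimes>\<^bsub>opposite U\<^esub> ?f \<ominus>\<^bsub>opposite U\<^esub> ?f \<otimes>\<^bsub>opposite U\<^esub> ?e =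
        (1 / (q - inverse q)) \<odot>\<^bsub>opposite U\<^esub> (L \<ominus>\<^bsub>opposite U\<^esub> K)"
      unfolding 1 2 \<kappa>_def[symmetric]
      by (simp add: O.diff_eq_smult s commutator_eq smult_r_distr smult_smult add.m_assoc[symmetric]
          add.inv_solve_left minus_eq_smult[symmetric] r_neg)
        (simp add: minus_smult smult_minus a_comm)
  qed (auto simp: s defining_relations)
  then have "is_Uq_antipode q h" by (simp add: is_Uq_antipode_def)
  then show ?thesis unfolding Uq_antipode_def by (rule someI[of "is_Uq_antipode q"])
qed

text \<open>Only the value at K is prescribed; applying the antipode to K K^-1 = 1 forces the value
  K at K^-1, and powers follow.\<close>

lemma antipode_Kpow: "Uq_antipode q (Kpow d) = Kpow (- d)"
proof -
  have S: "Uq_antipode q \<in> alg_hom U (opposite U)" "Uq_antipode q K = L"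
    using antipode by (auto simp: is_Uq_antipode_def)
  have s: "carrier (opposite U) = carrier U" "\<one>\<^bsub>opposite U\<^esub> = \<one>\<^bsub>U\<^esub>" "x \<otimes>\<^bsub>opposite U\<^esub> y = y \<otimes>\<^bsub>U\<^esub> x" for x y
    by (simp_all add: opposite_def)
  note D = alg_homD[OF S(1), unfolded s]
  have "Uq_antipode q L \<otimes>\<^bsub>U\<^esub> L = \<one>\<^bsub>U\<^esub>"
  proof -
    have "Uq_antipode q L \<otimes>\<^bsub>U\<^esub> Uq_antipode q K = Uq_antipode q (K \<otimes>\<^bsub>U\<^esub> L)" by (simp add: D)
    then show ?thesis by (simp add: S defining_relations D)
  qed
  then have "Uq_antipode q L \<otimes>\<^bsub>U\<^esub> L \<otimes>\<^bsub>U\<^esub> K = K" by simp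
  then have L: "Uq_antipode q L = K" by (simp add: m_assoc defining_relations D(1))
  have 1: "Uq_antipode q (K [^]\<^bsub>U\<^esub> n) = L [^]\<^bsub>U\<^esub> n" for n :: nat
  proof (induction n)
    case (Suc n)
    then show ?case using nat_pow_Suc2[of L n] by (simp add: D S)
  qed (simp add: D)
  have 2: "Uq_antipode q (L [^]\<^bsub>U\<^esub> n) = K [^]\<^bsub>U\<^esub> n" for n :: nat
  proof (induction n)
    case (Suc n)
    then show ?case using nat_pow_Suc2[of K n] by (simp add: D L)
  qed (simp add: D)
  show ?thesis by (cases "d = 0") (auto simp: Kpow_def 1 2 D)
qed

lemma comult: "is_Uq_comult q (Uq_comult q)"
proof -
  let ?e = "pure E \<one>\<^bsub>U\<^esub> \<oplus>\<^bsub>UU q\<^esub> pure K E" and ?f = "pure Y L \<oplus>\<^bsub>UU q\<^esub> pure \<one>\<^bsub>U\<^esub> Y"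
  note d = UU.l_distr UU.r_distr T.pure_mult T.pure_smult UU.smult_mult_left UU.smult_mult_right
    UU.smult_smult UU.smult_r_distr
  obtain h where "h \<in> alg_hom U (UU q)" "h E = ?e" "h Y = ?f" "h K = pure K K" "h L = pure L L"
  proof (rule Uq_hom_exists[OF T.complex_algebra_AB, of ?e ?f "pure K K" "pure L L" q])
    show "pure K K \<otimes>\<^bsub>UU q\<^esub> (?e \<otimes>\<^bsub>UU q\<^esub> pure L L) = q\<^sup>2 \<odot>\<^bsub>UU q\<^esub> ?e"
      by (simp add: d defining_relations flip: p_def)
    show "pure K K \<otimes>\<^bsub>UU q\<^esub> (?f \<otimes>\<^bsub>UU q\<^esub> pure L L) = inverse (q\<^sup>2) \<odot>\<^bsub>UU q\<^esub> ?f"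
      by (simp add: d defining_relations inverse_eq_divide flip: p_def)
    have 1: "?e \<otimes>\<^bsub>UU q\<^esub> ?f = (pure (E \<otimes>\<^bsub>U\<^esub> Y) L \<oplus>\<^bsub>UU q\<^esub> pure E Y) \<oplus>\<^bsub>UU q\<^esub>
        (pure (K \<otimes>\<^bsub>U\<^esub> Y) (E \<otimes>\<^bsub>U\<^esub> L) \<oplus>\<^bsub>UU q\<^esub> pure K (E \<otimes>\<^bsub>U\<^esub> Y))"
      by (simp add: d UU.a_ac)
    have 2: "?f \<otimes>\<^bsub>UU q\<^esub> ?e = (pure (Y \<otimes>\<^bsub>U\<^esub> E) L \<oplus>\<^bsub>UU q\<^esub> pure E Y) \<oplus>\<^bsub>UU q\<^esub>
        (pure (Y \<otimes>\<^bsub>U\<^esub> K) (L \<otimes>\<^bsub>U\<^esub> E) \<oplus>\<^bsub>UU q\<^esub> pure K (Y \<otimes>\<^bsub>U\<^esub> E))"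
      by (simp add: d UU.a_ac)
    \<comment> \<open>The factor 1/p from moving K past Y cancels the factor p from moving K^-1 past
      E.\<close>
    have 3: "pure (K \<otimes>\<^bsub>U\<^esub> Y) (E \<otimes>\<^bsub>U\<^esub> L) = pure (Y \<otimes>\<^bsub>U\<^esub> K) (L \<otimes>\<^bsub>U\<^esub> E)"
      by (simp add: K_Y_K E_L d)
    define A1 A2 A3 A4 B where "A1 = pure (Y \<otimes>\<^bsub>U\<^esub> E) L" and "A2 = pure E Y"
      and "A3 = pure (Y \<otimes>\<^bsub>U\<^esub> K) (L \<otimes>\<^bsub>U\<^esub> E)" and "A4 = pure K (Y \<otimes>\<^bsub>U\<^esub> E)"
      and "B = pure K L"
    have cl: "A1 \<in> carrier (UU q)" "A2 \<in> carrier (UU q)" "A3 \<in> carrier (UU q)" "A4 \<in> carrier (UU q)"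
      "B \<in> carrier (UU q)" "pure K K \<in> carrier (UU q)" "pure L L \<in> carrier (UU q)"
      by (simp_all add: A1_def A2_def A3_def A4_def B_def)
    have 4: "pure (E \<otimes>\<^bsub>U\<^esub> Y) L = A1 \<oplus>\<^bsub>UU q\<^esub> (\<kappa> \<odot>\<^bsub>UU q\<^esub> B \<oplus>\<^bsub>UU q\<^esub> (- \<kappa>) \<odot>\<^bsub>UU q\<^esub> pure L L)"
      "pure K (E \<otimes>\<^bsub>U\<^esub> Y) = A4 \<oplus>\<^bsub>UU q\<^esub> (\<kappa> \<odot>\<^bsub>UU q\<^esub> pure K K \<oplus>\<^bsub>UU q\<^esub> (- \<kappa>) \<odot>\<^bsub>UU q\<^esub> B)"
      by (simp_all add: commutator_eq T.pure_add_left T.pure_add_right T.pure_smult A1_def A4_def B_def)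
    have 5: "(- c) \<odot>\<^bsub>UU q\<^esub> x = \<ominus>\<^bsub>UU q\<^esub> (c \<odot>\<^bsub>UU q\<^esub> x)" if "x \<in> carrier (UU q)" for c x
      using that by (rule UU.minus_smult)
    \<comment> \<open>Cancellation in the additive group: \<open>b\<close> stands for
      \<open>\<kappa>\<close> times K tensor K^-1, which the two commutators contribute with
      opposite signs.\<close>
    have 6: "(a1 \<oplus>\<^bsub>UU q\<^esub> (b \<oplus>\<^bsub>UU q\<^esub> \<ominus>\<^bsub>UU q\<^esub> l) \<oplus>\<^bsub>UU q\<^esub> a2) \<oplus>\<^bsub>UU q\<^esub> (a3 \<oplus>\<^bsub>UU q\<^esub> (a4 \<oplus>\<^bsub>UU q\<^esub> (k \<oplus>\<^bsub>UU q\<^esub> \<ominus>\<^bsub>UU q\<^esub> b))) \<ominus>\<^bsub>UU q\<^esub>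
       ((a1 \<oplus>\<^bsub>UU q\<^esub> a2) \<oplus>\<^bsub>UU q\<^esub> (a3 \<oplus>\<^bsub>UU q\<^esub> a4)) = k \<oplus>\<^bsub>UU q\<^esub> \<ominus>\<^bsub>UU q\<^esub> l"
      if "a1 \<in> carrier (UU q)" "a2 \<in> carrier (UU q)" "a3 \<in> carrier (UU q)" "a4 \<in> carrier (UU q)"
        "b \<in> carrier (UU q)" "k \<in> carrier (UU q)" "l \<in> carrier (UU q)" for a1 a2 a3 a4 b k l
    proof -
      have "(a1 \<oplus>\<^bsub>UU q\<^esub> (b \<oplus>\<^bsub>UU q\<^esub> \<ominus>\<^bsub>UU q\<^esub> l) \<oplus>\<^bsub>UU q\<^esub> a2) \<oplus>\<^bsub>UU q\<^esub> (a3 \<oplus>\<^bsub>UU q\<^esub> (a4 \<oplus>\<^bsub>UU q\<^esub> (k \<oplus>\<^bsub>UU q\<^esub> \<ominus>\<^bsub>UU q\<^esub> b))) =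
        (k \<oplus>\<^bsub>UU q\<^esub> \<ominus>\<^bsub>UU q\<^esub> l) \<oplus>\<^bsub>UU q\<^esub> ((a1 \<oplus>\<^bsub>UU q\<^esub> a2) \<oplus>\<^bsub>UU q\<^esub> (a3 \<oplus>\<^bsub>UU q\<^esub> a4))"
        using that by (simp add: UU.a_ac UU.r_neg1 UU.r_neg2 UU.r_neg UU.l_neg)
      moreover have "(t \<oplus>\<^bsub>UU q\<^esub> s) \<ominus>\<^bsub>UU q\<^esub> s = t" if "t \<in> carrier (UU q)" "s \<in> carrier (UU q)" for s t
        using that by (simp add: UU.minus_eq UU.a_assoc UU.r_neg)
      ultimately show ?thesis using that by simp
    qed
    show "?e \<otimes>\<^bsub>UU q\<^esub> ?f \<ominus>\<^bsub>UU q\<^esub> ?f \<otimes>\<^bsub>UU q\<^esub> ?e =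
        (1 / (q - inverse q)) \<odot>\<^bsub>UU q\<^esub> (pure K K \<ominus>\<^bsub>UU q\<^esub> pure L L)"
      unfolding 1 2 3 4 A1_def[symmetric] A2_def[symmetric] A3_def[symmetric] A4_def[symmetric] \<kappa>_def[symmetric]
      using cl by (simp only: 5 6 UU.smult_closed) (simp add: UU.minus_eq UU.smult_r_distr UU.smult_minus 5)
  qed (auto simp: T.pure_mult defining_relations T.one_AB)
  then have "is_Uq_comult q h" by (simp add: is_Uq_comult_def)
  then show ?thesis unfolding Uq_comult_def by (rule someI[of "is_Uq_comult q"])
qed

end

context quantum_sl2
begin

section \<open>Coefficients of the comultiplication in the PBW basis\<close>

subsection \<open>Coordinates of the comultiplication\<close>

abbreviation "\<Delta> \<equiv> Uq_comult q"

lemmas comult_hom = alg_homD[OF comult[unfolded is_Uq_comult_def, THEN conjunct1]]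

lemma comult_gens:
  "\<Delta> E = pure E \<one>\<^bsub>U\<^esub> \<oplus>\<^bsub>UU q\<^esub> pure K E" "\<Delta> Y = pure Y L \<oplus>\<^bsub>UU q\<^esub> pure \<one>\<^bsub>U\<^esub> Y" "\<Delta> K = pure K K"
  using comult by (auto simp: is_Uq_comult_def)

text \<open>Forced by multiplicativity: Delta(K) Delta(K^-1) = 1, and K^-1 tensor K^-1 is a left
  inverse of Delta(K).\<close>

lemma comult_L: "\<Delta> L = pure L L"
proof -
  have "pure L L \<otimes>\<^bsub>UU q\<^esub> (\<Delta> K \<otimes>\<^bsub>UU q\<^esub> \<Delta> L) = pure L L \<otimes>\<^bsub>UU q\<^esub> \<Delta> \<one>\<^bsub>U\<^esub>"
    by (simp add: defining_relations flip: comult_hom(3))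
  moreover have "pure L L \<otimes>\<^bsub>UU q\<^esub> \<Delta> K = \<one>\<^bsub>UU q\<^esub>"
    by (simp add: comult_gens T.pure_mult defining_relations T.one_AB)
  ultimately show ?thesis
    by (simp add: comult_hom flip: UU.m_assoc)
qed

lemma comult_X: "\<Delta> X = pure X L \<oplus>\<^bsub>UU q\<^esub> pure \<one>\<^bsub>U\<^esub> X"
  by (simp add: comult_hom comult_gens comult_L UU.l_distr T.pure_mult defining_relations)

definition pairing :: "nat \<times> nat \<times> int \<Rightarrow> nat \<times> nat \<times> int \<Rightarrow> uq \<times> uq \<Rightarrow> complex" where
  "pairing i m = (\<lambda>(x, y). coord x i * coord y m)"

text \<open>The coefficient of \<open>Mon i \<otimes> Mon m\<close> in \<open>w\<close>.\<close>

definition tensor_coord :: "(uq \<times> uq \<Rightarrow> complex) set \<Rightarrow> nat \<times> nat \<times> int \<Rightarrow> nat \<times> nat \<times> int \<Rightarrow> complex" where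
  "tensor_coord w i m = T.tensor_functional (pairing i m) w"

lemma bilinear_pairing: "T.bilinear (pairing i m)"
  by (auto simp: T.bilinear_def pairing_def coord_ops algebra_simps)

lemma tensor_coord_linear:
  assumes "w \<in> carrier (UU q)"
  shows "v \<in> carrier (UU q) \<Longrightarrow> tensor_coord (w \<oplus>\<^bsub>UU q\<^esub> v) i m = tensor_coord w i m + tensor_coord v i m"
    "tensor_coord (c \<odot>\<^bsub>UU q\<^esub> w) i m = c * tensor_coord w i m"
  using T.tensor_functional_linear[OF bilinear_pairing assms] by (simp_all add: tensor_coord_def)

lemma tensor_coord_pure:
  "x \<in> carrier U \<Longrightarrow> y \<in> carrier U \<Longrightarrow> tensor_coord (pure x y) i m = coord x i * coord y m"
  by (simp add: tensor_coord_def T.tensor_functional_pure[OF bilinear_pairing]) (simp add: pairing_def)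

text \<open>Left multiplication by \<open>pure x y\<close> acts on the two coordinate vectors
  through \<open>rep x\<close> and \<open>rep y\<close>, so the coefficients of the product become
  combinations of coefficients of \<open>w\<close>.\<close>

lemma tensor_functional_rep:
  assumes "x \<in> carrier U" "y \<in> carrier U" "w \<in> carrier (UU q)"
  shows "tensor_coord (pure x y \<otimes>\<^bsub>UU q\<^esub> w) i m =
    T.tensor_functional (\<lambda>n. rep x (coord (fst n)) i * rep y (coord (snd n)) m) w"
proof -
  obtain f where f: "f \<in> carrier T.P" "w = T.I +>\<^bsub>T.P\<^esub> f" using T.AB_cosets[OF assms(3)] .
  have b: "T.bilinear (\<lambda>(a, b). pairing i m (x \<otimes>\<^bsub>U\<^esub> a, y \<otimes>\<^bsub>U\<^esub> b))"
    using assms(1,2) by (auto simp: T.bilinear_def pairing_def coord_ops rep_linear algebra_simps)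
  have b': "T.bilinear (\<lambda>n. rep x (coord (fst n)) i * rep y (coord (snd n)) m)"
    using assms(1,2) by (auto simp: T.bilinear_def coord_ops rep_linear algebra_simps)
  show ?thesis
    unfolding tensor_coord_def T.tensor_functional_pure_mult[OF bilinear_pairing assms]
    unfolding f(2) T.tensor_functional_coset[OF b f(1)] T.tensor_functional_coset[OF b' f(1)]
    \<comment> \<open>The two forms agree on pairs from the carrier, and the representative is
      supported there.\<close>
    by (rule support_sum_cong)
      (use T.support_P[OF f(1)] assms(1,2) in \<open>force simp: pairing_def coord_ops\<close>)
qed

lemma tensor_coord_combine:
  assumes "w \<in> carrier (UU q)"
  shows "T.tensor_functional (\<lambda>n. c1 * pairing i1 m1 n) w = c1 * tensor_coord w i1 m1"
    "T.tensor_functional (\<lambda>n. c1 * pairing i1 m1 n + c2 * pairing i2 m2 n + c3 * pairing i3 m3 n) w =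
      c1 * tensor_coord w i1 m1 + c2 * tensor_coord w i2 m2 + c3 * tensor_coord w i3 m3"
  using assms by (simp_all add: tensor_coord_def T.tensor_functional_combine T.bilinear_combine bilinear_pairing)

definition dcoord :: "uq \<Rightarrow> nat \<times> nat \<times> int \<Rightarrow> nat \<times> nat \<times> int \<Rightarrow> complex" where
  "dcoord u = tensor_coord (\<Delta> u)"

lemma dcoord_linear:
  "u \<in> carrier U \<Longrightarrow> v \<in> carrier U \<Longrightarrow> dcoord (u \<oplus>\<^bsub>U\<^esub> v) i m = dcoord u i m + dcoord v i m"
  "u \<in> carrier U \<Longrightarrow> dcoord (c \<odot>\<^bsub>U\<^esub> u) i m = c * dcoord u i m"
  by (simp_all add: dcoord_def comult_hom tensor_coord_linear)

text \<open>By \<open>comult_X\<close>, X tensor K^-1 acts by \<open>Xop\<close> on the left index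
  and by \<open>Lop\<close> on the right one, whence the power of p and the shift in d; 1 tensor X
  acts on the right index only.\<close>

lemma dcoord_X:
  assumes "u \<in> carrier U"
  shows "dcoord (X \<otimes>\<^bsub>U\<^esub> u) i (a, b, d) =
    p ^ b / p ^ a * Xop (\<lambda>i. dcoord u i (a, b, d + 1)) i + Xop (dcoord u i) (a, b, d)"
proof -
  obtain a1 b1 d1 where i: "i = (a1, b1, d1)" by (cases i)
  have w: "\<Delta> u \<in> carrier (UU q)" using assms comult_hom by simp
  have "tensor_coord (pure X L \<otimes>\<^bsub>UU q\<^esub> \<Delta> u) i (a, b, d) =
      T.tensor_functional (\<lambda>n. (if a1 = 0 then 0 else p ^ b / p ^ a) * pairing (a1 - 1, b1, d1) (a, b, d + 1) n) (\<Delta> u)"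
    (is "_ = T.tensor_functional ?f1 _")
    unfolding tensor_functional_rep[OF X_closed Uq_gen_closed w]
    by (rule arg_cong[of _ _ "\<lambda>f. T.tensor_functional f _"])
      (auto simp: fun_eq_iff rep rep_X ops_def i pairing_def)
  moreover have "tensor_coord (pure \<one>\<^bsub>U\<^esub> X \<otimes>\<^bsub>UU q\<^esub> \<Delta> u) i (a, b, d) =
      T.tensor_functional (\<lambda>n. (if a = 0 then 0 else 1) * pairing i (a - 1, b, d) n) (\<Delta> u)"
    (is "_ = T.tensor_functional ?f2 _")
    unfolding tensor_functional_rep[OF one_closed X_closed w]
    by (rule arg_cong[of _ _ "\<lambda>f. T.tensor_functional f _"])
      (auto simp: fun_eq_iff rep_ops rep_X ops_def pairing_def)
  moreover have "\<Delta> (X \<otimes>\<^bsub>U\<^esub> u) = pure X L \<otimes>\<^bsub>UU q\<^esub> \<Delta> u \<oplus>\<^bsub>UU q\<^esub> pure \<one>\<^bsub>U\<^esub> X \<otimes>\<^bsub>UU q\<^esub> \<Delta> u"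
    using assms w by (simp only: comult_hom(3) X_closed comult_X UU.l_distr T.pure_closed Uq_gen_closed one_closed)
  ultimately have "dcoord (X \<otimes>\<^bsub>U\<^esub> u) i (a, b, d) = T.tensor_functional ?f1 (\<Delta> u) + T.tensor_functional ?f2 (\<Delta> u)"
    using w unfolding dcoord_def
    by (simp only: tensor_coord_linear(1) UU.m_closed T.pure_closed X_closed Uq_gen_closed one_closed)
  then show ?thesis
    unfolding tensor_coord_combine[OF w] by (simp add: Xop_def dcoord_def i ring_distribs)
qed

lemma dcoord_Y:
  assumes "u \<in> carrier U"
  shows "dcoord (Y \<otimes>\<^bsub>U\<^esub> u) i (a, b, d) =
    p ^ b / p ^ a * Yop (\<lambda>i. dcoord u i (a, b, d + 1)) i + Yop (dcoord u i) (a, b, d)"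
proof -
  obtain a1 b1 d1 where i: "i = (a1, b1, d1)" by (cases i)
  have w: "\<Delta> u \<in> carrier (UU q)" using assms comult_hom by simp
  have "tensor_coord (pure Y L \<otimes>\<^bsub>UU q\<^esub> \<Delta> u) i (a, b, d) =
      T.tensor_functional (\<lambda>n. (if b1 = 0 then 0 else p ^ b / p ^ a / p ^ a1) * pairing (a1, b1 - 1, d1) (a, b, d + 1) n
        + (p ^ b / p ^ a * - (\<kappa> * qnum (1 / p) (Suc a1))) * pairing (Suc a1, b1, d1) (a, b, d + 1) n
        + (p ^ b / p ^ a * (\<kappa> * qnum (1 / p) (Suc a1) / p ^ a1 * p ^ (2 * b1))) * pairing (Suc a1, b1, d1 + 2) (a, b, d + 1) n) (\<Delta> u)"
    (is "_ = T.tensor_functional ?f1 _")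
    unfolding tensor_functional_rep[OF Uq_gen_closed Uq_gen_closed w]
    by (rule arg_cong[of _ _ "\<lambda>f. T.tensor_functional f _"])
      (auto simp: fun_eq_iff rep ops_def i pairing_def ring_distribs, simp_all add: field_simps)
  moreover have "tensor_coord (pure \<one>\<^bsub>U\<^esub> Y \<otimes>\<^bsub>UU q\<^esub> \<Delta> u) i (a, b, d) =
      T.tensor_functional (\<lambda>n. (if b = 0 then 0 else 1 / p ^ a) * pairing i (a, b - 1, d) n
        + (- (\<kappa> * qnum (1 / p) (Suc a))) * pairing i (Suc a, b, d) n
        + (\<kappa> * qnum (1 / p) (Suc a) / p ^ a * p ^ (2 * b)) * pairing i (Suc a, b, d + 2) n) (\<Delta> u)"
    (is "_ = T.tensor_functional ?f2 _")
    unfolding tensor_functional_rep[OF one_closed Uq_gen_closed w]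
    by (rule arg_cong[of _ _ "\<lambda>f. T.tensor_functional f _"])
      (auto simp: fun_eq_iff rep rep_ops ops_def pairing_def ring_distribs)
  moreover have "\<Delta> (Y \<otimes>\<^bsub>U\<^esub> u) = pure Y L \<otimes>\<^bsub>UU q\<^esub> \<Delta> u \<oplus>\<^bsub>UU q\<^esub> pure \<one>\<^bsub>U\<^esub> Y \<otimes>\<^bsub>UU q\<^esub> \<Delta> u"
    using assms w by (simp only: comult_hom(3) Uq_gen_closed comult_gens UU.l_distr T.pure_closed one_closed)
  ultimately have "dcoord (Y \<otimes>\<^bsub>U\<^esub> u) i (a, b, d) = T.tensor_functional ?f1 (\<Delta> u) + T.tensor_functional ?f2 (\<Delta> u)"
    using w unfolding dcoord_def
    by (simp only: tensor_coord_linear(1) UU.m_closed T.pure_closed X_closed Uq_gen_closed one_closed)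
  then show ?thesis
    unfolding tensor_coord_combine[OF w] by (simp add: Yop_def dcoord_def i field_simps)
qed

lemma dcoord_Kpow: "dcoord (Kpow d) i m = single (0, 0, d) i * single (0, 0, d) m"
proof -
  have K: "\<Delta> (K [^]\<^bsub>U\<^esub> n) = pure (K [^]\<^bsub>U\<^esub> n) (K [^]\<^bsub>U\<^esub> n)" for n :: nat
    by (induction n) (simp_all add: comult_hom T.one_AB comult_gens T.pure_mult)
  have L: "\<Delta> (L [^]\<^bsub>U\<^esub> n) = pure (L [^]\<^bsub>U\<^esub> n) (L [^]\<^bsub>U\<^esub> n)" for n :: nat
    by (induction n) (simp_all add: comult_hom T.one_AB comult_L T.pure_mult)
  have "\<Delta> (Kpow d) = pure (Kpow d) (Kpow d)" by (simp add: Kpow_def K L)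
  then show ?thesis by (simp add: dcoord_def tensor_coord_pure coord_Kpow)
qed

text \<open>The three claims are proved together: \<open>Yop\<close> at an index also reads the
  indices with one more X, and the first claim makes these terms vanish. The q-integer arises
  because each further Y turns the previous value into p times it plus 1.\<close>

lemma dcoord_Mon_0:
  "dcoord (Mon (0, b, d)) i (Suc a', b', e) = 0" (is "?A b i a' b' e")
  "dcoord (Mon (0, b, d)) i (0, 0, e) = (if e = d - int b then single (0, b, d) i else 0)" (is "?B b i e")
  "dcoord (Mon (0, b, d)) i (0, Suc 0, e) =
    (if e = d - int b + 1 then qnum p b * single (0, b - 1, d) i else 0)" (is "?C b i e")
proof -
  have "(\<forall>i a' b' e. ?A b i a' b' e) \<and> (\<forall>i e. ?B b i e) \<and> (\<forall>i e. ?C b i e)"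
  proof (induction b)
    case 0
    show ?case by (auto simp: Mon_K dcoord_Kpow single_def)
  next
    case (Suc b)
    then have IH: "?A b i a' b' e" "?B b i e" "?C b i e" for i a' b' e by blast+
    note Y = dcoord_Y[OF Mon_closed, of "(0, b, d)", unfolded Mon_Y]
    have lin: "Yop (\<lambda>i. if P then c * v i else 0) i = (if P then c * Yop v i else 0)"
      "Yop (\<lambda>i. if P then v i else 0) i = (if P then Yop v i else 0)" "Yop (\<lambda>i. 0) i = 0" for P c v i
      by (auto simp: Yop_def algebra_simps split: prod.splits)
    have "?A (Suc b) i a' b' e" for i a' b' e
      unfolding Y IH(1) lin by (simp add: Yop_def IH(1))
    moreover have "?B (Suc b) i e" for i e
      unfolding Y IH(2) lin ops_single by (auto simp: Yop_def IH(1))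
    moreover have "?C (Suc b) i e" for i e
    proof -
      have "Yop (dcoord (Mon (0, b, d)) i) (0, Suc 0, e) = (if e = d - int b then single (0, b, d) i else 0)"
        by (simp add: Yop_def IH)
      then show ?thesis unfolding Y IH(3) lin
        by (cases b) (auto simp: ops_single qnum_Suc' algebra_simps)
    qed
    ultimately show ?case by blast
  qed
  then show "?A b i a' b' e" "?B b i e" "?C b i e" by blast+
qed

text \<open>Moving K^-1 past the right tensor factor multiplies, for each X, the coefficient at Y
  K^e by p and the one at X K^e by 1/p. The latter also gains 1 each time, which makes it a
  q-integer in 1/p.\<close>

lemma dcoord_Mon:
  "dcoord (Mon (a, b, d)) i (0, 0, e) = (if e = d - int a - int b then single (a, b, d) i else 0)" (is "?A a i e")
  "dcoord (Mon (a, b, d)) i (0, Suc 0, e) =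
    (if e = d - int a - int b + 1 then p ^ a * qnum p b * single (a, b - 1, d) i else 0)" (is "?B a i e")
  "dcoord (Mon (a, b, d)) i (Suc 0, 0, e) =
    (if e = d - int a - int b + 1 then qnum (1 / p) a * single (a - 1, b, d) i else 0)" (is "?C a i e")
proof -
  have "(\<forall>i e. ?A a i e) \<and> (\<forall>i e. ?B a i e) \<and> (\<forall>i e. ?C a i e)"
  proof (induction a)
    case 0
    show ?case by (simp add: dcoord_Mon_0)
  next
    case (Suc a)
    then have IH: "?A a i e" "?B a i e" "?C a i e" for i e by blast+
    note X = dcoord_X[OF Mon_closed, of "(a, b, d)", unfolded Mon_X]
    have lin: "Xop (\<lambda>i. if P then c * v i else 0) i = (if P then c * Xop v i else 0)"
      "Xop (\<lambda>i. if P then v i else 0) i = (if P then Xop v i else 0)" for P c v i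
      by (auto simp: Xop_def algebra_simps split: prod.splits)
    have "?A (Suc a) i e" for i e
      unfolding X IH(1) lin ops_single by (auto simp: Xop_def)
    moreover have "?B (Suc a) i e" for i e
      unfolding X IH(2) lin ops_single by (auto simp: Xop_def)
    moreover have "?C (Suc a) i e" for i e
    proof -
      have "Xop (dcoord (Mon (a, b, d)) i) (Suc 0, 0, e) =
          (if e = d - int a - int b then single (a, b, d) i else 0)"
        by (simp add: Xop_def IH)
      then show ?thesis unfolding X IH(3) lin
        by (cases a) (auto simp: ops_single qnum_Suc' field_simps)
    qed
    ultimately show ?case by blast
  qed
  then show "?A a i e" "?B a i e" "?C a i e" by blast+
qed

text \<open>The table for monomials, read as operators on coordinates: the functional at K^e
  projects to the component d - a - b = e, those at Y K^e and X K^e are the skew derivations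
  followed by this projection. Written in terms of the lowered index, the condition on e is the same
  in all three.\<close>

lemma dcoord_eq:
  assumes "u \<in> carrier U"
  shows "dcoord u (a, b, d) (0, 0, e) = (if e = d - int a - int b then coord u (a, b, d) else 0)" (is "?A u")
    "dcoord u (a, b, d) (0, Suc 0, e) =
      (if e = d - int a - int b then p ^ a * qnum p (Suc b) * coord u (a, Suc b, d) else 0)" (is "?B u")
    "dcoord u (a, b, d) (Suc 0, 0, e) =
      (if e = d - int a - int b then qnum (1 / p) (Suc a) * coord u (Suc a, b, d) else 0)" (is "?C u")
proof -
  have "?A u \<and> ?B u \<and> ?C u"
    using assms
  proof (induction rule: pbw_induct)
    case (mon i)
    obtain a' b' d' where i: "i = (a', b', d')" by (cases i)
    show ?case unfolding i dcoord_Mon coord_Mon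
      by (cases a'; cases b') (auto simp: single_def)
  next
    case (add x y)
    then show ?case by (auto simp: dcoord_linear coord_ops algebra_simps)
  next
    case (smult c x)
    then show ?case by (auto simp: dcoord_linear coord_ops)
  qed
  then show "?A u" "?B u" "?C u" by blast+
qed

text \<open>The tensors whose slice at \<open>m\<close> is the coordinate function of an element of
  C form a subspace. It contains the pure tensors with left factor in C, hence the whole subspace
  that contains Delta(C).\<close>

lemma coideal_dcoord:
  assumes C: "right_coideal_subalgebra U \<Delta> C" and u: "u \<in> C"
  shows "(\<lambda>i. dcoord u i m) \<in> coord ` C"
proof -
  have sub: "unital_subalgebra U C" using C by (simp add: right_coideal_subalgebra_def)
  note S = unital_subalgebraD[OF sub]
  let ?W = "{w \<in> carrier (UU q). (\<lambda>i. tensor_coord w i m) \<in> coord ` C}"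
  have "submodule ?W complex_ring (UU q)"
  proof (rule UU.submoduleI')
    have "tensor_coord \<zero>\<^bsub>UU q\<^esub> i m = coord \<zero>\<^bsub>U\<^esub> i" for i
      using tensor_coord_linear(2)[of "\<zero>\<^bsub>UU q\<^esub>" 0 i m] coord_ops(2)[of "\<one>\<^bsub>U\<^esub>" 0] by simp
    then show "\<zero>\<^bsub>UU q\<^esub> \<in> ?W" using S(2) by auto
    fix v w assume vw: "v \<in> ?W" "w \<in> ?W"
    then obtain x y where "x \<in> C" "y \<in> C" "(\<lambda>i. tensor_coord v i m) = coord x" "(\<lambda>i. tensor_coord w i m) = coord y"
      by auto
    moreover from this have "(\<lambda>i. tensor_coord (v \<oplus>\<^bsub>UU q\<^esub> w) i m) = coord (x \<oplus>\<^bsub>U\<^esub> y)"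
      using vw S(1) by (auto simp: tensor_coord_linear coord_ops fun_eq_iff subset_iff)
    ultimately show "v \<oplus>\<^bsub>UU q\<^esub> w \<in> ?W" using vw S(4) by auto
  next
    fix c w assume w: "w \<in> ?W"
    then obtain x where "x \<in> C" "(\<lambda>i. tensor_coord w i m) = coord x" by auto
    moreover from this have "(\<lambda>i. tensor_coord (c \<odot>\<^bsub>UU q\<^esub> w) i m) = coord (c \<odot>\<^bsub>U\<^esub> x)"
      using w S(1) by (auto simp: tensor_coord_linear coord_ops fun_eq_iff subset_iff)
    ultimately show "c \<odot>\<^bsub>UU q\<^esub> w \<in> ?W" using w S(5) by auto
  qed auto
  moreover have "{pure s t |s t. s \<in> C \<and> t \<in> carrier U} \<subseteq> ?W"
  proof clarify
    fix s t assume st: "s \<in> C" "t \<in> carrier U"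
    then have s: "s \<in> carrier U" using S(1) by auto
    have "(\<lambda>i. tensor_coord (pure s t) i m) = coord (coord t m \<odot>\<^bsub>U\<^esub> s)"
      using s st(2) by (auto simp: tensor_coord_pure coord_ops fun_eq_iff)
    then show "pure s t \<in> carrier (UU q) \<and> (\<lambda>i. tensor_coord (pure s t) i m) \<in> coord ` C"
      using s st S(5) by auto
  qed
  ultimately have "tensor_subspace U U C (carrier U) \<subseteq> ?W"
    unfolding tensor_subspace_def linear_span_def by (intro hull_minimal)
  moreover have "\<Delta> u \<in> tensor_subspace U U C (carrier U)"
    using C u by (auto simp: right_coideal_subalgebra_def)
  ultimately show ?thesis by (auto simp: dcoord_def)
qed

end

section \<open>Subalgebras as sets of coordinate functions, and the degree filtration\<close>

section \<open>Subalgebras in coordinates\<close>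

context quantum_sl2
begin

text \<open>Coordinates of x X + y Y + z K^-1; \<open>degree1_op\<close> is left multiplication by
  this element, and \<open>Rshift e\<close> is right multiplication by K^e.\<close>

definition degree1 :: "complex \<Rightarrow> complex \<Rightarrow> complex \<Rightarrow> coords" where
  "degree1 x y z = (\<lambda>i. x * single (Suc 0, 0, 0) i + y * single (0, Suc 0, 0) i + z * single (0, 0, -1) i)"

definition degree1_op :: "complex \<Rightarrow> complex \<Rightarrow> complex \<Rightarrow> coords \<Rightarrow> coords" where
  "degree1_op x y z v = (\<lambda>i. x * Xop v i + y * Yop v i + z * Lop v i)"

definition Rshift :: "int \<Rightarrow> coords \<Rightarrow> coords" where
  "Rshift e v = (\<lambda>(a, b, d). v (a, b, d - e))"

text \<open>Images under \<open>coord\<close> replace carrier conditions by arithmetic of functions;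
  generation by a set is later expressed by ranging over all such images.\<close>

definition coord_subalgebra :: "coords set \<Rightarrow> bool" where
  "coord_subalgebra S \<longleftrightarrow> (\<exists>C. unital_subalgebra U C \<and> S = coord ` C)"

definition element :: "complex \<Rightarrow> complex \<Rightarrow> complex \<Rightarrow> uq" where
  "element x y z = x \<odot>\<^bsub>U\<^esub> X \<oplus>\<^bsub>U\<^esub> y \<odot>\<^bsub>U\<^esub> Y \<oplus>\<^bsub>U\<^esub> z \<odot>\<^bsub>U\<^esub> L"

lemma element_closed [simp]: "element x y z \<in> carrier U"
  by (simp add: element_def)

lemma coord_gens: "coord X = single (Suc 0, 0, 0)" "coord Y = single (0, Suc 0, 0)" "coord L = single (0, 0, -1)"
    "coord K = single (0, 0, 1)"
  unfolding coord_def rep_X rep(3-5) ops_single by simp_all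

lemma coord_element: "coord (element x y z) = degree1 x y z"
  by (simp only: element_def coord_ops(1,2) smult_closed a_closed X_closed Uq_gen_closed coord_gens degree1_def)

lemma rep_element: "rep (element x y z) = degree1_op x y z"
  by (rule ext) (simp only: element_def rep_ops(1,2) smult_closed a_closed X_closed Uq_gen_closed rep rep_X degree1_op_def)

text \<open>Left and right multiplication commute. On generators this is visible in the formulas,
  whose coefficients do not depend on d.\<close>

lemma rep_Rshift:
  assumes "u \<in> carrier U"
  shows "rep u (Rshift e v) = Rshift e (rep u v)"
  using assms
proof (induction arbitrary: v rule: U_induct)
  case (gen g x)
  have "rep (Uq_gen q g) (Rshift e w) = Rshift e (rep (Uq_gen q g) w)" for w
    by (cases g) (auto simp: rep ops_def Rshift_def fun_eq_iff algebra_simps)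
  then show ?case using gen by (simp add: rep_ops)
qed (auto simp: rep_ops Rshift_def fun_eq_iff)

lemma coord_mult_Kpow:
  assumes "u \<in> carrier U"
  shows "coord (u \<otimes>\<^bsub>U\<^esub> Kpow e) = Rshift e (coord u)"
proof -
  have "single (0, 0, e) = Rshift e (single (0, 0, 0))"
    by (auto simp: Rshift_def single_eq fun_eq_iff)
  then show ?thesis
    using assms rep_Rshift[OF assms, of e "single (0, 0, 0)"] by (simp add: coord_ops coord_Kpow coord_def[of u])
qed

lemma rep_Kpow: "rep (Kpow (int n)) v = (\<lambda>(a, b, d). (p ^ a / p ^ b) ^ n * v (a, b, d - int n))"
proof (induction n)
  case 0
  then show ?case by (simp add: rep_ops fun_eq_iff)
next
  case (Suc n)
  have "Kpow (int (Suc n)) = K \<otimes>\<^bsub>U\<^esub> Kpow (int n)" by (simp add: K_Kpow add.commute)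
  then have "rep (Kpow (int (Suc n))) v = Kop (rep (Kpow (int n)) v)"
    by (simp only: rep_ops(3) Uq_gen_closed Kpow_closed rep)
  then show ?case unfolding Suc by (auto simp: Kop_def fun_eq_iff algebra_simps)
qed

lemma coord_subalgebraD:
  assumes "coord_subalgebra S"
  shows "v \<in> S \<Longrightarrow> w \<in> S \<Longrightarrow> (\<lambda>i. v i + w i) \<in> S"
    "v \<in> S \<Longrightarrow> (\<lambda>i. c * v i) \<in> S"
    "single (0, 0, 0) \<in> S"
    "v \<in> S \<Longrightarrow> finite {i. v i \<noteq> 0}"
    "degree1 x y z \<in> S \<Longrightarrow> v \<in> S \<Longrightarrow> degree1_op x y z v \<in> S"
    "single (0, 0, e) \<in> S \<Longrightarrow> v \<in> S \<Longrightarrow> Rshift e v \<in> S"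
    "single (0, 0, int n) \<in> S \<Longrightarrow> single (0, 0, - int n) \<in> S \<Longrightarrow> v \<in> S \<Longrightarrow>
      (\<lambda>(a, b, d). (p ^ a / p ^ b) ^ n * v (a, b, d)) \<in> S"
proof -
  obtain C where C: "unital_subalgebra U C" "S = coord ` C"
    using assms by (auto simp: coord_subalgebra_def)
  note D = unital_subalgebraD[OF C(1)]
  have cl: "u \<in> carrier U" if "u \<in> C" for u using that D(1) by auto
  have im: "v \<in> S" if "u \<in> C" "v = coord u" for u v
    using that C(2) by simp
  have mem: "u \<in> C" if "coord u \<in> S" "u \<in> carrier U" for u
    using that C(2) coord_inject cl by blast
  show "(\<lambda>i. v i + w i) \<in> S" if vw: "v \<in> S" "w \<in> S" for v w
  proof -
    from vw C(2) obtain x y where "x \<in> C" "y \<in> C" "v = coord x" "w = coord y" by auto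
    then show ?thesis using coord_ops(1)[of x y] cl by (intro im[OF D(4)[of x y]]) auto
  qed
  show "(\<lambda>i. c * v i) \<in> S" if v: "v \<in> S" for v c
  proof -
    from v C(2) obtain x where "x \<in> C" "v = coord x" by auto
    then show ?thesis using coord_ops(2)[of x c] cl by (intro im[OF D(5)[of x c]]) auto
  qed
  show "single (0, 0, 0) \<in> S" by (rule im[OF D(3)]) (simp add: coord_ops)
  show "finite {i. v i \<noteq> 0}" if "v \<in> S" using that C(2) cl finite_coord by auto
  have mult: "rep u v \<in> S" if "coord u \<in> S" "u \<in> carrier U" "v \<in> S" for u v
  proof -
    from that C(2) obtain x where "x \<in> C" "v = coord x" by auto
    then show ?thesis using mem[OF that(1,2)] coord_ops(3)[of u x] cl by (intro im[OF D(6)[of u x]]) auto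
  qed
  show "degree1_op x y z v \<in> S" if "degree1 x y z \<in> S" "v \<in> S"
    using mult[of "element x y z" v] that by (simp add: coord_element rep_element)
  show R: "Rshift e v \<in> S" if ev: "single (0, 0, e) \<in> S" "v \<in> S" for e v
  proof -
    have k: "Kpow e \<in> C" using mem[of "Kpow e"] ev by (simp add: coord_Kpow)
    from ev C(2) obtain x where "x \<in> C" "v = coord x" by auto
    then show ?thesis using k coord_mult_Kpow[of x e] cl by (intro im[OF D(6)[of x "Kpow e"]]) auto
  qed
  show "(\<lambda>(a, b, d). (p ^ a / p ^ b) ^ n * v (a, b, d)) \<in> S"
    if "single (0, 0, int n) \<in> S" "single (0, 0, - int n) \<in> S" "v \<in> S" for n v
  proof -
    \<comment> \<open>This is K^n v K^-n: the right factor undoes the shift in d caused by the left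
      one, so only the eigenvalues of conjugation remain.\<close>
    have "rep (Kpow (int n)) (Rshift (- int n) v) \<in> S"
      by (rule mult) (use that R in \<open>auto simp: coord_Kpow\<close>)
    then show ?thesis by (simp add: rep_Kpow Rshift_def)
  qed
qed

context
  fixes S assumes S: "coord_subalgebra S"
begin

lemmas S_add = coord_subalgebraD(1)[OF S]
lemmas S_scale = coord_subalgebraD(2)[OF S]
lemmas S_one = coord_subalgebraD(3)[OF S]
lemmas S_degree1_op = coord_subalgebraD(5)[OF S]

lemma S_zero: "(\<lambda>i. 0) \<in> S"
  using S_scale[OF S_one, of 0] by simp

lemma S_diff: "v \<in> S \<Longrightarrow> w \<in> S \<Longrightarrow> (\<lambda>i. v i - w i) \<in> S"
  using S_add[of v "\<lambda>i. -1 * w i"] S_scale[of w "-1"] by simp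

lemma S_scaled: "(\<lambda>i. c * v i) \<in> S \<Longrightarrow> c \<noteq> 0 \<Longrightarrow> v \<in> S"
  using S_scale[of "\<lambda>i. c * v i" "1 / c"] by simp

lemma S_sum:
  assumes "finite I" "\<And>j. j \<in> I \<Longrightarrow> f j \<in> S"
  shows "(\<lambda>i. \<Sum>j\<in>I. f j i) \<in> S"
  using assms by (induction rule: finite_induct) (auto intro: S_zero S_add)

lemma S_finite_support:
  assumes "finite {i. v i \<noteq> 0}" "\<And>i. v i \<noteq> 0 \<Longrightarrow> single i \<in> S"
  shows "v \<in> S"
proof -
  have "(\<lambda>i. \<Sum>j\<in>{i. v i \<noteq> 0}. v j * single j i) \<in> S"
    by (rule S_sum) (use assms S_scale in auto)
  moreover have "(\<lambda>i. \<Sum>j\<in>{i. v i \<noteq> 0}. v j * single j i) = v"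
    using assms(1) by (auto simp: single_def if_distrib[of "\<lambda>x. _ * x"] fun_eq_iff sum.delta cong: if_cong)
  ultimately show ?thesis by simp
qed

lemma S_Kpow_add: "single (0, 0, d) \<in> S \<Longrightarrow> single (0, 0, e) \<in> S \<Longrightarrow> single (0, 0, d + e) \<in> S"
proof -
  assume "single (0, 0, d) \<in> S" "single (0, 0, e) \<in> S"
  then have "Rshift d (single (0, 0, e)) \<in> S" using coord_subalgebraD(6)[OF S] by blast
  moreover have "Rshift d (single (0, 0, e)) = single (0, 0, d + e)"
    by (auto simp: Rshift_def single_eq fun_eq_iff)
  ultimately show ?thesis by simp
qed

lemma S_Kpow_mult:
  assumes "single (0, 0, e) \<in> S" "single (0, 0, - e) \<in> S"
  shows "single (0, 0, e * k) \<in> S"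
proof (induction k rule: int_induct[of _ 0])
  case base
  show ?case using S_one by simp
next
  case (step1 k)
  then show ?case using S_Kpow_add[OF assms(1), of "e * k"] by (simp add: algebra_simps)
next
  case (step2 k)
  then show ?case using S_Kpow_add[OF assms(2), of "e * k"] by (simp add: algebra_simps)
qed

lemma S_single_X:
  assumes "degree1 1 0 0 \<in> S" "single (0, b, d) \<in> S"
  shows "single (a, b, d) \<in> S"
proof (induction a)
  case (Suc a)
  have "degree1_op 1 0 0 (single (a, b, d)) = single (Suc a, b, d)" by (simp add: degree1_op_def ops_single)
  then show ?case using S_degree1_op[OF assms(1) Suc] by simp
qed (rule assms(2))

lemma S_single_Y:
  assumes "degree1 0 1 0 \<in> S" "single (0, 0, d) \<in> S"
  shows "single (0, b, d) \<in> S"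
proof (induction b)
  case (Suc b)
  have "degree1_op 0 1 0 (single (0, b, d)) = single (0, Suc b, d)" by (simp add: degree1_op_def ops_single)
  then show ?case using S_degree1_op[OF assms(1) Suc] by simp
qed (rule assms(2))

lemma S_power: "degree1 x y z \<in> S \<Longrightarrow> v \<in> S \<Longrightarrow> (degree1_op x y z ^^ n) v \<in> S"
  by (induction n) (auto intro: S_degree1_op)

text \<open>Lagrange interpolation separates the eigenspaces of the diagonal operator \<open>f\<close>.\<close>

lemma S_eigenspace:
  assumes f: "\<And>v. v \<in> S \<Longrightarrow> (\<lambda>i. f i * v i) \<in> S" and v: "v \<in> S"
  shows "(\<lambda>i. if f i = \<mu> then v i else 0) \<in> S"
proof -
  have prod: "(\<lambda>i. (\<Prod>\<nu>\<in>N. f i - \<nu>) * v i) \<in> S" if "finite N" for N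
    using that
  proof (induction rule: finite_induct)
    case empty
    then show ?case using v by simp
  next
    case (insert \<nu> N)
    have "(\<lambda>i. f i * ((\<Prod>\<nu>\<in>N. f i - \<nu>) * v i) - \<nu> * ((\<Prod>\<nu>\<in>N. f i - \<nu>) * v i)) \<in> S"
      by (rule S_diff[OF f[OF insert.IH] S_scale[OF insert.IH]])
    then show ?case using insert by (simp add: algebra_simps)
  qed
  define N where "N = f ` {i. v i \<noteq> 0} - {\<mu>}"
  have N: "finite N" using coord_subalgebraD(4)[OF S v] by (simp add: N_def)
  have c: "(\<Prod>\<nu>\<in>N. \<mu> - \<nu>) \<noteq> 0" using N by (auto simp: N_def)
  have eq: "(\<lambda>i. (\<Prod>\<nu>\<in>N. f i - \<nu>) * v i) = (\<lambda>i. (\<Prod>\<nu>\<in>N. \<mu> - \<nu>) * (if f i = \<mu> then v i else 0))"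
  proof
    fix i
    show "(\<Prod>\<nu>\<in>N. f i - \<nu>) * v i = (\<Prod>\<nu>\<in>N. \<mu> - \<nu>) * (if f i = \<mu> then v i else 0)"
    proof (cases "f i = \<mu> \<or> v i = 0")
      case False
      then have "f i \<in> N" by (simp add: N_def)
      then have "(\<Prod>\<nu>\<in>N. f i - \<nu>) = 0" using N by (intro prod_zero) auto
      then show ?thesis using False by simp
    qed auto
  qed
  show ?thesis by (rule S_scaled[OF _ c]) (rule prod[OF N, unfolded eq])
qed

end

definition degree_below :: "nat \<Rightarrow> coords \<Rightarrow> bool" where
  "degree_below m v \<longleftrightarrow> (\<forall>a b d. m \<le> a + b \<longrightarrow> v (a, b, d) = 0)"

lemma degree_belowD: "degree_below m v \<Longrightarrow> m \<le> a + b \<Longrightarrow> v (a, b, d) = 0"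
  by (simp add: degree_below_def)

lemma degree_below_SucI:
  "degree_below (Suc m) v \<Longrightarrow> (\<And>a b d. a + b = m \<Longrightarrow> v (a, b, d) = 0) \<Longrightarrow> degree_below m v"
  unfolding degree_below_def
  by (metis Suc_leI le_neq_implies_less)

lemma degree_below_0: "degree_below 0 v \<Longrightarrow> v = (\<lambda>i. 0)"
  by (auto simp: degree_below_def fun_eq_iff)

lemma degree_below_exists:
  assumes "finite {i. v i \<noteq> (0::complex)}"
  obtains m where "degree_below m v"
proof -
  let ?M = "Max ((\<lambda>(a, b, d). a + b) ` {i. v i \<noteq> 0})"
  have "a + b \<le> ?M" if "v (a, b, d) \<noteq> 0" for a b d
    by (rule Max_ge[OF finite_imageI[OF assms]]) (rule image_eqI[of _ _ "(a, b, d)"], use that in auto)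
  then have "degree_below (Suc ?M) v" unfolding degree_below_def by (metis not_less_eq_eq)
  then show thesis by (rule that)
qed

lemma degree_below_combine:
  "degree_below m v \<Longrightarrow> degree_below m w \<Longrightarrow> degree_below m (\<lambda>i. v i - c * w i)"
  by (simp add: degree_below_def)

text \<open>K^-1 and the \<open>\<kappa>\<close> terms of \<open>Yop\<close> do not raise the
  degree, so the new top part only sees multiplication by X and by Y, the latter with p^-a from
  moving past X^a.\<close>

lemma degree1_op_top:
  assumes "degree_below (Suc m) v"
  shows "degree_below (Suc (Suc m)) (degree1_op x y z v)"
    "a + b = Suc m \<Longrightarrow> degree1_op x y z v (a, b, d) =
      x * (if a = 0 then 0 else v (a - 1, b, d)) + y * (if b = 0 then 0 else v (a, b - 1, d) / p ^ a)"
  using assms by (auto simp: degree_below_def degree1_op_def ops_def)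

lemma degree_below_one: "degree_below (Suc 0) (single (0, 0, 0))"
  by (auto simp: degree_below_def single_def)

end

section \<open>The grading and the skew derivations on a coideal subalgebra\<close>

section \<open>Coideal subalgebras in coordinates\<close>

text \<open>Closure under the three families of operators found in \<open>dcoord_eq\<close>; from
  here on no tensor product appears.\<close>

locale coideal_coords = quantum_sl2 +
  fixes S :: "coords set"
  assumes S: "coord_subalgebra S"
    and S_degree: "v \<in> S \<Longrightarrow> (\<lambda>(a, b, d). if e = d - int a - int b then v (a, b, d) else 0) \<in> S"
    and S_DX_degree: "v \<in> S \<Longrightarrow>
      (\<lambda>(a, b, d). if e = d - int a - int b then qnum (1 / p) (Suc a) * v (Suc a, b, d) else 0) \<in> S"
    and S_DY_degree: "v \<in> S \<Longrightarrow>
      (\<lambda>(a, b, d). if e = d - int a - int b then p ^ a * qnum p (Suc b) * v (a, Suc b, d) else 0) \<in> S"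
begin

text \<open>Finite support leaves finitely many nonzero graded components, and \<open>w\<close> is
  their sum. This removes the projection from the operators in the assumptions on S.\<close>

lemma S_from_degrees:
  assumes fin: "finite {i. w i \<noteq> 0}"
    and w: "\<And>e. (\<lambda>(a, b, d). if e = d - int a - int b then w (a, b, d) else 0) \<in> S"
  shows "w \<in> S"
proof -
  let ?I = "(\<lambda>(a, b, d). d - int a - int b) ` {i. w i \<noteq> 0}"
  let ?f = "\<lambda>e (a, b, d). if e = d - int a - int b then w (a, b, d) else 0"
  have fin': "finite ?I" using fin by simp
  have "(\<lambda>i. \<Sum>e\<in>?I. ?f e i) \<in> S" by (rule S_sum[OF S fin']) (rule w)
  moreover have "(\<lambda>i. \<Sum>e\<in>?I. ?f e i) = w"
  proof
    fix i :: "nat \<times> nat \<times> int"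
    obtain a b d where i: "i = (a, b, d)" by (cases i)
    show "(\<Sum>e\<in>?I. ?f e i) = w i"
    proof (cases "w i = 0")
      case False
      then have "d - int a - int b \<in> ?I" by (intro image_eqI[of _ _ i]) (auto simp: i)
      then show ?thesis using fin' by (simp add: i)
    qed (simp add: i sum.neutral)
  qed
  ultimately show ?thesis by simp
qed

lemma S_DX:
  assumes v: "v \<in> S"
  shows "(\<lambda>(a, b, d). qnum (1 / p) (Suc a) * v (Suc a, b, d)) \<in> S"
proof (rule S_from_degrees)
  have "{i. (case i of (a, b, d) \<Rightarrow> qnum (1 / p) (Suc a) * v (Suc a, b, d)) \<noteq> 0} \<subseteq>
      (\<lambda>(a, b, d). (a - 1, b, d)) ` {i. v i \<noteq> 0}"
    by (auto intro!: image_eqI[of _ _ "(Suc _, _, _)"])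
  then show "finite {i. (case i of (a, b, d) \<Rightarrow> qnum (1 / p) (Suc a) * v (Suc a, b, d)) \<noteq> 0}"
    using coord_subalgebraD(4)[OF S v] by (meson finite_imageI finite_subset)
qed (simp only: prod.case S_DX_degree[OF v])

lemma S_DY:
  assumes v: "v \<in> S"
  shows "(\<lambda>(a, b, d). p ^ a * qnum p (Suc b) * v (a, Suc b, d)) \<in> S"
proof (rule S_from_degrees)
  have "{i. (case i of (a, b, d) \<Rightarrow> p ^ a * qnum p (Suc b) * v (a, Suc b, d)) \<noteq> 0} \<subseteq>
      (\<lambda>(a, b, d). (a, b - 1, d)) ` {i. v i \<noteq> 0}"
    by (auto intro!: image_eqI[of _ _ "(_, Suc _, _)"])
  then show "finite {i. (case i of (a, b, d) \<Rightarrow> p ^ a * qnum p (Suc b) * v (a, Suc b, d)) \<noteq> 0}"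
    using coord_subalgebraD(4)[OF S v] by (meson finite_imageI finite_subset)
qed (simp only: prod.case S_DY_degree[OF v])

text \<open>Iterating the derivations shifts indices and multiplies by products of q-integers and
  powers of p. Of these factors only their nonvanishing is kept, since the later arguments are about
  supports.\<close>

lemma S_derivatives:
  assumes v: "v \<in> S"
  obtains c where "\<And>a b. c a b \<noteq> 0" "(\<lambda>(a, b, d). c a b * v (a + j, b + k, d)) \<in> S"
proof -
  have Y: "\<exists>c. (\<forall>a b. c a b \<noteq> 0) \<and> (\<lambda>(a, b, d). c a b * v (a, b + k, d)) \<in> S" for k
  proof (induction k)
    case 0
    show ?case using v by (intro exI[of _ "\<lambda>_ _. 1"]) simp
  next
    case (Suc k)
    then obtain c where c: "\<And>a b. c a b \<noteq> 0" "(\<lambda>(a, b, d). c a b * v (a, b + k, d)) \<in> S" by auto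
    let ?c = "\<lambda>a b. p ^ a * qnum p (Suc b) * c a (Suc b)"
    have "(\<lambda>(a, b, d). ?c a b * v (a, b + Suc k, d)) \<in> S"
      using S_DY[OF c(2)] by (simp add: mult.assoc)
    moreover have "?c a b \<noteq> 0" for a b using c(1) qnum_p_nonzero(1) by simp
    ultimately show ?case by (intro exI[of _ ?c]) blast
  qed
  have "\<exists>c. (\<forall>a b. c a b \<noteq> 0) \<and> (\<lambda>(a, b, d). c a b * v (a + j, b + k, d)) \<in> S"
  proof (induction j)
    case 0
    show ?case using Y[of k] by simp
  next
    case (Suc j)
    then obtain c where c: "\<And>a b. c a b \<noteq> 0" "(\<lambda>(a, b, d). c a b * v (a + j, b + k, d)) \<in> S" by auto
    let ?c = "\<lambda>a b. qnum (1 / p) (Suc a) * c (Suc a) b"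
    have "(\<lambda>(a, b, d). ?c a b * v (a + Suc j, b + k, d)) \<in> S"
      using S_DX[OF c(2)] by (simp add: mult.assoc)
    moreover have "?c a b \<noteq> 0" for a b using c(1) qnum_p_nonzero(2) by simp
    ultimately show ?case by (intro exI[of _ ?c]) blast
  qed
  then show thesis using that by blast
qed

text \<open>With a and b fixed, d - a - b determines d, so the grading isolates a single
  monomial.\<close>

lemma S_single_Kpow:
  assumes "v \<in> S" "\<And>a b d. v (a, b, d) \<noteq> 0 \<Longrightarrow> a = a0 \<and> b = b0" "v (a0, b0, d) \<noteq> 0"
  shows "single (a0, b0, d) \<in> S"
proof -
  let ?e = "d - int a0 - int b0"
  have "(\<lambda>(a, b, d). if ?e = d - int a - int b then v (a, b, d) else 0) = (\<lambda>i. v (a0, b0, d) * single (a0, b0, d) i)"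
    using assms(2) by (fastforce simp: single_eq fun_eq_iff)
  then show ?thesis using S_degree[OF assms(1), of ?e] S_scaled[OF S _ assms(3)] by simp
qed

text \<open>After a derivations in X and b in Y only powers of K survive: any other index would come
  from a coefficient above the top degree.\<close>

lemma top_single_Kpow:
  assumes v: "v \<in> S" "degree_below (Suc (a + b)) v" "v (a, b, d) \<noteq> 0"
  shows "single (0, 0, d) \<in> S"
proof -
  obtain c where c: "\<And>a b. c a b \<noteq> 0" "(\<lambda>(a', b', d). c a' b' * v (a' + a, b' + b, d)) \<in> S"
    using S_derivatives[OF v(1), of a b] by blast
  show ?thesis
  proof (rule S_single_Kpow[OF c(2)])
    show "a' = 0 \<and> b' = 0" if "(case (a', b', d') of (a', b', d) \<Rightarrow> c a' b' * v (a' + a, b' + b, d)) \<noteq> 0" for a' b' d'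
    proof (rule ccontr)
      assume "\<not> (a' = 0 \<and> b' = 0)"
      then have "v (a' + a, b' + b, d') = 0" by (intro degree_belowD[OF v(2)]) auto
      then show False using that by simp
    qed
  qed (use c(1) v(3) in simp)
qed

section \<open>Trivial Cartan part: the space of degree-one symbols\<close>

subsection \<open>Trivial intersection with the Cartan part\<close>

text \<open>The leading part x X + y Y of an element of S with d - a - b = -1. The only lower
  monomial with this value is K^-1, whose coefficient is left free.\<close>

definition symbol :: "complex \<Rightarrow> complex \<Rightarrow> bool" where
  "symbol x y \<longleftrightarrow> (\<exists>z. degree1 x y z \<in> S)"

lemma symbol_combine: "symbol x y \<Longrightarrow> symbol x' y' \<Longrightarrow> symbol (x + c * x') (y + c * y')"
proof -
  assume "symbol x y" "symbol x' y'"
  then obtain z z' where z: "degree1 x y z \<in> S" "degree1 x' y' z' \<in> S" by (auto simp: symbol_def)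
  have "(\<lambda>i. degree1 x y z i + c * degree1 x' y' z' i) \<in> S" by (intro S_add[OF S] S_scale[OF S] z)
  moreover have "(\<lambda>i. degree1 x y z i + c * degree1 x' y' z' i) = degree1 (x + c * x') (y + c * y') (z + c * z')"
    by (simp add: degree1_def fun_eq_iff algebra_simps)
  ultimately show ?thesis by (auto simp: symbol_def)
qed

lemma symbol_zero: "symbol 0 0"
  unfolding symbol_def using S_zero[OF S] by (intro exI[of _ 0]) (simp add: degree1_def)

lemma symbol_scale: "symbol x y \<Longrightarrow> symbol (c * x) (c * y)"
  using symbol_combine[OF symbol_zero, of x y c] by simp

end

locale coideal_coords_trivial = coideal_coords +
  assumes trivial: "single (0, 0, d) \<in> S \<Longrightarrow> d = 0"
begin

lemma top_trivial: "v \<in> S \<Longrightarrow> degree_below (Suc m) v \<Longrightarrow> a + b = m \<Longrightarrow> d \<noteq> 0 \<Longrightarrow> v (a, b, d) = 0"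
  using top_single_Kpow trivial by blast

text \<open>The derivations bring \<open>v\<close> down to degree at most one, and the component d -
  a - b = -1 of the result lies in the span of X, Y and K^-1. The factors \<open>x\<close> and
  \<open>y\<close> come from the derivations; that they do not vanish is all that matters.\<close>

lemma top_symbol:
  assumes v: "v \<in> S" "degree_below (Suc (Suc (j + k))) v"
  obtains x y where "x \<noteq> 0" "y \<noteq> 0" "symbol (x * v (Suc j, k, 0)) (y * v (j, Suc k, 0))"
proof -
  obtain c where c: "\<And>a b. c a b \<noteq> 0" "(\<lambda>(a, b, d). c a b * v (a + j, b + k, d)) \<in> S" (is "?w \<in> S")
    using S_derivatives[OF v(1), of j k] by blast
  have "degree_below (Suc 1) ?w" using v(2) by (auto simp: degree_below_def)
  then have top: "?w (a, b, d) = 0" if "a + b = 1" "d \<noteq> 0" for a b d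
    by (rule top_trivial[OF c(2) _ that])
  have zero: "v (a, b, d) = 0" if "Suc (Suc (j + k)) \<le> a + b" for a b d
    by (rule degree_belowD[OF v(2) that])
  have "(\<lambda>(a, b, d). if -1 = d - int a - int b then ?w (a, b, d) else 0) =
    degree1 (?w (1, 0, 0)) (?w (0, 1, 0)) (?w (0, 0, -1))"
  proof
    fix i :: "nat \<times> nat \<times> int"
    obtain a b d where i: "i = (a, b, d)" by (cases i)
    consider "a = 0" "b = 0" | "a = 1" "b = 0" | "a = 0" "b = 1" | "a + b \<ge> 2" by linarith
    then show "(\<lambda>(a, b, d). if -1 = d - int a - int b then ?w (a, b, d) else 0) i =
      degree1 (?w (1, 0, 0)) (?w (0, 1, 0)) (?w (0, 0, -1)) i"
    proof cases
      case 4
      then show ?thesis using zero[of "a + j" "b + k" d] by (auto simp: i degree1_def single_def)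
    qed (auto simp: i degree1_def single_def)
  qed
  then have "degree1 (?w (1, 0, 0)) (?w (0, 1, 0)) (?w (0, 0, -1)) \<in> S" using S_degree[OF c(2), of "-1"] by simp
  then have "symbol (c 1 0 * v (Suc j, k, 0)) (c 0 1 * v (j, Suc k, 0))" unfolding symbol_def by auto
  then show thesis using that c(1) by blast
qed

text \<open>Descent on the degree: in positive degree a top coefficient with d = 0 would give a
  nonzero symbol, and one with d nonzero is excluded by \<open>top_trivial\<close>.\<close>

lemma symbol_trivial_imp:
  assumes "\<And>x y. symbol x y \<Longrightarrow> x = 0 \<and> y = 0" "v \<in> S"
  shows "degree_below 1 v"
proof -
  have "degree_below (Suc m) v \<Longrightarrow> degree_below 1 v" for m
  proof (induction m)
    case (Suc m)
    have "v (a, b, d) = 0" if ab: "a + b = Suc m" for a b d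
    proof (cases "d = 0")
      case True
      show ?thesis
      \<comment> \<open>For a = 0 the coefficient appears as the Y entry of a symbol, otherwise as
        the X entry.\<close>
      proof (cases a)
        case 0
        then obtain x y where xy: "x \<noteq> 0" "y \<noteq> 0" "symbol (x * v (Suc 0, m, 0)) (y * v (0, Suc m, 0))"
          using top_symbol[OF assms(2), of 0 m] Suc.prems by auto
        show ?thesis using assms(1)[OF xy(3)] xy(2) True ab 0 by simp
      next
        case (Suc j)
        then obtain x y where xy: "x \<noteq> 0" "y \<noteq> 0" "symbol (x * v (Suc j, b, 0)) (y * v (j, Suc b, 0))"
          using top_symbol[OF assms(2), of j b] Suc.prems ab by auto
        show ?thesis using assms(1)[OF xy(3)] xy(1) True ab Suc by simp
      qed
    next
      case False
      then show ?thesis using top_trivial[OF assms(2) Suc.prems ab] by blast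
    qed
    then show ?case using Suc degree_below_SucI by blast
  qed simp
  moreover obtain m where "degree_below m v"
    using degree_below_exists coord_subalgebraD(4)[OF S assms(2)] by blast
  moreover have "degree_below (Suc m) v" if "degree_below m v" for m
    using that by (auto simp: degree_below_def)
  ultimately show ?thesis by blast
qed

lemma power_top:
  "degree_below (Suc m) ((degree1_op x y z ^^ m) (single (0, 0, 0)))"
  by (induction m) (auto simp: degree_below_one intro: degree1_op_top)

lemma power_top_X: "(degree1_op 1 y z ^^ m) (single (0, 0, 0)) (m, 0, 0) = 1"
proof (induction m)
  case (Suc m)
  then show ?case using degree1_op_top(2)[OF power_top[of m 1 y z], of "Suc m" 0 1 y z 0] by simp
qed (simp add: single_def)

lemma power_top_Y: "(degree1_op 0 1 z ^^ m) (single (0, 0, 0)) (0, m, 0) = 1"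
proof (induction m)
  case (Suc m)
  then show ?case using degree1_op_top(2)[OF power_top[of m 0 1 z], of 0 "Suc m" 0 1 z 0] by simp
qed (simp add: single_def)

lemma power_Y_support:
  "a > 0 \<Longrightarrow> (degree1_op 0 1 z ^^ m) (single (0, 0, 0)) (a, b, d) = 0"
  by (induction m arbitrary: a b d) (auto simp: single_def degree1_op_def ops_def)

text \<open>Here and in \<open>line_Y\<close> the symbols of degree one span a line, so the derivations determine the
  top-degree part of an element by a single coefficient.\<close>

lemma line_X:
  assumes B: "degree1 1 y z \<in> S" and symbol: "\<And>y. symbol 0 y \<Longrightarrow> y = 0"
    and G: "coord_subalgebra G" "degree1 1 y z \<in> G"
  shows "S \<subseteq> G"
proof -
  have "degree_below m v \<Longrightarrow> v \<in> S \<Longrightarrow> v \<in> G" for m v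
  proof (induction m arbitrary: v)
    case 0
    then show ?case using degree_below_0 S_zero[OF G(1)] by auto
  next
    case (Suc m)
    let ?B = "(degree1_op 1 y z ^^ m) (single (0, 0, 0))"
    let ?v = "\<lambda>i. v i - v (m, 0, 0) * ?B i"
    have BS: "?B \<in> S" "?B \<in> G" using S_power[OF S B S_one[OF S]] S_power[OF G S_one[OF G(1)]] .
    have vS: "?v \<in> S" by (rule S_diff[OF S Suc.prems(2) S_scale[OF S BS(1)]])
    have below: "degree_below (Suc m) ?v" by (rule degree_below_combine[OF Suc.prems(1) power_top])
    \<comment> \<open>Induction on b along the top degree: the subtraction removes the coefficient
      at X^m, and a symbol with X entry zero has Y entry zero.\<close>
    have zero: "?v (a, b, 0) = 0" if "a + b = m" for a b
      using that
    proof (induction b arbitrary: a)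
      case 0
      then show ?case by (simp add: power_top_X)
    next
      case (Suc b)
      have b: "degree_below (Suc (Suc (a + b))) ?v" using below Suc.prems by simp
      obtain x y where "x \<noteq> 0" "y \<noteq> 0" "symbol (x * ?v (Suc a, b, 0)) (y * ?v (a, Suc b, 0))"
        by (rule top_symbol[OF vS b])
      moreover have "?v (Suc a, b, 0) = 0" using Suc.IH[of "Suc a"] Suc.prems by simp
      ultimately show ?case using symbol[of "y * ?v (a, Suc b, 0)"] by simp
    qed
    have "degree_below m ?v"
    proof (rule degree_below_SucI[OF below])
      fix a b d assume ab: "a + b = m"
      show "?v (a, b, d) = 0"
        using zero[OF ab] top_trivial[OF vS below ab] by (cases "d = 0") auto
    qed
    then have "?v \<in> G" using Suc.IH vS by blast
    then have "(\<lambda>i. ?v i + v (m, 0, 0) * ?B i) \<in> G" by (rule S_add[OF G(1) _ S_scale[OF G(1) BS(2)]])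
    then show ?case by simp
  qed
  then show ?thesis using degree_below_exists coord_subalgebraD(4)[OF S] by blast
qed

lemma line_Y:
  assumes B: "degree1 0 1 z \<in> S" and symbol: "\<And>x y. symbol x y \<Longrightarrow> x = 0"
    and v: "v \<in> S" "a > 0"
  shows "v (a, b, d) = 0"
proof -
  have "degree_below m v \<Longrightarrow> v \<in> S \<Longrightarrow> \<forall>a b d. a > 0 \<longrightarrow> v (a, b, d) = 0" for m v
  proof (induction m arbitrary: v)
    case 0
    then show ?case using degree_below_0 by auto
  next
    case (Suc m)
    let ?B = "(degree1_op 0 1 z ^^ m) (single (0, 0, 0))"
    let ?v = "\<lambda>i. v i - v (0, m, 0) * ?B i"
    have BS: "?B \<in> S" by (rule S_power[OF S B S_one[OF S]])
    have vS: "?v \<in> S" by (rule S_diff[OF S Suc.prems(2) S_scale[OF S BS]])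
    have below: "degree_below (Suc m) ?v" by (rule degree_below_combine[OF Suc.prems(1) power_top])
    \<comment> \<open>Every symbol has X entry zero, so the coefficients with positive a vanish
      directly; the one at Y^m is removed by the subtraction.\<close>
    have zero: "?v (a, b, 0) = 0" if "a + b = m" for a b
    proof (cases a)
      case 0
      then show ?thesis using that by (simp add: power_top_Y)
    next
      case (Suc j)
      have b: "degree_below (Suc (Suc (j + b))) ?v" using below Suc that by auto
      obtain x y where "x \<noteq> 0" "y \<noteq> 0" "symbol (x * ?v (Suc j, b, 0)) (y * ?v (j, Suc b, 0))"
        by (rule top_symbol[OF vS b])
      then show ?thesis using symbol Suc by (metis mult_eq_0_iff)
    qed
    have "degree_below m ?v"
    proof (rule degree_below_SucI[OF below])
      fix a b d assume ab: "a + b = m"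
      show "?v (a, b, d) = 0"
        using zero[OF ab] top_trivial[OF vS below ab] by (cases "d = 0") auto
    qed
    then have "?v (a, b, d) = 0" if "a > 0" for a b d using Suc.IH vS that by blast
    then show ?case using power_Y_support by simp
  qed
  then show ?thesis using degree_below_exists coord_subalgebraD(4)[OF S] v by metis
qed

text \<open>In the q-commutator (X + l K^-1)(Y + l' K^-1) - p (Y + l' K^-1)(X + l K^-1) the factor p
  cancels XY and all mixed terms with K^-1. What remains is a combination of 1 and K^-2, and the
  coefficient l l' (1 - p) - p \<open>\<kappa>\<close> of K^-2 must vanish because K^-2 is not in
  S.\<close>

lemma plane_relation:
  assumes B: "degree1 1 0 l \<in> S" "degree1 0 1 l' \<in> S"
  shows "l * l' = q\<^sup>2 / ((1 - q\<^sup>2) * (q - inverse q))"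
proof -
  let ?w = "\<lambda>i. degree1_op 1 0 l (degree1 0 1 l') i - p * degree1_op 0 1 l' (degree1 1 0 l) i"
  have wS: "?w \<in> S"
    by (intro S_diff[OF S] S_scale[OF S] S_degree1_op[OF S] B)
  have w: "?w = (\<lambda>i. p * \<kappa> * single (0, 0, 0) i + (l * l' * (1 - p) - p * \<kappa>) * single (0, 0, -2) i)"
  proof
    fix i :: "nat \<times> nat \<times> int"
    obtain a b d where i: "i = (a, b, d)" by (cases i)
    show "?w i = p * \<kappa> * single (0, 0, 0) i + (l * l' * (1 - p) - p * \<kappa>) * single (0, 0, -2) i"
      by (auto simp: i degree1_op_def ops_def degree1_def single_eq qnum_Suc algebra_simps)
  qed
  have "l * l' * (1 - p) = p * \<kappa>"
  proof (rule ccontr)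
    assume "l * l' * (1 - p) \<noteq> p * \<kappa>"
    then have "single (0, 0, -2) \<in> S"
      by (intro S_single_Kpow[OF wS[unfolded w]]) (auto simp: single_eq split: if_splits)
    then show False using trivial by fastforce
  qed
  moreover have "1 - p \<noteq> 0" using p_pow_neq_1[of 1] by simp
  ultimately have "l * l' = p * \<kappa> / (1 - p)" by (metis nonzero_eq_divide_eq)
  then show ?thesis by (simp add: p_def \<kappa>_def)
qed

text \<open>The ordered products of powers of the two generators have X^a Y^b as top part at d = 0,
  so the top part of any element of S can be removed by subtracting elements of G.\<close>

lemma plane_generates:
  assumes B: "degree1 1 0 l \<in> S" "degree1 0 1 l' \<in> S"
    and G: "coord_subalgebra G" "degree1 1 0 l \<in> G" "degree1 0 1 l' \<in> G"
  shows "S \<subseteq> G"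
proof -
  let ?N = "\<lambda>a b. (degree1_op 1 0 l ^^ a) ((degree1_op 0 1 l' ^^ b) (single (0, 0, 0)))"
  have N_below: "degree_below (Suc (a + b)) (?N a b)" for a b
    by (induction a) (auto intro: degree1_op_top power_top)
  have N0: "(degree1_op 0 1 l' ^^ b) (single (0, 0, 0)) (a', b', 0) = (if a' = 0 \<and> b' = b then 1 else 0)"
    if "a' + b' = b" for a' b' b
    using that
  proof (induction b arbitrary: a' b')
    case (Suc b)
    then show ?case using degree1_op_top(2)[OF power_top[of b 0 1 l'], of a' b' 0 1 l' 0] power_Y_support
      by (cases b') auto
  qed (auto simp: single_def)
  have N: "?N a b (a', b', 0) = (if a' = a \<and> b' = b then 1 else 0)" if "a' + b' = a + b" for a b a' b'
    using that
  proof (induction a arbitrary: a' b')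
    case 0
    then show ?case using N0[of a' b' b] by simp
  next
    case (Suc a)
    then show ?case using degree1_op_top(2)[OF N_below[of a b], of a' b' 1 0 l 0]
      by (cases a') auto
  qed
  have "degree_below m v \<Longrightarrow> v \<in> S \<Longrightarrow> v \<in> G" for m v
  proof (induction m arbitrary: v)
    case 0
    then show ?case using degree_below_0 S_zero[OF G(1)] by auto
  next
    case (Suc m)
    let ?t = "\<lambda>i. \<Sum>b\<le>m. v (m - b, b, 0) * ?N (m - b) b i"
    \<comment> \<open>The factor 1 matches the form of \<open>degree_below_combine\<close>.\<close>
    let ?v = "\<lambda>i. v i - 1 * ?t i"
    have NS: "?N a b \<in> S" "?N a b \<in> G" for a b
      by (intro S_power[OF S] S_power[OF G(1)] B G S_one[OF S] S_one[OF G(1)])+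
    have tS: "?t \<in> S" "?t \<in> G"
      by (rule S_sum[OF S] S_sum[OF G(1)], simp, rule S_scale[OF S NS(1)] S_scale[OF G(1) NS(2)])+
    have vS: "?v \<in> S" using S_diff[OF S Suc.prems(2) tS(1)] by simp
    have "degree_below (Suc m) ?t"
      unfolding degree_below_def
    proof (intro allI impI sum.neutral ballI)
      fix a b d b' assume "Suc m \<le> a + b" "b' \<in> {..m}"
      then have "?N (m - b') b' (a, b, d) = 0"
        using degree_belowD[OF N_below[of "m - b'" b']] by simp
      then show "v (m - b', b', 0) * ?N (m - b') b' (a, b, d) = 0" by simp
    qed
    then have below: "degree_below (Suc m) ?v" by (rule degree_below_combine[OF Suc.prems(1)])
    have zero: "?v (a, b, 0) = 0" if ab: "a + b = m" for a b
    proof -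
      have "?t (a, b, 0) = (\<Sum>b'\<le>m. if b' = b then v (a, b, 0) else 0)"
        by (rule sum.cong) (use ab in \<open>auto simp: N\<close>)
      also have "\<dots> = v (a, b, 0)" using ab by simp
      finally show ?thesis by simp
    qed
    have "degree_below m ?v"
    proof (rule degree_below_SucI[OF below])
      fix a b d assume ab: "a + b = m"
      show "?v (a, b, d) = 0"
        using zero[OF ab] top_trivial[OF vS below ab] by (cases "d = 0") auto
    qed
    then have "?v \<in> G" using Suc.IH vS by blast
    then have "(\<lambda>i. ?v i + ?t i) \<in> G" by (rule S_add[OF G(1) _ tS(2)])
    then show ?case by simp
  qed
  then show ?thesis using degree_below_exists coord_subalgebraD(4)[OF S] by blast
qed

text \<open>The four cases are the kinds of subspaces of the plane of symbols: zero, a line other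
  than x = 0, the line x = 0, and the whole plane. The first and the third put S on one side of the
  triangular decomposition.\<close>

theorem trivial_classification:
  "(\<forall>v\<in>S. \<forall>a b d. v (a, b, d) \<noteq> 0 \<longrightarrow> b = 0) \<or>
   (\<forall>v\<in>S. \<forall>a b d. v (a, b, d) \<noteq> 0 \<longrightarrow> a = 0) \<or>
   (\<exists>l l'. degree1 1 l l' \<in> S \<and> (\<forall>G. coord_subalgebra G \<and> degree1 1 l l' \<in> G \<longrightarrow> S \<subseteq> G)) \<or>
   (\<exists>l l'. l * l' = q\<^sup>2 / ((1 - q\<^sup>2) * (q - inverse q)) \<and> degree1 1 0 l \<in> S \<and> degree1 0 1 l' \<in> S \<and>
     (\<forall>G. coord_subalgebra G \<and> degree1 1 0 l \<in> G \<and> degree1 0 1 l' \<in> G \<longrightarrow> S \<subseteq> G))"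
proof -
  consider (zero) "\<forall>x y. symbol x y \<longrightarrow> x = 0 \<and> y = 0"
    | (slope) "\<forall>y. symbol 0 y \<longrightarrow> y = 0" "\<exists>x y. symbol x y \<and> x \<noteq> 0"
    | (vertical) "\<forall>x y. symbol x y \<longrightarrow> x = 0" "\<exists>y. symbol 0 y \<and> y \<noteq> 0"
    | (plane) "\<exists>x y. symbol x y \<and> x \<noteq> 0" "\<exists>y. symbol 0 y \<and> y \<noteq> 0"
    by metis
  then show ?thesis
  proof cases
    case zero
    have "b = 0" if "v \<in> S" "v (a, b, d) \<noteq> 0" for v a b d
    proof (rule ccontr)
      assume "b \<noteq> 0"
      then have "v (a, b, d) = 0"
        by (intro degree_belowD[OF symbol_trivial_imp[OF _ that(1)]]) (use zero in auto)
      then show False using that by simp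
    qed
    then show ?thesis by blast
  next
    case slope
    then obtain x y where "symbol x y" "x \<noteq> 0" by blast
    then have "symbol 1 (y / x)" using symbol_scale[of x y "1 / x"] by simp
    then obtain z where z: "degree1 1 (y / x) z \<in> S" by (auto simp: symbol_def)
    have "S \<subseteq> G" if "coord_subalgebra G" "degree1 1 (y / x) z \<in> G" for G
      by (rule line_X[OF z _ that]) (use slope in blast)
    then show ?thesis using z by blast
  next
    case vertical
    then obtain y where "symbol 0 y" "y \<noteq> 0" by blast
    then have "symbol 0 1" using symbol_scale[of 0 y "1 / y"] by simp
    then obtain z where z: "degree1 0 1 z \<in> S" by (auto simp: symbol_def)
    have "a = 0" if "v \<in> S" "v (a, b, d) \<noteq> 0" for v a b d
      using line_Y[OF z _ that(1), of a b d] vertical(1) that(2) by blast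
    then show ?thesis by blast
  next
    case plane
    then obtain x y y' where xy: "symbol x y" "x \<noteq> 0" "symbol 0 y'" "y' \<noteq> 0" by blast
    then have Y: "symbol 0 1" using symbol_scale[of 0 y' "1 / y'"] by simp
    have "symbol 1 (y / x)" using xy symbol_scale[of x y "1 / x"] by simp
    \<comment> \<open>Symbols form a subspace, so a multiple of (0, 1) can be subtracted to obtain a
      generator without Y.\<close>
    then have "symbol 1 0" using symbol_combine[OF _ Y, of 1 "y / x" "- (y / x)"] by simp
    then obtain l l' where l: "degree1 1 0 l \<in> S" "degree1 0 1 l' \<in> S" using Y by (auto simp: symbol_def)
    then show ?thesis using plane_relation[OF l] plane_generates[OF l] by blast
  qed
qed

end

section \<open>Nontrivial Cartan part: weights and extraction of X and Y\<close>

subsection \<open>Nontrivial intersection with the Cartan part\<close>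

lemma (in quantum_sl2) p_pow_inject: "p ^ m = p ^ n \<Longrightarrow> m = n"
proof (induction m n rule: linorder_wlog)
  case (le m n)
  have "p ^ n = p ^ m * p ^ (n - m)" using le(1) by (simp flip: power_add)
  then have "p ^ m * p ^ (n - m) = p ^ m * 1" using le(2) by simp
  then have "p ^ (n - m) = 1" using p_nonzero by simp
  then show ?case using p_pow_neq_1[of "n - m"] le by (cases "n = m") auto
qed auto

locale coideal_coords_nontrivial = coideal_coords +
  assumes neg: "single (0, 0, d) \<in> S \<Longrightarrow> single (0, 0, - d) \<in> S"
    and nontrivial: "\<exists>d. d \<noteq> 0 \<and> single (0, 0, d) \<in> S"
begin

text \<open>Conjugation by K^n multiplies the coefficient at X^a Y^b K^d by p^(n (a - b)). As q is
  no root of unity, its eigenspaces are the weight spaces, and \<open>S_eigenspace\<close> projects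
  onto them.\<close>

lemma S_weight:
  assumes v: "v \<in> S"
  shows "(\<lambda>(a, b, d). if int a - int b = w then v (a, b, d) else 0) \<in> S"
proof -
  obtain d where d: "d \<noteq> 0" "single (0, 0, d) \<in> S" using nontrivial by blast
  \<comment> \<open>By \<open>neg\<close> the exponent may be taken positive.\<close>
  define n where "n = nat \<bar>d\<bar>"
  have n: "n > 0" "single (0, 0, int n) \<in> S" "single (0, 0, - int n) \<in> S"
    using d neg by (auto simp: n_def abs_if)
  let ?f = "\<lambda>(a, b, d::int). (p ^ a / p ^ b) ^ n"
  have f: "(\<lambda>i. ?f i * v i) \<in> S" if "v \<in> S" for v
  proof -
    have "(\<lambda>i. ?f i * v i) = (\<lambda>(a, b, d). (p ^ a / p ^ b) ^ n * v (a, b, d))" by auto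
    then show ?thesis using coord_subalgebraD(7)[OF S n(2,3) that] by simp
  qed
  show ?thesis
  proof (cases "\<exists>a0 b0. w = int a0 - int b0")
    case True
    then obtain a0 b0 where w: "w = int a0 - int b0" by blast
    have "(p ^ a / p ^ b) ^ n = (p ^ a0 / p ^ b0) ^ n \<longleftrightarrow> int a - int b = w" for a b
    proof
      assume "(p ^ a / p ^ b) ^ n = (p ^ a0 / p ^ b0) ^ n"
      then have "(p ^ a) ^ n * (p ^ b0) ^ n = (p ^ a0) ^ n * (p ^ b) ^ n"
        by (simp add: power_divide field_simps)
      then have "p ^ ((a + b0) * n) = p ^ ((a0 + b) * n)"
        by (simp add: power_mult power_add power_mult_distrib)
      then have "(a + b0) * n = (a0 + b) * n" by (rule p_pow_inject)
      then show "int a - int b = w" using n w by simp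
    next
      assume "int a - int b = w"
      then have "a + b0 = a0 + b" using w by linarith
      then have "p ^ a * p ^ b0 = p ^ a0 * p ^ b" by (simp flip: power_add)
      then have "p ^ a / p ^ b = p ^ a0 / p ^ b0" by (simp add: field_simps)
      then show "(p ^ a / p ^ b) ^ n = (p ^ a0 / p ^ b0) ^ n" by simp
    qed
    then have "(\<lambda>i. if ?f i = (p ^ a0 / p ^ b0) ^ n then v i else 0) =
      (\<lambda>(a, b, d). if int a - int b = w then v (a, b, d) else 0)" by (auto simp: fun_eq_iff)
    then show ?thesis using S_eigenspace[OF S f v, of "(p ^ a0 / p ^ b0) ^ n"] by simp
  next
    case False
    then have "(\<lambda>(a, b, d). if int a - int b = w then v (a, b, d) else 0) = (\<lambda>i. 0)"
      by (fastforce simp: fun_eq_iff)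
    then show ?thesis using S_zero[OF S] by simp
  qed
qed

text \<open>The derivations reduce the monomial to K^d, whose inverse lies in S by
  \<open>neg\<close>; right multiplication by K^-d then removes the power of K.\<close>

lemma S_cancel_Kpow:
  assumes "single (a, b, d) \<in> S"
  shows "single (a, b, 0) \<in> S"
proof -
  obtain c where c: "\<And>a b. c a b \<noteq> 0" "(\<lambda>(a', b', d'). c a' b' * single (a, b, d) (a' + a, b' + b, d')) \<in> S"
    using S_derivatives[OF assms, of a b] by blast
  have "single (0, 0, d) \<in> S"
    by (rule S_single_Kpow[OF c(2)]) (auto simp: c(1) single_eq split: if_splits)
  then have "Rshift (- d) (single (a, b, d)) \<in> S"
    using neg coord_subalgebraD(6)[OF S _ assms] by blast
  moreover have "Rshift (- d) (single (a, b, d)) = single (a, b, 0)"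
    by (auto simp: Rshift_def single_eq fun_eq_iff)
  ultimately show ?thesis by simp
qed

lemma Max_support:
  fixes g :: "nat \<times> nat \<times> int \<Rightarrow> nat"
  assumes "v \<in> S" "v i0 \<noteq> 0"
  obtains i where "v i \<noteq> 0" "\<And>j. v j \<noteq> 0 \<Longrightarrow> g j \<le> g i"
proof -
  let ?G = "g ` {i. v i \<noteq> 0}"
  have fin: "finite ?G" using coord_subalgebraD(4)[OF S assms(1)] by simp
  then have "Max ?G \<in> ?G" using assms(2) by (intro Max_in) blast+
  then obtain i where i: "v i \<noteq> 0" "g i = Max ?G" by auto
  have "g j \<le> g i" if "v j \<noteq> 0" for j unfolding i(2) by (rule Max_ge[OF fin]) (use that in simp)
  then show thesis using that i(1) by blast
qed

text \<open>In a weight component b determines a, so an index with maximal b is maximal in both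
  exponents. Differentiating a times in X and b - 1 times in Y leaves only monomials Y K^d, from
  which the grading picks one.\<close>

lemma S_contains_Y:
  assumes v: "v \<in> S" "v (a1, b1, d1) \<noteq> 0" "b1 > 0"
  shows "degree1 0 1 0 \<in> S"
proof -
  let ?v = "\<lambda>(a, b, d). if int a - int b = int a1 - int b1 then v (a, b, d) else 0"
  have vS: "?v \<in> S" by (rule S_weight[OF v(1)])
  have nz: "?v (a1, b1, d1) \<noteq> 0" using v(2) by simp
  obtain i where i: "?v i \<noteq> 0" "\<And>j. ?v j \<noteq> 0 \<Longrightarrow> fst (snd j) \<le> fst (snd i)"
    by (rule Max_support[OF vS nz, of "\<lambda>j. fst (snd j)"]) blast
  obtain a b d where abd: "i = (a, b, d)" by (cases i)
  have b: "b > 0" using i(2)[of "(a1, b1, d1)"] v abd by auto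
  have w: "int a - int b = int a1 - int b1" using i(1) abd by (auto split: if_splits)
  obtain c where c: "\<And>a b. c a b \<noteq> 0" "(\<lambda>(a', b', d'). c a' b' * ?v (a' + a, b' + (b - 1), d')) \<in> S" (is "?w \<in> S")
    using S_derivatives[OF vS, of a "b - 1"] by blast
  have "single (0, 1, d) \<in> S"
  proof (rule S_single_Kpow[OF c(2)])
    show "?w (0, 1, d) \<noteq> 0" using i(1) c(1) b abd by (simp split: if_splits)
    fix a' b' d' assume "?w (a', b', d') \<noteq> 0"
    then have nz': "?v (a' + a, b' + (b - 1), d') \<noteq> 0" by auto
    \<comment> \<open>The weight gives a' = b' - 1 and maximality gives b' at most 1; since a' is
      not negative, one index remains.\<close>
    then have "int (a' + a) - int (b' + (b - 1)) = int a1 - int b1" by (auto split: if_splits)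
    moreover have "b' + (b - 1) \<le> b" using i(2)[OF nz'] abd by simp
    ultimately show "a' = 0 \<and> b' = 1" using w b by linarith
  qed
  then have "single (0, 1, 0) \<in> S" by (rule S_cancel_Kpow)
  then show ?thesis by (simp add: degree1_def)
qed

text \<open>The mirror image of \<open>S_contains_Y\<close>, with a maximal in the weight component
  and one derivation in X left out.\<close>

lemma S_contains_X:
  assumes v: "v \<in> S" "v (a1, b1, d1) \<noteq> 0" "a1 > 0"
  shows "degree1 1 0 0 \<in> S"
proof -
  let ?v = "\<lambda>(a, b, d). if int a - int b = int a1 - int b1 then v (a, b, d) else 0"
  have vS: "?v \<in> S" by (rule S_weight[OF v(1)])
  have nz: "?v (a1, b1, d1) \<noteq> 0" using v(2) by simp
  obtain i where i: "?v i \<noteq> 0" "\<And>j. ?v j \<noteq> 0 \<Longrightarrow> fst j \<le> fst i"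
    by (rule Max_support[OF vS nz, of fst]) blast
  obtain a b d where abd: "i = (a, b, d)" by (cases i)
  have a: "a > 0" using i(2)[of "(a1, b1, d1)"] v abd by auto
  have w: "int a - int b = int a1 - int b1" using i(1) abd by (auto split: if_splits)
  obtain c where c: "\<And>a b. c a b \<noteq> 0" "(\<lambda>(a', b', d'). c a' b' * ?v (a' + (a - 1), b' + b, d')) \<in> S" (is "?w \<in> S")
    using S_derivatives[OF vS, of "a - 1" b] by blast
  have "single (1, 0, d) \<in> S"
  proof (rule S_single_Kpow[OF c(2)])
    show "?w (1, 0, d) \<noteq> 0" using i(1) c(1) a abd by (simp split: if_splits)
    fix a' b' d' assume "?w (a', b', d') \<noteq> 0"
    then have nz': "?v (a' + (a - 1), b' + b, d') \<noteq> 0" by auto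
    then have "int (a' + (a - 1)) - int (b' + b) = int a1 - int b1" by (auto split: if_splits)
    moreover have "a' + (a - 1) \<le> a" using i(2)[OF nz'] abd by simp
    ultimately show "a' = 1 \<and> b' = 0" using w a by linarith
  qed
  then have "single (1, 0, 0) \<in> S" by (rule S_cancel_Kpow)
  then show ?thesis by (simp add: degree1_def)
qed

text \<open>Y X - p^-1 X Y = - \<open>\<kappa>\<close> + \<open>\<kappa>\<close> K^-2, and the
  grading separates K^-2 from 1.\<close>

lemma S_contains_K2:
  assumes X: "degree1 1 0 0 \<in> S" and Y: "degree1 0 1 0 \<in> S"
  shows "single (0, 0, 2) \<in> S" "single (0, 0, -2) \<in> S"
proof -
  let ?w = "\<lambda>i. degree1_op 0 1 0 (degree1 1 0 0) i - (1 / p) * degree1_op 1 0 0 (degree1 0 1 0) i"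
  have wS: "?w \<in> S"
    by (intro S_diff[OF S] S_scale[OF S] S_degree1_op[OF S] X Y)
  have w: "?w = (\<lambda>i. (- \<kappa>) * single (0, 0, 0) i + \<kappa> * single (0, 0, -2) i)"
    by (auto simp: fun_eq_iff degree1_op_def ops_def degree1_def single_eq qnum_Suc algebra_simps)
  show K: "single (0, 0, -2) \<in> S"
    by (rule S_single_Kpow[OF wS[unfolded w]]) (auto simp: single_eq split: if_splits)
  show "single (0, 0, 2) \<in> S" using neg[OF K] by simp
qed

text \<open>A top term X^a Y^b K^d puts K^d into S, so d is even. All monomials with even d lie in S
  and in G alike, so the whole top part can be subtracted without leaving either.\<close>

lemma even_generates:
  assumes X: "degree1 1 0 0 \<in> S" and Y: "degree1 0 1 0 \<in> S" and even: "\<And>d. single (0, 0, d) \<in> S \<Longrightarrow> even d"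
    and G: "coord_subalgebra G" "degree1 1 0 0 \<in> G" "degree1 0 1 0 \<in> G" "single (0, 0, 2) \<in> G" "single (0, 0, -2) \<in> G"
  shows "S \<subseteq> G"
proof -
  \<comment> \<open>Stated for an arbitrary \<open>G'\<close> because it is applied both to S and to
    G.\<close>
  have mon: "single (a, b, d) \<in> G'"
    if G': "coord_subalgebra G'" "degree1 1 0 0 \<in> G'" "degree1 0 1 0 \<in> G'" "single (0, 0, 2) \<in> G'" "single (0, 0, -2) \<in> G'"
      and "even d" for G' a b d
  proof -
    obtain k where d: "d = 2 * k" using \<open>even d\<close> by blast
    have "single (0, 0, d) \<in> G'" unfolding d by (rule S_Kpow_mult[OF G'(1,4,5)])
    then show ?thesis by (rule S_single_X[OF G'(1,2) S_single_Y[OF G'(1,3)]])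
  qed
  note monS = mon[OF S X Y S_contains_K2[OF X Y]] and monG = mon[OF G]
  have "degree_below m v \<Longrightarrow> v \<in> S \<Longrightarrow> v \<in> G" for m v
  proof (induction m arbitrary: v)
    case 0
    then show ?case using degree_below_0 S_zero[OF G(1)] by auto
  next
    case (Suc m)
    let ?t = "\<lambda>(a, b, d). if a + b = m then v (a, b, d) else 0"
    have fin: "finite {i. ?t i \<noteq> 0}"
      by (rule finite_subset[OF _ coord_subalgebraD(4)[OF S Suc.prems(2)]]) (auto split: if_splits)
    have t: "single i \<in> S" "single i \<in> G" if "?t i \<noteq> 0" for i
    proof -
      obtain a b d where i: "i = (a, b, d)" by (cases i)
      have "a + b = m" "v (a, b, d) \<noteq> 0" using that i by (auto split: if_splits)
      then have "even d" using even top_single_Kpow[OF Suc.prems(2)] Suc.prems(1) by blast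
      then show "single i \<in> S" "single i \<in> G" unfolding i by (rule monS monG)+
    qed
    have tS: "?t \<in> S" "?t \<in> G"
      by (rule S_finite_support[OF S fin t(1)] S_finite_support[OF G(1) fin t(2)], assumption)+
    let ?v = "\<lambda>i. v i - 1 * ?t i"
    have vS: "?v \<in> S" using S_diff[OF S Suc.prems(2) tS(1)] by simp
    have "degree_below m ?v"
      using Suc.prems(1) by (auto simp: degree_below_def)
    then have "?v \<in> G" using Suc.IH vS by blast
    then have "(\<lambda>i. ?v i + ?t i) \<in> G" by (rule S_add[OF G(1) _ tS(2)])
    then show ?case by simp
  qed
  then show ?thesis using degree_below_exists coord_subalgebraD(4)[OF S] by blast
qed

text \<open>Outside the two one-sided cases some element involves X and some element involves Y,
  which puts X, Y, K^2 and K^-2 into S. What remains to decide is the parity of the exponents d with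
  K^d in S.\<close>

theorem nontrivial_classification:
  "(\<forall>v\<in>S. \<forall>a b d. v (a, b, d) \<noteq> 0 \<longrightarrow> b = 0) \<or>
   (\<forall>v\<in>S. \<forall>a b d. v (a, b, d) \<noteq> 0 \<longrightarrow> a = 0) \<or>
   (degree1 1 0 0 \<in> S \<and> degree1 0 1 0 \<in> S \<and> single (0, 0, 2) \<in> S \<and> single (0, 0, -2) \<in> S \<and>
     (\<forall>G. coord_subalgebra G \<and> degree1 1 0 0 \<in> G \<and> degree1 0 1 0 \<in> G \<and> single (0, 0, 2) \<in> G \<and> single (0, 0, -2) \<in> G
       \<longrightarrow> S \<subseteq> G)) \<or>
   (\<forall>v. finite {i. v i \<noteq> 0} \<longrightarrow> v \<in> S)"
proof (cases "(\<forall>v\<in>S. \<forall>a b d. v (a, b, d) \<noteq> 0 \<longrightarrow> b = 0) \<or> (\<forall>v\<in>S. \<forall>a b d. v (a, b, d) \<noteq> 0 \<longrightarrow> a = 0)")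
  case False
  then have X: "degree1 1 0 0 \<in> S" and Y: "degree1 0 1 0 \<in> S"
    using S_contains_X S_contains_Y by (blast intro: gr0I)+
  note K2 = S_contains_K2[OF X Y]
  show ?thesis
  proof (cases "\<forall>d. single (0, 0, d) \<in> S \<longrightarrow> even d")
    case True
    then have "S \<subseteq> G" if "coord_subalgebra G" "degree1 1 0 0 \<in> G" "degree1 0 1 0 \<in> G" "single (0, 0, 2) \<in> G" "single (0, 0, -2) \<in> G" for G
      using even_generates[OF X Y _ that] by blast
    then show ?thesis using X Y K2 by blast
  next
    case False
    then obtain d where d: "single (0, 0, d) \<in> S" "odd d" by blast
    then obtain k where "d = 2 * k + 1" by (elim oddE)
    \<comment> \<open>K is the product of K^(2k+1) and (K^2)^(-k).\<close>
    then have "single (0, 0, 1) \<in> S"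
      using S_Kpow_add[OF S d(1) S_Kpow_mult[OF S K2, of "- k"]] by simp
    then have K: "single (0, 0, d) \<in> S" for d
      using S_Kpow_mult[OF S _ neg, of 1 d] by simp
    have "single i \<in> S" for i
    proof -
      obtain a b d where i: "i = (a, b, d)" by (cases i)
      show ?thesis unfolding i by (rule S_single_X[OF S X S_single_Y[OF S Y K]])
    qed
    then have "v \<in> S" if "finite {i. v i \<noteq> 0}" for v using S_finite_support[OF S that] by blast
    then show ?thesis by blast
  qed
qed blast

end

section \<open>Translation from coordinates back to subalgebras of U\<close>

section \<open>The classification\<close>

context quantum_sl2
begin

lemma coord_mem_iff:
  "unital_subalgebra U C \<Longrightarrow> u \<in> carrier U \<Longrightarrow> coord u \<in> coord ` C \<longleftrightarrow> u \<in> C"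
  using unital_subalgebraD(1)[of U C] coord_inject by blast

lemma Kpow_mem:
  assumes "unital_subalgebra U C" "K \<in> C" "L \<in> C"
  shows "Kpow d \<in> C"
proof -
  note D = unital_subalgebraD[OF assms(1)]
  have "g [^]\<^bsub>U\<^esub> n \<in> C" if "g \<in> C" for g and n :: nat
    by (induction n) (use D that in auto)
  then show ?thesis using assms by (simp add: Kpow_def)
qed

text \<open>The support condition is strengthened to one that is stable under products: acting on
  any function supported at a = b = 0 keeps the support there. K and K^-1 satisfy it, and evaluation
  at the coordinates of 1 gives the claim.\<close>

lemma U_zero_support:
  assumes "u \<in> U_zero q" "coord u (a, b, d) \<noteq> 0"
  shows "a = 0 \<and> b = 0"
proof -
  define supp where "supp v \<longleftrightarrow> (\<forall>a b d. a \<noteq> 0 \<or> b \<noteq> 0 \<longrightarrow> v (a, b, d) = 0)" for v :: coords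
  let ?C = "{u \<in> carrier U. \<forall>v. supp v \<longrightarrow> supp (rep u v)}"
  have "unital_subalgebra U ?C"
  proof (rule unital_subalgebraI)
    show "x \<oplus>\<^bsub>U\<^esub> y \<in> ?C" if "x \<in> ?C" "y \<in> ?C" for x y
    proof -
      have "supp (\<lambda>i. v i + w i)" if "supp v" "supp w" for v w using that by (simp add: supp_def)
      then show ?thesis using that by (simp add: rep_ops)
    qed
    show "c \<odot>\<^bsub>U\<^esub> x \<in> ?C" if "x \<in> ?C" for c x
    proof -
      have "supp (\<lambda>i. c * v i)" if "supp v" for v using that by (simp add: supp_def)
      then show ?thesis using that by (simp add: rep_ops)
    qed
  qed (auto simp: rep_ops)
  moreover have "{K, L} \<subseteq> ?C" by (auto simp: rep supp_def ops_def)
  ultimately have "U_zero q \<subseteq> ?C" unfolding U_zero_def by (rule generated_subalgebra_minimal)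
  then have "u \<in> ?C" by (rule subsetD) (rule assms(1))
  moreover have "supp (single (0, 0, 0))" by (simp add: supp_def single_eq)
  ultimately show ?thesis using assms(2) unfolding coord_def supp_def by blast
qed

lemma generated_memI:
  "(\<And>C. unital_subalgebra U C \<Longrightarrow> Z \<subseteq> C \<Longrightarrow> u \<in> C) \<Longrightarrow> u \<in> generated_subalgebra U Z"
  unfolding generated_subalgebra_def hull_def by blast

lemma Kpow_U_zero: "Kpow d \<in> U_zero q"
  unfolding U_zero_def by (rule generated_memI) (auto intro: Kpow_mem)

lemma mem_of_support:
  assumes C: "unital_subalgebra U C" and u: "u \<in> carrier U" "\<And>i. coord u i \<noteq> 0 \<Longrightarrow> single i \<in> coord ` C"
  shows "u \<in> C"
proof -
  have "coord_subalgebra (coord ` C)" using C by (auto simp: coord_subalgebra_def)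
  then have "coord u \<in> coord ` C" using S_finite_support finite_coord[OF u(1)] u(2) by blast
  then show ?thesis using coord_mem_iff[OF C u(1)] by simp
qed

text \<open>Any subalgebra containing E, K and K^-1 contains X = E K^-1 and hence every X^a K^d, so
  it contains all elements supported on b = 0.\<close>

lemma U_ge0_memI:
  assumes "u \<in> carrier U" "\<And>a b d. coord u (a, b, d) \<noteq> 0 \<Longrightarrow> b = 0"
  shows "u \<in> U_ge0 q"
  unfolding U_ge0_def
proof (rule generated_memI)
  fix C assume C: "unital_subalgebra U C" "{E, K, L} \<subseteq> C"
  have S: "coord_subalgebra (coord ` C)" using C by (auto simp: coord_subalgebra_def)
  have "X \<in> C" using C unital_subalgebraD(6)[OF C(1)] by auto
  then have "coord X \<in> coord ` C" by (rule imageI)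
  then have X: "degree1 1 0 0 \<in> coord ` C" by (simp only: coord_gens) (simp add: degree1_def)
  have "single (0, 0, d) \<in> coord ` C" for d
    using imageI[OF Kpow_mem[OF C(1), of d], of coord] C(2) by (simp add: coord_Kpow)
  then have mem: "single (a, 0, d) \<in> coord ` C" for a d by (rule S_single_X[OF S X])
  show "u \<in> C"
  proof (rule mem_of_support[OF C(1) assms(1)])
    show "single i \<in> coord ` C" if "coord u i \<noteq> 0" for i
      using that assms(2) mem by (cases i) blast
  qed
qed

lemma U_le0_memI:
  assumes "u \<in> carrier U" "\<And>a b d. coord u (a, b, d) \<noteq> 0 \<Longrightarrow> a = 0"
  shows "u \<in> U_le0 q"
  unfolding U_le0_def
proof (rule generated_memI)
  fix C assume C: "unital_subalgebra U C" "{Y, K, L} \<subseteq> C"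
  have S: "coord_subalgebra (coord ` C)" using C by (auto simp: coord_subalgebra_def)
  have "coord Y \<in> coord ` C" using C by auto
  then have Y: "degree1 0 1 0 \<in> coord ` C" by (simp only: coord_gens) (simp add: degree1_def)
  have "single (0, 0, d) \<in> coord ` C" for d
    using imageI[OF Kpow_mem[OF C(1), of d], of coord] C(2) by (simp add: coord_Kpow)
  then have mem: "single (0, b, d) \<in> coord ` C" for b d by (rule S_single_Y[OF S Y])
  show "u \<in> C"
  proof (rule mem_of_support[OF C(1) assms(1)])
    show "single i \<in> coord ` C" if "coord u i \<noteq> 0" for i
      using that assms(2) mem by (cases i) blast
  qed
qed

text \<open>Transports generation to coordinates: the assumption \<open>gen\<close> has the form in
  which both classifications describe S by means of all G containing the generators.\<close>

lemma generated_eqI: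
  assumes C: "unital_subalgebra U C" and Z: "Z \<subseteq> carrier U" "\<And>z. z \<in> Z \<Longrightarrow> coord z \<in> coord ` C"
    and gen: "\<And>G. coord_subalgebra G \<Longrightarrow> coord ` Z \<subseteq> G \<Longrightarrow> coord ` C \<subseteq> G"
  shows "C = generated_subalgebra U Z"
proof
  have "Z \<subseteq> C" using Z coord_mem_iff[OF C] by blast
  then show "generated_subalgebra U Z \<subseteq> C" by (rule generated_subalgebra_minimal[OF C])
  show "C \<subseteq> generated_subalgebra U Z"
  proof (rule subsetI, rule generated_memI)
    fix u D assume u: "u \<in> C" and D: "unital_subalgebra U D" "Z \<subseteq> D"
    have "coord ` C \<subseteq> coord ` D"
      by (rule gen) (use D in \<open>auto simp: coord_subalgebra_def\<close>)
    then show "u \<in> D"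
      using u coord_mem_iff[OF D(1), of u] unital_subalgebraD(1)[OF C] by blast
  qed
qed

text \<open>Each closure condition is \<open>coideal_dcoord\<close> for one of the coefficient
  functionals at K^e, X K^e and Y K^e.\<close>

lemma coideal_coords_image:
  assumes C: "right_coideal_subalgebra U \<Delta> C"
  shows "coideal_coords q (coord ` C)"
proof (intro coideal_coords.intro coideal_coords_axioms.intro quantum_sl2_axioms)
  have sub: "unital_subalgebra U C" using C by (simp add: right_coideal_subalgebra_def)
  then show "coord_subalgebra (coord ` C)" by (auto simp: coord_subalgebra_def)
  fix v e assume "v \<in> coord ` C"
  then obtain u where u: "u \<in> C" "v = coord u" by auto
  have uU: "u \<in> carrier U" using u unital_subalgebraD(1)[OF sub] by auto
  note d = coideal_dcoord[OF C u(1)]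
  have "(\<lambda>(a, b, d). if e = d - int a - int b then v (a, b, d) else 0) = (\<lambda>i. dcoord u i (0, 0, e))" (is "?P = _")
    "(\<lambda>(a, b, d). if e = d - int a - int b then qnum (1 / p) (Suc a) * v (Suc a, b, d) else 0) =
      (\<lambda>i. dcoord u i (Suc 0, 0, e))" (is "?X = _")
    "(\<lambda>(a, b, d). if e = d - int a - int b then p ^ a * qnum p (Suc b) * v (a, Suc b, d) else 0) =
      (\<lambda>i. dcoord u i (0, Suc 0, e))" (is "?Y = _")
    by (auto simp: fun_eq_iff dcoord_eq[OF uU] u(2))
  then show "?P \<in> coord ` C" "?X \<in> coord ` C" "?Y \<in> coord ` C"
    using d by simp_all
qed

theorem coideal_classification:
  assumes C: "right_coideal_subalgebra U \<Delta> C"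
    and H: "hopf_subalgebra U \<Delta> (Uq_antipode q) (C \<inter> U_zero q)"
  shows "(C \<inter> U_zero q = {c \<odot>\<^bsub>U\<^esub> \<one>\<^bsub>U\<^esub> | c. True} \<longrightarrow>
        C \<subseteq> U_ge0 q \<or> C \<subseteq> U_le0 q \<or>
        (\<exists>l l'. C = generated_subalgebra U {element 1 l l'}) \<or>
        (\<exists>l l'. l * l' = q\<^sup>2 / ((1 - q\<^sup>2) * (q - inverse q)) \<and>
           C = generated_subalgebra U {element 1 0 l, element 0 1 l'})) \<and>
     (C \<inter> U_zero q \<noteq> {c \<odot>\<^bsub>U\<^esub> \<one>\<^bsub>U\<^esub> | c. True} \<longrightarrow>
        C \<subseteq> U_ge0 q \<or> C \<subseteq> U_le0 q \<or>
        C = generated_subalgebra U {X, K \<otimes>\<^bsub>U\<^esub> K, L \<otimes>\<^bsub>U\<^esub> L, Y} \<or>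
        C = carrier U)"
proof -
  let ?S = "coord ` C"
  have sub: "unital_subalgebra U C" using C by (simp add: right_coideal_subalgebra_def)
  note D = unital_subalgebraD[OF sub]
  interpret S: coideal_coords q ?S by (rule coideal_coords_image[OF C])
  have ge0: "C \<subseteq> U_ge0 q" if "\<forall>v\<in>?S. \<forall>a b d. v (a, b, d) \<noteq> 0 \<longrightarrow> b = 0"
    using that D(1) by (intro subsetI U_ge0_memI) auto
  have le0: "C \<subseteq> U_le0 q" if "\<forall>v\<in>?S. \<forall>a b d. v (a, b, d) \<noteq> 0 \<longrightarrow> a = 0"
    using that D(1) by (intro subsetI U_le0_memI) auto
  have Kpow: "Kpow d \<in> C \<inter> U_zero q" if "single (0, 0, d) \<in> ?S" for d
    using that coord_mem_iff[OF sub, of "Kpow d"] Kpow_U_zero by (simp add: coord_Kpow)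
  have scalar: "coord (c \<odot>\<^bsub>U\<^esub> \<one>\<^bsub>U\<^esub>) = (\<lambda>i. c * single (0, 0, 0) i)" for c
    by (simp add: coord_ops)
  show ?thesis
  proof (intro conjI impI)
    assume triv: "C \<inter> U_zero q = {c \<odot>\<^bsub>U\<^esub> \<one>\<^bsub>U\<^esub> | c. True}"
    interpret S: coideal_coords_trivial q ?S
    proof
      fix d assume "single (0, 0, d) \<in> ?S"
      \<comment> \<open>K^d lies in the Cartan part of C and is therefore a scalar; comparing
        coordinates leaves d = 0.\<close>
      then have "Kpow d \<in> {c \<odot>\<^bsub>U\<^esub> \<one>\<^bsub>U\<^esub> | c. True}" using Kpow unfolding triv by simp
      then obtain c where c: "Kpow d = c \<odot>\<^bsub>U\<^esub> \<one>\<^bsub>U\<^esub>" by auto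
      have "single (0, 0, d) = coord (Kpow d)" by (simp only: coord_Kpow)
      also have "\<dots> = (\<lambda>i. c * single (0, 0, 0) i)" unfolding c by (rule scalar)
      finally show "d = 0" by (auto simp: single_eq fun_eq_iff dest: spec[of _ "0::nat"] split: if_splits)
    qed
    have line: "C = generated_subalgebra U {element 1 l l'}"
      if "degree1 1 l l' \<in> ?S" "\<forall>G. coord_subalgebra G \<and> degree1 1 l l' \<in> G \<longrightarrow> ?S \<subseteq> G" for l l'
      by (rule generated_eqI[OF sub]) (use that in \<open>auto simp: coord_element\<close>)
    have plane: "C = generated_subalgebra U {element 1 0 l, element 0 1 l'}"
      if "degree1 1 0 l \<in> ?S" "degree1 0 1 l' \<in> ?S"
        "\<forall>G. coord_subalgebra G \<and> degree1 1 0 l \<in> G \<and> degree1 0 1 l' \<in> G \<longrightarrow> ?S \<subseteq> G" for l l'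
      by (rule generated_eqI[OF sub]) (use that in \<open>auto simp: coord_element\<close>)
    from S.trivial_classification
    show "C \<subseteq> U_ge0 q \<or> C \<subseteq> U_le0 q \<or>
        (\<exists>l l'. C = generated_subalgebra U {element 1 l l'}) \<or>
        (\<exists>l l'. l * l' = q\<^sup>2 / ((1 - q\<^sup>2) * (q - inverse q)) \<and>
           C = generated_subalgebra U {element 1 0 l, element 0 1 l'})"
    proof (elim disjE exE conjE)
      fix l l'
      assume "degree1 1 l l' \<in> ?S" "\<forall>G. coord_subalgebra G \<and> degree1 1 l l' \<in> G \<longrightarrow> ?S \<subseteq> G"
      from line[OF this] show ?thesis by iprover
    next
      fix l l'
      assume *: "l * l' = q\<^sup>2 / ((1 - q\<^sup>2) * (q - inverse q))"
      assume "degree1 1 0 l \<in> ?S" "degree1 0 1 l' \<in> ?S"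
        "\<forall>G. coord_subalgebra G \<and> degree1 1 0 l \<in> G \<and> degree1 0 1 l' \<in> G \<longrightarrow> ?S \<subseteq> G"
      from * plane[OF this] show ?thesis by iprover
    qed (use ge0 le0 in iprover)+
  next
    assume nontriv: "C \<inter> U_zero q \<noteq> {c \<odot>\<^bsub>U\<^esub> \<one>\<^bsub>U\<^esub> | c. True}"
    have "unital_subalgebra U (C \<inter> U_zero q)" using H by (simp add: hopf_subalgebra_def)
    from unital_subalgebraD(5)[OF this unital_subalgebraD(3)[OF this]]
    have "{c \<odot>\<^bsub>U\<^esub> \<one>\<^bsub>U\<^esub> | c. True} \<subseteq> C \<inter> U_zero q" by fast
    with nontriv obtain u where "u \<in> C \<inter> U_zero q" "u \<notin> {c \<odot>\<^bsub>U\<^esub> \<one>\<^bsub>U\<^esub> | c. True}" by fast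
    then have u: "u \<in> C" "u \<in> U_zero q" "\<And>c. u \<noteq> c \<odot>\<^bsub>U\<^esub> \<one>\<^bsub>U\<^esub>" by fast+
    \<comment> \<open>An element of the Cartan part with no coefficient away from K^0 would be a
      scalar.\<close>
    have "\<exists>d. d \<noteq> 0 \<and> coord u (0, 0, d) \<noteq> 0"
    proof (rule ccontr)
      assume *: "\<not> ?thesis"
      have "coord u = coord (coord u (0, 0, 0) \<odot>\<^bsub>U\<^esub> \<one>\<^bsub>U\<^esub>)"
      proof
        fix i :: "nat \<times> nat \<times> int"
        obtain a b d where "i = (a, b, d)" by (cases i)
        then show "coord u i = coord (coord u (0, 0, 0) \<odot>\<^bsub>U\<^esub> \<one>\<^bsub>U\<^esub>) i"
          using * U_zero_support[OF u(2), of a b d] unfolding scalar by (auto simp: single_eq)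
      qed
      then have "u = coord u (0, 0, 0) \<odot>\<^bsub>U\<^esub> \<one>\<^bsub>U\<^esub>" using u(1) D(1) by (intro coord_inject) auto
      then show False using u(3) by blast
    qed
    then obtain d0 where d0: "d0 \<noteq> 0" "coord u (0, 0, d0) \<noteq> 0" by blast
    interpret S: coideal_coords_nontrivial q ?S
    proof
      \<comment> \<open>All coordinates of \<open>u\<close> have a = b = 0, so the grading isolates
        K^d0.\<close>
      have "single (0, 0, d0) \<in> ?S"
        by (rule S.S_single_Kpow[of "coord u"]) (use u U_zero_support d0 in blast)+
      then show "\<exists>d. d \<noteq> 0 \<and> single (0, 0, d) \<in> ?S" using d0 by blast
      fix d assume "single (0, 0, d) \<in> ?S"
      \<comment> \<open>The Hopf hypothesis supplies the inverse: the intersection is stable under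
        the antipode, which sends K^d to K^-d.\<close>
      then have "Uq_antipode q (Kpow d) \<in> C"
        using Kpow H unfolding hopf_subalgebra_def by blast
      then have "coord (Kpow (- d)) \<in> ?S" by (simp add: antipode_Kpow)
      then show "single (0, 0, - d) \<in> ?S" by (simp add: coord_Kpow)
    qed
    have gens: "coord X = degree1 1 0 0" "coord Y = degree1 0 1 0" "coord (K \<otimes>\<^bsub>U\<^esub> K) = single (0, 0, 2)"
      "coord (L \<otimes>\<^bsub>U\<^esub> L) = single (0, 0, -2)"
    proof -
      show "coord X = degree1 1 0 0" "coord Y = degree1 0 1 0" unfolding coord_gens by (simp_all add: degree1_def)
      show "coord (K \<otimes>\<^bsub>U\<^esub> K) = single (0, 0, 2)" "coord (L \<otimes>\<^bsub>U\<^esub> L) = single (0, 0, -2)"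
        by (simp_all add: coord_ops coord_gens rep ops_single)
    qed
    from S.nontrivial_classification
    show "C \<subseteq> U_ge0 q \<or> C \<subseteq> U_le0 q \<or>
        C = generated_subalgebra U {X, K \<otimes>\<^bsub>U\<^esub> K, L \<otimes>\<^bsub>U\<^esub> L, Y} \<or> C = carrier U"
    proof (elim disjE conjE)
      assume gen: "degree1 1 0 0 \<in> ?S" "degree1 0 1 0 \<in> ?S" "single (0, 0, 2) \<in> ?S" "single (0, 0, -2) \<in> ?S"
        "\<forall>G. coord_subalgebra G \<and> degree1 1 0 0 \<in> G \<and> degree1 0 1 0 \<in> G \<and> single (0, 0, 2) \<in> G \<and> single (0, 0, -2) \<in> G
          \<longrightarrow> ?S \<subseteq> G"
      have "C = generated_subalgebra U {X, K \<otimes>\<^bsub>U\<^esub> K, L \<otimes>\<^bsub>U\<^esub> L, Y}"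
      proof (rule generated_eqI[OF sub])
        show "coord z \<in> ?S" if "z \<in> {X, K \<otimes>\<^bsub>U\<^esub> K, L \<otimes>\<^bsub>U\<^esub> L, Y}" for z
          using that gen(1-4) gens by (elim insertE emptyE) simp_all
        show "?S \<subseteq> G" if "coord_subalgebra G" "coord ` {X, K \<otimes>\<^bsub>U\<^esub> K, L \<otimes>\<^bsub>U\<^esub> L, Y} \<subseteq> G" for G
        proof -
          have "coord X \<in> G" "coord Y \<in> G" "coord (K \<otimes>\<^bsub>U\<^esub> K) \<in> G" "coord (L \<otimes>\<^bsub>U\<^esub> L) \<in> G"
            using that(2) by blast+
          then show ?thesis using gen(5) that(1) unfolding gens by blast
        qed
      qed auto
      then show ?thesis by iprover
    next
      assume "\<forall>v. finite {i. v i \<noteq> 0} \<longrightarrow> v \<in> ?S"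
      then have "carrier U \<subseteq> C" using finite_coord coord_mem_iff[OF sub] by blast
      then have "C = carrier U" using D(1) by blast
      then show ?thesis by iprover
    qed (use ge0 le0 in iprover)+
  qed
qed

end

theorem mainTheorem3:
  fixes q :: complex and C :: "uq set"
  assumes q_nonzero: "q \<noteq> 0"
    and q_not_root_of_unity: "\<And>n::nat. n > 0 \<Longrightarrow> q ^ n \<noteq> 1"
    and C_coideal: "right_coideal_subalgebra (Uq q) (Uq_comult q) C"
    and C_Hopf: "hopf_subalgebra (Uq q) (Uq_comult q) (Uq_antipode q) (C \<inter> U_zero q)"
  shows
    "(C \<inter> U_zero q = {c \<odot>\<^bsub>Uq q\<^esub> \<one>\<^bsub>Uq q\<^esub> | c. True} \<longrightarrow>
        C \<subseteq> U_ge0 q \<or>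
        C \<subseteq> U_le0 q \<or>
        (\<exists>l l'. C = generated_subalgebra (Uq q)
           {UE q \<otimes>\<^bsub>Uq q\<^esub> UKinv q \<oplus>\<^bsub>Uq q\<^esub> l \<odot>\<^bsub>Uq q\<^esub> UF q \<oplus>\<^bsub>Uq q\<^esub> l' \<odot>\<^bsub>Uq q\<^esub> UKinv q}) \<or>
        (\<exists>l l'. l * l' = q^2 / ((1 - q^2) * (q - inverse q)) \<and>
           C = generated_subalgebra (Uq q)
             {UE q \<otimes>\<^bsub>Uq q\<^esub> UKinv q \<oplus>\<^bsub>Uq q\<^esub> l \<odot>\<^bsub>Uq q\<^esub> UKinv q,
              UF q \<oplus>\<^bsub>Uq q\<^esub> l' \<odot>\<^bsub>Uq q\<^esub> UKinv q})) \<and>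
     (C \<inter> U_zero q \<noteq> {c \<odot>\<^bsub>Uq q\<^esub> \<one>\<^bsub>Uq q\<^esub> | c. True} \<longrightarrow>
        C \<subseteq> U_ge0 q \<or>
        C \<subseteq> U_le0 q \<or>
        C = generated_subalgebra (Uq q)
          {UE q \<otimes>\<^bsub>Uq q\<^esub> UKinv q,
           UK q \<otimes>\<^bsub>Uq q\<^esub> UK q,
           UKinv q \<otimes>\<^bsub>Uq q\<^esub> UKinv q,
           UF q} \<or>
        C = carrier (Uq q))"
proof -
  interpret quantum_sl2 q using q_nonzero q_not_root_of_unity by unfold_locales
  have "element 1 l l' = X \<oplus>\<^bsub>U\<^esub> l \<odot>\<^bsub>U\<^esub> Y \<oplus>\<^bsub>U\<^esub> l' \<odot>\<^bsub>U\<^esub> L"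
    "element 1 0 l = X \<oplus>\<^bsub>U\<^esub> l \<odot>\<^bsub>U\<^esub> L" "element 0 1 l = Y \<oplus>\<^bsub>U\<^esub> l \<odot>\<^bsub>U\<^esub> L" for l l'
    by (simp_all add: element_def)
  then show ?thesis using coideal_classification[OF C_coideal C_Hopf] by simp
qed

end
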